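(* Let $E \subseteq \mathbb{C}$ be compact, and suppose that there exists a sequence $(E_k)_{k \in \mathbb{N}}$ of compact subsets of $E$ with the following properties, where $\Omega_k$ and $\Omega$ denote the unbounded components (the components containing $\infty$) of $\mathbb{C}_\infty \setminus E_k$ and $\mathbb{C}_\infty \setminus E$ respectively: (i) every $E_k$ has finite Painlevé length; (ii) there exists an integer $m$ such that $\Omega$ and every $\Omega_k$ are nondegenerate $m$-connected domains; (iii) the sequence of domains $(\Omega_k)_{k \in \mathbb{N}}$ converges to $\Omega$ in the sense of Carathéodory. Then $\gamma(E)=\gamma_c(E)$.
   Context: $\mathbb{C}_\infty$ is the Riemann sphere. Analytic capacity: for $E\subseteq\mathbb{C}$ compact, let $\Omega$ be the component of $\mathbb{C}_\infty\setminus E$ containing $\infty$, and let $H^\infty(\Omega)$ be the class of bounded holomorphic functions on $\Omega$. Then $\gamma(E):=\sup\{|f'(\infty)| : f\in H^\infty(\Omega),\ |f|\le 1\}$, where $f'(\infty):=\lim_{z\to\infty} z(f(z)-f(\infty))$. Cauchy capacity: $\gamma_c(E):=\sup\{|\mu(E)|\}$, the supremum being over all finite complex Borel measures $\mu$ supported on $E$ such that $|\mathcal{C}_\mu|\le 1$ on $\mathbb{C}_\infty\setminus E$, where $\mathcal{C}_\mu(z):=\int \frac{1}{\xi-z}\,d\mu(\xi)$ is the Cauchy transform of $\mu$ (with $\mathcal{C}_\mu(\infty)=0$). Finite Painlevé length: a compact set $E$ has finite Painlevé length if there is a number $l$ such that every open set $U$ with $E\subseteq U$ contains a cycle $\Gamma$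 surrounding $E$ that consists of finitely many disjoint analytic Jordan curves and has length less than $l$. Nondegenerate $m$-connected domain: a domain in $\mathbb{C}_\infty$ whose complement in $\mathbb{C}_\infty$ has exactly $m$ connected components, each containing more than one point. Carathéodory convergence: let $(\Omega_k)$ be a sequence of domains in $\mathbb{C}_\infty$, each containing $\infty$. The kernel of $(\Omega_k)$ (with respect to $\infty$) is the largest domain $\Omega$ containing $\infty$ such that for every compact $K\subseteq\Omega$ there is $k_0$ with $K\subseteq\Omega_k$ for all $k\ge k_0$, if such a domain exists (otherwise the kernel does not exist). The sequence $(\Omega_k)$ converges to $\Omega$ in the sense of Carathéodory if $\Omega$ is the kernel of every subsequence of $(\Omega_k)$. *)

theory Defs
  imports "HOL-Complex_Analysis.Complex_Analysis"
begin

section \<open>The Riemann sphere\<close>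

text \<open>Here \<open>None\<close> is the point at infinity and \<open>Some z\<close> is the finite point \<open>z\<close>.\<close>

definition riemann_sphere :: "complex option topology" where
  "riemann_sphere = Alexandroff_compactification euclidean"

definition sphere_domain :: "complex option set \<Rightarrow> bool" where
  "sphere_domain \<Omega> \<longleftrightarrow> \<Omega> \<noteq> {} \<and> openin riemann_sphere \<Omega> \<and> connectedin riemann_sphere \<Omega>"

definition outer_domain :: "complex set \<Rightarrow> complex option set" where
  "outer_domain E = connected_component_of_set (subtopology riemann_sphere (- Some ` E)) None"

text \<open>The coordinate \<open>w = 1/z\<close> near infinity. Together with \<open>Some\<close> it covers the sphere.\<close>

definition chart_at_infinity :: "complex \<Rightarrow> complex option" where
  "chart_at_infinity w = (if w = 0 then None else Some (inverse w))"

definition sphere_holomorphic_on ::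
    "(complex option \<Rightarrow> complex) \<Rightarrow> complex option set \<Rightarrow> bool" where
  "sphere_holomorphic_on f \<Omega> \<longleftrightarrow>
     (f \<circ> Some) holomorphic_on (Some -` \<Omega>) \<and>
     (f \<circ> chart_at_infinity) holomorphic_on (chart_at_infinity -` \<Omega>)"


section \<open>Analytic capacity\<close>

definition H_infinity :: "complex option set \<Rightarrow> (complex option \<Rightarrow> complex) set" where
  "H_infinity \<Omega> = {f. sphere_holomorphic_on f \<Omega> \<and> bounded (f ` \<Omega>)}"

definition deriv_at_infinity :: "(complex option \<Rightarrow> complex) \<Rightarrow> complex" where
  "deriv_at_infinity f = Lim at_infinity (\<lambda>z. z * (f (Some z) - f None))"

text \<open>Both capacities are suprema in the extended reals, so that no boundedness of the set
  of competitors is presupposed.\<close>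

definition analytic_capacity :: "complex set \<Rightarrow> ereal" where
  "analytic_capacity E =
     (SUP f\<in>{f \<in> H_infinity (outer_domain E). \<forall>z\<in>outer_domain E. cmod (f z) \<le> 1}.
        ereal (cmod (deriv_at_infinity f)))"


section \<open>Complex measures and Cauchy capacity\<close>

text \<open>A complex measure is a countably additive complex-valued function on the Borel sets; it
  is automatically finite, and the case of constantly empty \<open>A\<close> forces \<open>\<nu> {} = 0\<close>.
  Values of \<open>\<nu>\<close> on non-Borel sets are irrelevant.\<close>

definition complex_borel_measure :: "(complex set \<Rightarrow> complex) \<Rightarrow> bool" where
  "complex_borel_measure \<nu> \<longleftrightarrow>
     (\<forall>A::nat \<Rightarrow> complex set. range A \<subseteq> sets borel \<longrightarrow> disjoint_family A \<longrightarrow>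
        (\<lambda>n. \<nu> (A n)) sums \<nu> (\<Union>n. A n))"

definition supported_on :: "(complex set \<Rightarrow> complex) \<Rightarrow> complex set \<Rightarrow> bool" where
  "supported_on \<nu> E \<longleftrightarrow> (\<forall>A\<in>sets borel. A \<inter> E = {} \<longrightarrow> \<nu> A = 0)"

text \<open>The positive part in the Jordan decomposition of a finite signed Borel measure \<open>\<sigma>\<close>.
  Negative values of \<open>\<sigma> B\<close> are truncated to \<open>0\<close> by \<open>ennreal\<close>; this does not
  change the supremum, because \<open>B = {}\<close> contributes \<open>0\<close>.\<close>

definition positive_variation :: "(complex set \<Rightarrow> real) \<Rightarrow> complex measure" where
  "positive_variation \<sigma> =
     measure_of UNIV (sets borel) (\<lambda>A. SUP B\<in>{B \<in> sets borel. B \<subseteq> A}. ennreal (\<sigma> B))"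

definition signed_integral ::
    "(complex set \<Rightarrow> real) \<Rightarrow> (complex \<Rightarrow> complex) \<Rightarrow> complex" where
  "signed_integral \<sigma> f =
     (LINT x|positive_variation \<sigma>. f x) - (LINT x|positive_variation (\<lambda>A. - \<sigma> A). f x)"

definition complex_measure_integral ::
    "(complex set \<Rightarrow> complex) \<Rightarrow> (complex \<Rightarrow> complex) \<Rightarrow> complex" where
  "complex_measure_integral \<nu> f =
     signed_integral (\<lambda>A. Re (\<nu> A)) f + \<i> * signed_integral (\<lambda>A. Im (\<nu> A)) f"

definition cauchy_transform ::
    "(complex set \<Rightarrow> complex) \<Rightarrow> complex option \<Rightarrow> complex" where
  "cauchy_transform \<nu> p =
     (case p of None \<Rightarrow> 0 | Some z \<Rightarrow> complex_measure_integral \<nu> (\<lambda>\<xi>. 1 / (\<xi> - z)))"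

definition cauchy_capacity :: "complex set \<Rightarrow> ereal" where
  "cauchy_capacity E =
     (SUP \<nu>\<in>{\<nu>. complex_borel_measure \<nu> \<and> supported_on \<nu> E \<and>
                  (\<forall>z\<in>- Some ` E. cmod (cauchy_transform \<nu> z) \<le> 1)}.
        ereal (cmod (\<nu> E)))"


section \<open>Finite Painleve length\<close>

text \<open>Both orientations are covered: precomposing \<open>\<phi>\<close> with \<open>z \<mapsto> 1/z\<close> (after shrinking
  \<open>A\<close> to avoid \<open>0\<close>) reverses the curve.\<close>

definition analytic_jordan_curve :: "(real \<Rightarrow> complex) \<Rightarrow> bool" where
  "analytic_jordan_curve \<gamma> \<longleftrightarrow>
     (\<exists>\<phi> A. open A \<and> sphere 0 1 \<subseteq> A \<and> \<phi> holomorphic_on A \<and> inj_on \<phi> A \<and>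
            \<gamma> = \<phi> \<circ> circlepath 0 1)"

definition curve_length :: "(real \<Rightarrow> complex) \<Rightarrow> real" where
  "curve_length \<gamma> = integral {0..1} (\<lambda>t. norm (vector_derivative \<gamma> (at t)))"

text \<open>Orientations are part of the parametrizations, so nested curves may enter a cycle with
  opposite signs. Surrounding \<open>E\<close> means winding number \<open>1\<close> about every point of
  \<open>E\<close>; nothing is required of the winding number about other points.\<close>

definition jordan_cycle :: "(real \<Rightarrow> complex) set \<Rightarrow> bool" where
  "jordan_cycle \<Gamma> \<longleftrightarrow> finite \<Gamma> \<and> (\<forall>\<gamma>\<in>\<Gamma>. analytic_jordan_curve \<gamma>) \<and>
     pairwise (\<lambda>\<gamma> \<delta>. disjnt (path_image \<gamma>) (path_image \<delta>)) \<Gamma>"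

definition surrounds :: "(real \<Rightarrow> complex) set \<Rightarrow> complex set \<Rightarrow> bool" where
  "surrounds \<Gamma> E \<longleftrightarrow> (\<forall>\<gamma>\<in>\<Gamma>. path_image \<gamma> \<inter> E = {}) \<and>
     (\<forall>z\<in>E. (\<Sum>\<gamma>\<in>\<Gamma>. winding_number \<gamma> z) = 1)"

definition finite_painleve_length :: "complex set \<Rightarrow> bool" where
  "finite_painleve_length E \<longleftrightarrow> compact E \<and>
     (\<exists>l::real. \<forall>U. open U \<longrightarrow> E \<subseteq> U \<longrightarrow>
        (\<exists>\<Gamma>. jordan_cycle \<Gamma> \<and> (\<forall>\<gamma>\<in>\<Gamma>. path_image \<gamma> \<subseteq> U) \<and> surrounds \<Gamma> E \<and>
             (\<Sum>\<gamma>\<in>\<Gamma>. curve_length \<gamma>) < l))"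


section \<open>Nondegenerate domains and Caratheodory convergence\<close>

definition nondegenerate_connected_domain :: "nat \<Rightarrow> complex option set \<Rightarrow> bool" where
  "nondegenerate_connected_domain m \<Omega> \<longleftrightarrow> sphere_domain \<Omega> \<and>
     (let \<C> = connected_components_of (subtopology riemann_sphere (- \<Omega>))
      in finite \<C> \<and> card \<C> = m \<and> (\<forall>C\<in>\<C>. \<exists>x\<in>C. \<exists>y\<in>C. x \<noteq> y))"

definition eventually_absorbed ::
    "(nat \<Rightarrow> complex option set) \<Rightarrow> complex option set \<Rightarrow> bool" where
  "eventually_absorbed \<Omega>s \<Omega> \<longleftrightarrow>
     (\<forall>K. compactin riemann_sphere K \<longrightarrow> K \<subseteq> \<Omega> \<longrightarrow> (\<exists>k0. \<forall>k\<ge>k0. K \<subseteq> \<Omega>s k))"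

text \<open>The kernel with respect to infinity, as a relation since it need not exist.\<close>

definition is_kernel :: "(nat \<Rightarrow> complex option set) \<Rightarrow> complex option set \<Rightarrow> bool" where
  "is_kernel \<Omega>s \<Omega> \<longleftrightarrow>
     sphere_domain \<Omega> \<and> None \<in> \<Omega> \<and> eventually_absorbed \<Omega>s \<Omega> \<and>
     (\<forall>\<Omega>'. sphere_domain \<Omega>' \<and> None \<in> \<Omega>' \<and> eventually_absorbed \<Omega>s \<Omega>' \<longrightarrow> \<Omega>' \<subseteq> \<Omega>)"

definition caratheodory_converges ::
    "(nat \<Rightarrow> complex option set) \<Rightarrow> complex option set \<Rightarrow> bool" where
  "caratheodory_converges \<Omega>s \<Omega> \<longleftrightarrow>
     (\<forall>r::nat \<Rightarrow> nat. strict_mono r \<longrightarrow> is_kernel (\<Omega>s \<circ> r) \<Omega>)"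

end

theory Submission
  imports Defs "HOL-Probability.Probability"
begin

text \<open>Cauchy transforms of admissible measures are admissible functions, which gives
  \<open>\<gamma>\<^sub>c \<le> \<gamma>\<close>. If \<open>F\<close> has finite Painleve length, every bounded holomorphic function
  \<open>f\<close> on the outer domain with \<open>f(\<infinity>) = 0\<close> is the Cauchy transform of a weak limit of the measures
  \<open>f dz\<close> on cycles of bounded length shrinking to \<open>F\<close>; so \<open>\<gamma>(E\<^sub>k) = \<gamma>\<^sub>c(E\<^sub>k)\<close>, and it remains to
  show that \<open>\<gamma>(E)\<close> is at most the limit inferior of \<open>\<gamma>(E\<^sub>k)\<close>. Kernel convergence and equal connectivity
  match each component \<open>L\<close> of the complement of \<open>\<Omega>\<close> with exactly one component of the complement
  of \<open>\<Omega>\<^sub>k\<close>, contained in \<open>L\<close>, and the Riemann maps of their exteriors converge. Given an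
  admissible \<open>f\<close> on \<open>\<Omega>\<close>, the components are replaced one at a time: near \<open>L\<close> the function \<open>f\<close> is
  precomposed with the nearly identical conformal map between the exteriors, and it is kept away
  from \<open>L\<close>; on an annulus the two functions differ by a small function, which is split by
  Cauchy integrals into a part holomorphic inside and a part holomorphic outside.\<close>

section \<open>Finite signed Borel measures\<close>

text \<open>Each \<open>\<Omega>\<^sub>k\<close> contains \<open>\<Omega>\<close>, so an admissible
  function for \<open>E\<close> is in general not defined on all of \<open>\<Omega>\<^sub>k\<close>;
  the replacement has to bridge this gap. The error of the additive splitting is measured on two
  fixed level curves of a Riemann map, away from all boundaries. Nondegeneracy enters as two
  distinct boundary points of \<open>L\<close>: they keep the smaller continua from shrinking to a
  point, which through Schottky's theorem makes the inverse Riemann maps a normal family. The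
  competitors for \<open>\<gamma>\<^sub>c\<close> are tested on the whole complement of the set,
  bounded components included; the cycles are therefore pruned to the curves in the unbounded
  component, and the resulting transforms vanish in the bounded ones. A Cauchy transform vanishes at
  infinity, whereas the glued functions keep the value of \<open>f\<close> there, so a disc
  automorphism is interposed. The excess of the bounds over 1 is removed by division by
  \<open>1 + e\<close>, and of the coefficient at infinity only a lower bound for its modulus is
  carried along.\<close>

definition signed_borel_measure :: "(complex set \<Rightarrow> real) \<Rightarrow> bool" where
  "signed_borel_measure \<sigma> \<longleftrightarrow>
     (\<forall>A::nat \<Rightarrow> complex set. range A \<subseteq> sets borel \<longrightarrow> disjoint_family A \<longrightarrow>
        (\<lambda>n. \<sigma> (A n)) sums \<sigma> (\<Union>n. A n))"

lemma signed_borel_measureD: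
  assumes "signed_borel_measure \<sigma>" "\<And>n::nat. A n \<in> sets borel" "disjoint_family A"
  shows "(\<lambda>n. \<sigma> (A n)) sums \<sigma> (\<Union>n. A n)"
  using assms unfolding signed_borel_measure_def by blast

text \<open>A constant series converges only if its term is 0.\<close>

lemma signed_borel_measure_empty:
  assumes "signed_borel_measure \<sigma>"
  shows "\<sigma> {} = 0"
proof -
  have "(\<lambda>n::nat. \<sigma> {}) sums \<sigma> (\<Union>n::nat. {})"
    by (rule signed_borel_measureD[OF assms]) (auto simp: disjoint_family_on_def)
  then have "summable (\<lambda>n::nat. \<sigma> {})"
    by (rule sums_summable)
  then show ?thesis
    by (simp add: summable_const_iff)
qed

lemma signed_borel_measure_Un:
  assumes "signed_borel_measure \<sigma>" "A \<in> sets borel" "B \<in> sets borel" "A \<inter> B = {}"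
  shows "\<sigma> (A \<union> B) = \<sigma> A + \<sigma> B"
proof -
  have "(\<lambda>n. \<sigma> (binaryset A B n)) sums \<sigma> (\<Union>n. binaryset A B n)"
    by (rule signed_borel_measureD[OF assms(1)])
       (use assms in \<open>auto simp: disjoint_family_on_def binaryset_def\<close>)
  moreover have "(\<lambda>n. \<sigma> (binaryset A B n)) sums (\<sigma> A + \<sigma> B)"
    by (rule binaryset_sums) (rule signed_borel_measure_empty[OF assms(1)])
  ultimately show ?thesis
    by (metis UN_binaryset_eq sums_unique2)
qed

lemma signed_borel_measure_Diff:
  assumes "signed_borel_measure \<sigma>" "A \<in> sets borel" "B \<in> sets borel" "B \<subseteq> A"
  shows "\<sigma> (A - B) = \<sigma> A - \<sigma> B"
  using signed_borel_measure_Un[of \<sigma> B "A - B"] assms by (auto simp: Un_absorb1)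

lemma signed_borel_measure_uminus:
  assumes "signed_borel_measure \<sigma>"
  shows "signed_borel_measure (\<lambda>A. - \<sigma> A)"
  unfolding signed_borel_measure_def
  by (intro allI impI sums_minus signed_borel_measureD[OF assms]) auto

text \<open>If the values on subsets of a set are unbounded, they are unbounded on one of the two
  parts of any splitting of it. Repeated splitting gives a decreasing sequence of such sets whose
  successive differences are disjoint and have values of modulus at least 1; the series over them
  cannot converge.\<close>

lemma signed_borel_measure_bounded:
  assumes \<sigma>: "signed_borel_measure \<sigma>"
  shows "\<exists>b. \<forall>A\<in>sets borel. \<bar>\<sigma> A\<bar> \<le> b"
proof (rule ccontr)
  assume neg: "\<not> ?thesis"
  define bad where
    "bad A \<longleftrightarrow> A \<in> sets borel \<and> (\<forall>b. \<exists>B\<in>sets borel. B \<subseteq> A \<and> \<bar>\<sigma> B\<bar> > b)" for A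
  have bad_UNIV: "bad UNIV"
    using neg unfolding bad_def by (auto simp: not_le)
  have step: "\<exists>A'. bad A' \<and> A' \<subseteq> A \<and> \<bar>\<sigma> (A - A')\<bar> \<ge> 1" if "bad A" for A
  proof -
    have A: "A \<in> sets borel" using that by (simp add: bad_def)
    \<comment> \<open>With the margin \<open>\<bar>\<sigma> A\<bar> + 1\<close> both
      \<open>B\<close> and \<open>A - B\<close> have values of modulus at least 1, so either of them
      may be the part that is discarded.\<close>
    have "\<exists>B\<in>sets borel. B \<subseteq> A \<and> \<bar>\<sigma> B\<bar> > \<bar>\<sigma> A\<bar> + 1"
      using that unfolding bad_def by (elim conjE allE)
    then obtain B where B: "B \<in> sets borel" "B \<subseteq> A" "\<bar>\<sigma> B\<bar> > \<bar>\<sigma> A\<bar> + 1"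
      by auto
    have d: "\<sigma> (A - B) = \<sigma> A - \<sigma> B"
      by (rule signed_borel_measure_Diff[OF \<sigma> A B(1,2)])
    have "bad B \<or> bad (A - B)"
    proof (rule ccontr)
      assume "\<not> (bad B \<or> bad (A - B))"
      then obtain b1 b2 where
        b1: "\<And>C. C \<in> sets borel \<Longrightarrow> C \<subseteq> B \<Longrightarrow> \<bar>\<sigma> C\<bar> \<le> b1" and
        b2: "\<And>C. C \<in> sets borel \<Longrightarrow> C \<subseteq> A - B \<Longrightarrow> \<bar>\<sigma> C\<bar> \<le> b2"
        using A B(1) unfolding bad_def by (metis not_le sets.Diff)
      have "\<bar>\<sigma> C\<bar> \<le> b1 + b2" if "C \<in> sets borel" "C \<subseteq> A" for C
      proof -
        have "\<sigma> C = \<sigma> (C \<inter> B) + \<sigma> (C - B)"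
          using signed_borel_measure_Un[OF \<sigma>, of "C \<inter> B" "C - B"] that B(1)
          by (simp add: Int_Diff_Un Int_Diff_disjoint)
        moreover have "\<bar>\<sigma> (C \<inter> B)\<bar> \<le> b1" "\<bar>\<sigma> (C - B)\<bar> \<le> b2"
          using that B(1) by (auto intro!: b1 b2)
        ultimately show ?thesis by linarith
      qed
      then show False
        using \<open>bad A\<close> unfolding bad_def by (meson not_le)
    qed
    then show ?thesis
    proof
      assume "bad B"
      then show ?thesis using d B by (intro exI[of _ B]) auto
    next
      assume "bad (A - B)"
      moreover have "A - (A - B) = B" using B(2) by blast
      ultimately show ?thesis using B by (intro exI[of _ "A - B"]) auto
    qed
  qed
  obtain A where A: "\<And>n. bad (A n)" "\<And>n. A (Suc n) \<subseteq> A n \<and> \<bar>\<sigma> (A n - A (Suc n))\<bar> \<ge> 1"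
    using dependent_nat_choice[of "\<lambda>_ A. bad A" "\<lambda>_ A A'. A' \<subseteq> A \<and> \<bar>\<sigma> (A - A')\<bar> \<ge> 1"]
      bad_UNIV step by metis
  have dec: "decseq A"
    using A(2) by (intro decseq_SucI) auto
  have "disjoint_family (\<lambda>n. A n - A (Suc n))"
    unfolding disjoint_family_on_def
  proof (intro ballI impI)
    fix m n :: nat assume "m \<noteq> n"
    then consider "Suc m \<le> n" | "Suc n \<le> m" by linarith
    then show "(A m - A (Suc m)) \<inter> (A n - A (Suc n)) = {}"
      by cases (use decseqD[OF dec] in blast)+
  qed
  then have "(\<lambda>n. \<sigma> (A n - A (Suc n))) sums \<sigma> (\<Union>n. A n - A (Suc n))"
    using A(1) by (intro signed_borel_measureD[OF \<sigma>]) (auto simp: bad_def)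
  then have "(\<lambda>n. \<sigma> (A n - A (Suc n))) \<longlonglongrightarrow> 0"
    by (intro summable_LIMSEQ_zero sums_summable)
  then have "eventually (\<lambda>n. \<bar>\<sigma> (A n - A (Suc n))\<bar> < 1) sequentially"
    by (auto dest!: tendstoD[of _ 0 _ 1] simp: dist_real_def)
  then show False
    using A(2) by (auto simp: eventually_sequentially not_less[symmetric])
qed

section \<open>Positive variation and Jordan decomposition\<close>

text \<open>The set function that \<open>positive_variation\<close> passes to
  \<open>measure_of\<close>, kept apart from the measure because its countable additivity has to be
  proved before \<open>emeasure\<close> can be identified with it.\<close>

definition upper_variation :: "(complex set \<Rightarrow> real) \<Rightarrow> complex set \<Rightarrow> ennreal" where
  "upper_variation \<sigma> A = (SUP B\<in>{B \<in> sets borel. B \<subseteq> A}. ennreal (\<sigma> B))"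

lemma upper_variation_ge:
  "B \<in> sets borel \<Longrightarrow> B \<subseteq> A \<Longrightarrow> ennreal (\<sigma> B) \<le> upper_variation \<sigma> A"
  unfolding upper_variation_def by (rule SUP_upper) auto

lemma upper_variation_superadd:
  assumes \<sigma>: "signed_borel_measure \<sigma>" and "A \<inter> B = {}"
  shows "upper_variation \<sigma> A + upper_variation \<sigma> B \<le> upper_variation \<sigma> (A \<union> B)"
proof -
  have *: "ennreal (\<sigma> C) + ennreal (\<sigma> D) \<le> upper_variation \<sigma> (A \<union> B)"
    if "C \<in> sets borel" "C \<subseteq> A" "D \<in> sets borel" "D \<subseteq> B" for C D
  proof -
    have "\<sigma> (C \<union> D) = \<sigma> C + \<sigma> D"
      using that assms by (intro signed_borel_measure_Un) auto
    then have "ennreal (\<sigma> C + \<sigma> D) \<le> upper_variation \<sigma> (A \<union> B)"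
      using upper_variation_ge[of "C \<union> D" "A \<union> B" \<sigma>] that by auto
    \<comment> \<open>\<open>ennreal\<close> truncates negative values, so the sum on the left is,
      according to the signs, one of \<open>ennreal (\<sigma> C + \<sigma> D)\<close>,
      \<open>ennreal (\<sigma> C)\<close>, \<open>ennreal (\<sigma> D)\<close> and 0.\<close>
    moreover have "ennreal (\<sigma> C) \<le> upper_variation \<sigma> (A \<union> B)" "ennreal (\<sigma> D) \<le> upper_variation \<sigma> (A \<union> B)"
      using that by (auto intro!: upper_variation_ge)
    ultimately show ?thesis
      unfolding ennreal_plus_if by auto
  qed
  have ne: "{B \<in> sets borel. B \<subseteq> X} \<noteq> {}" for X :: "complex set"
    by blast
  have **: "ennreal (\<sigma> C) + upper_variation \<sigma> B \<le> upper_variation \<sigma> (A \<union> B)"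
    if "C \<in> sets borel" "C \<subseteq> A" for C
    unfolding upper_variation_def[of \<sigma> B] ennreal_SUP_add_right[OF ne]
    by (rule SUP_least) (use * that in auto)
  show ?thesis
    unfolding upper_variation_def[of \<sigma> A] ennreal_SUP_add_left[OF ne, symmetric]
    by (rule SUP_least) (use ** in auto)
qed

lemma upper_variation_empty:
  assumes "signed_borel_measure \<sigma>"
  shows "upper_variation \<sigma> {} = 0"
proof -
  have "{B \<in> sets borel. B \<subseteq> {}} = {{} :: complex set}" by auto
  then have "upper_variation \<sigma> {} = (SUP B\<in>{{}}. ennreal (\<sigma> B))"
    by (simp only: upper_variation_def)
  then show ?thesis
    by (simp add: signed_borel_measure_empty[OF assms])
qed

text \<open>Superadditivity on finite unions gives one inequality in the limit. For the other, a
  Borel subset \<open>B\<close> of the union is cut into the pieces \<open>B \<inter> A n\<close>,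
  and truncation can only raise the partial sums of \<open>\<sigma>\<close>.\<close>

lemma upper_variation_UN:
  assumes \<sigma>: "signed_borel_measure \<sigma>"
    and A: "\<And>n::nat. A n \<in> sets borel" and disj: "disjoint_family A"
  shows "(\<Sum>n. upper_variation \<sigma> (A n)) = upper_variation \<sigma> (\<Union>n. A n)"
proof (rule antisym)
  have fin: "(\<Sum>i<n. upper_variation \<sigma> (A i)) \<le> upper_variation \<sigma> (\<Union>i<n. A i)" for n
  proof (induction n)
    case (Suc n)
    have "A i \<inter> A n = {}" if "i < n" for i
      using disjoint_family_onD[OF disj, of i n] that by simp
    then have "(\<Union>i<n. A i) \<inter> A n = {}"
      by blast
    then have "upper_variation \<sigma> (\<Union>i<n. A i) + upper_variation \<sigma> (A n)
        \<le> upper_variation \<sigma> ((\<Union>i<n. A i) \<union> A n)"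
      by (rule upper_variation_superadd[OF \<sigma>])
    moreover have "(\<Union>i<n. A i) \<union> A n = (\<Union>i<Suc n. A i)"
      by (auto simp: lessThan_Suc)
    ultimately show ?case
      using Suc by (auto intro: order_trans add_right_mono)
  qed simp
  have mono: "upper_variation \<sigma> (\<Union>i<n. A i) \<le> upper_variation \<sigma> (\<Union>i. A i)" for n
    unfolding upper_variation_def by (rule SUP_subset_mono) auto
  show "(\<Sum>n. upper_variation \<sigma> (A n)) \<le> upper_variation \<sigma> (\<Union>n. A n)"
    unfolding suminf_eq_SUP by (rule SUP_least) (rule order_trans[OF fin mono])
next
  show "upper_variation \<sigma> (\<Union>n. A n) \<le> (\<Sum>n. upper_variation \<sigma> (A n))"
    unfolding upper_variation_def[of \<sigma> "\<Union>n. A n"]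
  proof (rule SUP_least, clarsimp)
    fix B assume B: "B \<in> sets borel" "B \<subseteq> (\<Union>n. A n)"
    have "(\<lambda>n. \<sigma> (B \<inter> A n)) sums \<sigma> (\<Union>n. B \<inter> A n)"
      using B A disj by (intro signed_borel_measureD[OF \<sigma>]) (auto simp: disjoint_family_on_def, blast)
    moreover have "(\<Union>n. B \<inter> A n) = B" using B(2) by blast
    ultimately have "(\<lambda>n. \<Sum>i<n. \<sigma> (B \<inter> A i)) \<longlonglongrightarrow> \<sigma> B"
      by (simp add: sums_def)
    then have lim: "(\<lambda>n. ennreal (\<Sum>i<n. \<sigma> (B \<inter> A i))) \<longlonglongrightarrow> ennreal (\<sigma> B)"
      by (rule tendsto_ennrealI)
    have sub: "ennreal (\<Sum>i<n. g i) \<le> (\<Sum>i<n. ennreal (g i))" for n :: nat and g :: "nat \<Rightarrow> real"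
    proof (induction n)
      case (Suc n)
      have "ennreal (a + b) \<le> ennreal a + ennreal b" for a b
        unfolding ennreal_plus_if by (auto intro!: ennreal_leI simp: ennreal_neg)
      from this[of "sum g {..<n}" "g n"] show ?case
        using add_right_mono[OF Suc, of "ennreal (g n)"] by (simp add: order_trans)
    qed simp
    have "ennreal (\<Sum>i<n. \<sigma> (B \<inter> A i)) \<le> (\<Sum>n. upper_variation \<sigma> (A n))" for n
    proof -
      have "ennreal (\<Sum>i<n. \<sigma> (B \<inter> A i)) \<le> (\<Sum>i<n. ennreal (\<sigma> (B \<inter> A i)))" by (rule sub)
      also have "\<dots> \<le> (\<Sum>i<n. upper_variation \<sigma> (A i))"
        using B A by (intro sum_mono upper_variation_ge) auto
      also have "\<dots> \<le> (\<Sum>n. upper_variation \<sigma> (A n))"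
        by (rule sum_le_suminf) auto
      finally show ?thesis .
    qed
    then show "ennreal (\<sigma> B) \<le> (\<Sum>n. upper_variation \<sigma> (A n))"
      by (intro LIMSEQ_le_const2[OF lim]) auto
  qed
qed

lemma sets_positive_variation [simp, measurable_cong]: "sets (positive_variation \<sigma>) = sets borel"
  and space_positive_variation [simp]: "space (positive_variation \<sigma>) = UNIV"
  unfolding positive_variation_def
  using sets.sigma_sets_eq[of "borel :: complex measure"] by simp_all

text \<open>\<open>measure_of\<close> returns the given set function only if that is countably
  additive; for a signed measure this is \<open>upper_variation_UN\<close>.\<close>

lemma emeasure_positive_variation:
  assumes \<sigma>: "signed_borel_measure \<sigma>" and A: "A \<in> sets borel"
  shows "emeasure (positive_variation \<sigma>) A = upper_variation \<sigma> A"
proof (rule emeasure_measure_of[of "positive_variation \<sigma>" UNIV "sets borel"])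
  show "positive_variation \<sigma> = measure_of UNIV (sets borel) (upper_variation \<sigma>)"
    by (simp add: positive_variation_def upper_variation_def[abs_def])
  show "positive (sets (positive_variation \<sigma>)) (upper_variation \<sigma>)"
    by (simp add: positive_def upper_variation_empty[OF \<sigma>])
  show "countably_additive (sets (positive_variation \<sigma>)) (upper_variation \<sigma>)"
    by (rule countably_additiveI) (auto intro!: upper_variation_UN[OF \<sigma>])
qed (use A in auto)

lemma finite_measure_positive_variation:
  assumes \<sigma>: "signed_borel_measure \<sigma>"
  shows "finite_measure (positive_variation \<sigma>)"
proof
  obtain b where b: "\<And>A. A \<in> sets borel \<Longrightarrow> \<bar>\<sigma> A\<bar> \<le> b"
    using signed_borel_measure_bounded[OF \<sigma>] by blast
  have "upper_variation \<sigma> UNIV \<le> ennreal b"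
    unfolding upper_variation_def
  proof (rule SUP_least, clarsimp)
    fix B :: "complex set" assume "B \<in> sets borel"
    then show "ennreal (\<sigma> B) \<le> ennreal b"
      using b[of B] by (intro ennreal_leI) linarith
  qed
  then show "emeasure (positive_variation \<sigma>) (space (positive_variation \<sigma>)) \<noteq> \<infinity>"
    using emeasure_positive_variation[OF \<sigma>, of UNIV] by (auto simp: top_unique)
qed

lemma measure_positive_variation_ge:
  assumes \<sigma>: "signed_borel_measure \<sigma>" and "A \<in> sets borel" "B \<in> sets borel" "B \<subseteq> A"
  shows "\<sigma> B \<le> measure (positive_variation \<sigma>) A"
proof -
  interpret finite_measure "positive_variation \<sigma>"
    by (rule finite_measure_positive_variation[OF \<sigma>])
  have "ennreal (\<sigma> B) \<le> ennreal (measure (positive_variation \<sigma>) A)"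
    using upper_variation_ge[of B A \<sigma>] assms emeasure_positive_variation[OF \<sigma>, of A]
    by (simp add: emeasure_eq_measure)
  then show ?thesis
    by (simp add: ennreal_le_iff2) (use measure_nonneg[of "positive_variation \<sigma>" A] in linarith)
qed

lemma measure_positive_variation_le:
  assumes \<sigma>: "signed_borel_measure \<sigma>" and A: "A \<in> sets borel"
    and c: "\<And>B. B \<in> sets borel \<Longrightarrow> B \<subseteq> A \<Longrightarrow> \<sigma> B \<le> c"
  shows "measure (positive_variation \<sigma>) A \<le> c"
proof -
  interpret finite_measure "positive_variation \<sigma>"
    by (rule finite_measure_positive_variation[OF \<sigma>])
  have "0 \<le> c" using c[of "{}"] signed_borel_measure_empty[OF \<sigma>] by simp
  have "upper_variation \<sigma> A \<le> ennreal c"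
    unfolding upper_variation_def by (rule SUP_least) (use c in \<open>auto intro: ennreal_leI\<close>)
  then have "ennreal (measure (positive_variation \<sigma>) A) \<le> ennreal c"
    using emeasure_positive_variation[OF \<sigma>, of A] A by (simp add: emeasure_eq_measure)
  then show ?thesis using \<open>0 \<le> c\<close> by simp
qed

text \<open>For \<open>B \<subseteq> A\<close> the value on \<open>B\<close> is
  \<open>\<sigma> A\<close> minus the value on \<open>A - B\<close>, and the latter is controlled by
  the opposite variation. Taking suprema in both directions gives the equality.\<close>

lemma Jordan_decomposition:
  assumes \<sigma>: "signed_borel_measure \<sigma>" and A: "A \<in> sets borel"
  shows "measure (positive_variation \<sigma>) A - measure (positive_variation (\<lambda>A. - \<sigma> A)) A = \<sigma> A"
proof -
  let ?p = "measure (positive_variation \<sigma>) A"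
    and ?n = "measure (positive_variation (\<lambda>A. - \<sigma> A)) A"
  note \<sigma>' = signed_borel_measure_uminus[OF \<sigma>]
  have "?p \<le> \<sigma> A + ?n"
  proof (rule measure_positive_variation_le[OF \<sigma> A])
    fix B assume "B \<in> sets borel" "B \<subseteq> A"
    then show "\<sigma> B \<le> \<sigma> A + ?n"
      using measure_positive_variation_ge[OF \<sigma>' A, of "A - B"] signed_borel_measure_Diff[OF \<sigma> A, of B] A
      by auto
  qed
  moreover have "?n \<le> ?p - \<sigma> A"
  proof (rule measure_positive_variation_le[OF \<sigma>' A])
    fix B assume "B \<in> sets borel" "B \<subseteq> A"
    then show "- \<sigma> B \<le> ?p - \<sigma> A"
      using measure_positive_variation_ge[OF \<sigma> A, of "A - B"] signed_borel_measure_Diff[OF \<sigma> A, of B] A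
      by auto
  qed
  ultimately show ?thesis by linarith
qed

lemma positive_variation_null:
  assumes \<sigma>: "signed_borel_measure \<sigma>" and A: "A \<in> sets borel"
    and "\<And>B. B \<in> sets borel \<Longrightarrow> B \<subseteq> A \<Longrightarrow> \<sigma> B = 0"
  shows "A \<in> null_sets (positive_variation \<sigma>)"
proof -
  have "upper_variation \<sigma> A \<le> 0"
    unfolding upper_variation_def by (rule SUP_least) (simp add: assms(3))
  then show ?thesis
    using emeasure_positive_variation[OF \<sigma> A] A by (intro null_setsI) simp_all
qed

section \<open>Integration against differences of measures\<close>

text \<open>Equality of two differences of measures is written with sums, since values in
  \<open>[0, \<infinity>]\<close> cannot be subtracted freely. In this form it passes through every
  step of the induction on measurable functions.\<close>

lemma nn_integral_eq_add:
  assumes sets [measurable_cong]: "sets M1 = sets borel" "sets M2 = sets borel"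
      "sets P = sets borel" "sets N = sets borel"
    and eq: "\<And>A. A \<in> sets borel \<Longrightarrow> emeasure M1 A + emeasure N A = emeasure P A + emeasure M2 A"
    and f: "f \<in> borel_measurable borel"
  shows "(\<integral>\<^sup>+x. f x \<partial>M1) + (\<integral>\<^sup>+x. f x \<partial>N) = (\<integral>\<^sup>+x. f x \<partial>P) + (\<integral>\<^sup>+x. f x \<partial>M2)"
  using f
proof (induction rule: borel_measurable_induct)
  case (cong f g)
  then have "f = g" by auto
  with cong show ?case by simp
next
  case (set A)
  then show ?case using eq[of A] sets by simp
next
  case (mult u c)
  have [measurable]: "u \<in> borel_measurable borel" using mult by simp
  have "(\<integral>\<^sup>+x. c * u x \<partial>M1) + (\<integral>\<^sup>+x. c * u x \<partial>N) = c * ((\<integral>\<^sup>+x. u x \<partial>M1) + (\<integral>\<^sup>+x. u x \<partial>N))"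
    by (simp add: nn_integral_cmult distrib_left)
  also have "\<dots> = (\<integral>\<^sup>+x. c * u x \<partial>P) + (\<integral>\<^sup>+x. c * u x \<partial>M2)"
    by (simp add: nn_integral_cmult distrib_left mult.IH)
  finally show ?case .
next
  case (add u v)
  have [measurable]: "u \<in> borel_measurable borel" "v \<in> borel_measurable borel" using add by simp_all
  have "(\<integral>\<^sup>+x. v x + u x \<partial>M1) + (\<integral>\<^sup>+x. v x + u x \<partial>N)
      = ((\<integral>\<^sup>+x. v x \<partial>M1) + (\<integral>\<^sup>+x. v x \<partial>N)) + ((\<integral>\<^sup>+x. u x \<partial>M1) + (\<integral>\<^sup>+x. u x \<partial>N))"
    by (simp add: nn_integral_add ac_simps)
  also have "\<dots> = (\<integral>\<^sup>+x. v x + u x \<partial>P) + (\<integral>\<^sup>+x. v x + u x \<partial>M2)"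
    unfolding add.IH by (simp add: nn_integral_add ac_simps)
  finally show ?case .
next
  case (seq U)
  have [measurable]: "U i \<in> borel_measurable borel" for i using seq by simp
  have conv: "(\<integral>\<^sup>+x. (SUP i. U i) x \<partial>M) = (SUP i. \<integral>\<^sup>+x. U i x \<partial>M)" if [measurable_cong]: "sets M = sets borel" for M
    unfolding SUP_apply by (rule nn_integral_monotone_convergence_SUP) (use seq in auto)
  have inc: "incseq (\<lambda>i. \<integral>\<^sup>+x. U i x \<partial>M)" for M
    using seq(3) by (auto simp: incseq_def le_fun_def intro!: nn_integral_mono)
  show ?case
    unfolding conv[OF sets(1)] conv[OF sets(2)] conv[OF sets(3)] conv[OF sets(4)]
      ennreal_SUP_add[OF inc inc, symmetric] seq.IH ..
qed

lemma integral_eq_diff_real: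
  fixes f :: "complex \<Rightarrow> real"
  assumes sets [measurable_cong]: "sets M1 = sets borel" "sets M2 = sets borel"
      "sets P = sets borel" "sets N = sets borel"
    and eq: "\<And>A. A \<in> sets borel \<Longrightarrow> emeasure M1 A + emeasure N A = emeasure P A + emeasure M2 A"
    and int: "integrable M1 f" "integrable M2 f" "integrable P f" "integrable N f"
  shows "(LINT x|P. f x) - (LINT x|N. f x) = (LINT x|M1. f x) - (LINT x|M2. f x)"
proof -
  have [measurable]: "f \<in> borel_measurable borel"
    using borel_measurable_integrable[OF int(1)] by (simp add: measurable_def sets sets_eq_imp_space_eq[OF sets(1)])
  have pos: "enn2real (\<integral>\<^sup>+x. ennreal (g x) \<partial>M1) + enn2real (\<integral>\<^sup>+x. ennreal (g x) \<partial>N)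
      = enn2real (\<integral>\<^sup>+x. ennreal (g x) \<partial>P) + enn2real (\<integral>\<^sup>+x. ennreal (g x) \<partial>M2)"
    if g: "g = f \<or> g = (\<lambda>x. - f x)" for g
  proof -
    have [measurable]: "g \<in> borel_measurable borel" using g by auto
    have fin: "(\<integral>\<^sup>+x. ennreal (g x) \<partial>M) < top" if "integrable M f" for M
    proof -
      have "(\<integral>\<^sup>+x. ennreal (g x) \<partial>M) \<le> (\<integral>\<^sup>+x. ennreal (norm (f x)) \<partial>M)"
        by (intro nn_integral_mono ennreal_leI) (use g in auto)
      also have "\<dots> < top" using that by (simp add: integrable_iff_bounded)
      finally show ?thesis .
    qed
    have "(\<integral>\<^sup>+x. ennreal (g x) \<partial>M1) + (\<integral>\<^sup>+x. ennreal (g x) \<partial>N)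
        = (\<integral>\<^sup>+x. ennreal (g x) \<partial>P) + (\<integral>\<^sup>+x. ennreal (g x) \<partial>M2)"
      by (rule nn_integral_eq_add[OF sets eq]) auto
    then show ?thesis
      using fin[OF int(1)] fin[OF int(2)] fin[OF int(3)] fin[OF int(4)]
      by (metis enn2real_plus)
  qed
  show ?thesis
    using pos[of f] pos[of "\<lambda>x. - f x"] int
    by (simp add: real_lebesgue_integral_def)
qed

text \<open>The Jordan decomposition in the definition of \<open>signed_integral\<close> may be
  exchanged for any difference of finite measures representing \<open>\<sigma>\<close>, as long as
  the function is integrable against all of them. Integrals can then be computed from image measures
  that overlap.\<close>

lemma signed_integral_eq_diff:
  fixes f :: "complex \<Rightarrow> complex"
  assumes \<sigma>: "signed_borel_measure \<sigma>"
    and sets [measurable_cong]: "sets M1 = sets borel" "sets M2 = sets borel"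
    and fin: "finite_measure M1" "finite_measure M2"
    and eq: "\<And>A. A \<in> sets borel \<Longrightarrow> \<sigma> A = measure M1 A - measure M2 A"
    and int: "integrable M1 f" "integrable M2 f" "integrable (positive_variation \<sigma>) f"
      "integrable (positive_variation (\<lambda>A. - \<sigma> A)) f"
  shows "signed_integral \<sigma> f = (LINT x|M1. f x) - (LINT x|M2. f x)"
proof -
  let ?P = "positive_variation \<sigma>" and ?N = "positive_variation (\<lambda>A. - \<sigma> A)"
  interpret P: finite_measure ?P by (rule finite_measure_positive_variation[OF \<sigma>])
  interpret N: finite_measure ?N
    by (rule finite_measure_positive_variation[OF signed_borel_measure_uminus[OF \<sigma>]])
  interpret M1: finite_measure M1 by (rule fin)
  interpret M2: finite_measure M2 by (rule fin)
  have em: "emeasure M1 A + emeasure ?N A = emeasure ?P A + emeasure M2 A" if "A \<in> sets borel" for A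
  proof -
    have "measure M1 A + measure ?N A = measure ?P A + measure M2 A"
      using Jordan_decomposition[OF \<sigma> that] eq[OF that] by linarith
    then show ?thesis
      by (simp add: M1.emeasure_eq_measure M2.emeasure_eq_measure P.emeasure_eq_measure
          N.emeasure_eq_measure flip: ennreal_plus)
  qed
  have "(LINT x|?P. Re (f x)) - (LINT x|?N. Re (f x)) = (LINT x|M1. Re (f x)) - (LINT x|M2. Re (f x))"
    by (rule integral_eq_diff_real[OF sets _ _ em]) (use int in auto)
  moreover have "(LINT x|?P. Im (f x)) - (LINT x|?N. Im (f x)) = (LINT x|M1. Im (f x)) - (LINT x|M2. Im (f x))"
    by (rule integral_eq_diff_real[OF sets _ _ em]) (use int in auto)
  ultimately show ?thesis
    using int by (simp add: signed_integral_def complex_eq_iff)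
qed

section \<open>The unbounded component on the sphere\<close>

lemma topspace_riemann_sphere [simp]: "topspace riemann_sphere = UNIV"
  by (simp add: riemann_sphere_def topspace_Alexandroff_compactification UNIV_option_conv)

lemma openin_riemann_sphere_Some: "open U \<Longrightarrow> openin riemann_sphere (Some ` U)"
  unfolding riemann_sphere_def openin_Alexandroff_compactification by auto

lemma openin_riemann_sphere_None:
  assumes "compact C"
  shows "openin riemann_sphere (insert None (Some ` (- C)))"
  unfolding riemann_sphere_def openin_Alexandroff_compactification
  using assms by (intro disjI2 exI[of _ C]) (simp add: compact_imp_closed flip: Compl_eq_Diff_UNIV)

lemma openin_riemann_sphere_NoneE:
  assumes "openin riemann_sphere V" "None \<in> V"
  obtains C where "compact C" "V = insert None (Some ` (- C))"
  using assms unfolding riemann_sphere_def openin_Alexandroff_compactification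
  by (auto simp flip: Compl_eq_Diff_UNIV)

lemma continuous_map_riemann_sphere_Some: "continuous_map euclidean riemann_sphere Some"
  unfolding riemann_sphere_def by (rule continuous_map_Some)

lemma connectedin_riemann_sphere_Some: "connected S \<Longrightarrow> connectedin riemann_sphere (Some ` S)"
  by (rule connectedin_continuous_map_image[OF continuous_map_riemann_sphere_Some]) simp

lemma compact_Compl_outside:
  fixes E :: "complex set"
  assumes "compact E"
  shows "compact (- outside E)"
proof -
  have "- outside E = E \<union> inside E"
    by (simp add: outside_inside)
  moreover have "bounded (E \<union> inside E)"
    using assms by (simp add: compact_imp_bounded bounded_inside)
  moreover have "closed (- outside E)"
    using assms by (simp add: compact_imp_closed open_outside closed_Compl)
  ultimately show ?thesis
    by (simp add: compact_eq_bounded_closed)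
qed

lemma outside_not_subset_bounded:
  fixes E :: "complex set"
  assumes "bounded E" "bounded B"
  obtains z where "z \<in> outside E" "z \<notin> B"
  using unbounded_outside[OF assms(1)] assms(2) bounded_subset by blast

text \<open>Infinity together with \<open>outside E\<close> is connected because every neighbourhood
  of infinity meets the unbounded set \<open>outside E\<close>, and it cannot be enlarged because
  \<open>inside E\<close> is open. This reduces questions on the sphere to the planar sets
  \<open>outside\<close> and \<open>inside\<close>.\<close>

lemma outer_domain_eq:
  assumes "compact E"
  shows "outer_domain E = insert None (Some ` outside E)"
proof (rule set_eqI, rule iffI)
  have bE: "bounded E" by (rule compact_imp_bounded[OF assms])
  fix y assume "y \<in> outer_domain E"
  then obtain T where T: "connectedin riemann_sphere T" "T \<subseteq> - Some ` E" "None \<in> T" "y \<in> T"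
    by (auto simp: outer_domain_def connected_component_of_def connectedin_subtopology)
  show "y \<in> insert None (Some ` outside E)"
  proof (rule ccontr)
    assume y: "y \<notin> insert None (Some ` outside E)"
    have A: "openin riemann_sphere (insert None (Some ` outside E))"
      using openin_riemann_sphere_None[OF compact_Compl_outside[OF assms]] by simp
    have B: "openin riemann_sphere (Some ` inside E)"
      by (intro openin_riemann_sphere_Some open_inside compact_imp_closed assms)
    have cov: "T \<subseteq> insert None (Some ` outside E) \<union> Some ` inside E"
    proof
      fix t assume "t \<in> T"
      then show "t \<in> insert None (Some ` outside E) \<union> Some ` inside E"
        using T(2) inside_Un_outside[of E] by (cases t) blast+
    qed
    have "insert None (Some ` outside E) \<inter> Some ` inside E \<inter> T = {}"
      using inside_Int_outside[of E, unfolded disjoint_iff] by auto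
    moreover have "insert None (Some ` outside E) \<inter> T \<noteq> {}" using T(3) by blast
    moreover have "Some ` inside E \<inter> T \<noteq> {}" using T(4) y cov by blast
    ultimately show False
      by (rule connectedinD[OF T(1) A B cov])
  qed
next
  have bE: "bounded E" by (rule compact_imp_bounded[OF assms])
  fix y assume y: "y \<in> insert None (Some ` outside E)"
  have "connectedin riemann_sphere (insert None (Some ` outside E))"
  proof (rule connectedin_intermediate_closure_of)
    show "connectedin riemann_sphere (Some ` outside E)"
      by (intro connectedin_riemann_sphere_Some connected_outside bE) simp
    have "None \<in> riemann_sphere closure_of (Some ` outside E)"
      unfolding in_closure_of
    proof (intro conjI allI impI)
      fix T assume T: "None \<in> T \<and> openin riemann_sphere T"
      then obtain C where C: "compact C" "T = insert None (Some ` (- C))"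
        using openin_riemann_sphere_NoneE by blast
      obtain z where "z \<in> outside E" "z \<notin> C"
        using outside_not_subset_bounded[OF bE compact_imp_bounded[OF C(1)]] by blast
      then show "\<exists>y. y \<in> Some ` outside E \<and> y \<in> T"
        using C by blast
    qed simp
    then show "insert None (Some ` outside E) \<subseteq> riemann_sphere closure_of (Some ` outside E)"
      using closure_of_subset[of "Some ` outside E" riemann_sphere] by simp
  qed auto
  moreover have "insert None (Some ` outside E) \<subseteq> - Some ` E"
    using outside_no_overlap[of E, unfolded disjoint_iff] by auto
  ultimately show "y \<in> outer_domain E"
    unfolding outer_domain_def connected_component_of_def connectedin_subtopology mem_Collect_eq
    using y by blast
qed

lemma vimage_Some_outer_domain: "compact E \<Longrightarrow> Some -` outer_domain E = outside E"
  by (auto simp: outer_domain_eq)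

text \<open>Points near 0 have inverses outside every bounded set, so the set keeps away from 0,
  where \<open>inverse\<close> is discontinuous.\<close>

lemma closed_vimage_inverse:
  fixes Q :: "complex set"
  assumes "compact Q"
  shows "closed {w. w \<noteq> 0 \<and> inverse w \<in> Q}"
proof -
  obtain B where B: "B > 0" "\<And>x. x \<in> Q \<Longrightarrow> norm x \<le> B"
    using compact_imp_bounded[OF assms] bounded_pos by metis
  have "{w. w \<noteq> 0 \<and> inverse w \<in> Q} = (- ball 0 (inverse B)) \<inter> inverse -` Q"
  proof (intro set_eqI iffI)
    fix w assume w: "w \<in> {w. w \<noteq> 0 \<and> inverse w \<in> Q}"
    then have "inverse (norm w) \<le> B" using B(2)[of "inverse w"] by (simp add: norm_inverse)
    then have "inverse B \<le> norm w"
      using w B(1) by (simp add: field_simps)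
    then show "w \<in> (- ball 0 (inverse B)) \<inter> inverse -` Q" using w by simp
  qed (use B(1) in auto)
  moreover have "closed ((- ball 0 (inverse B)) \<inter> inverse -` Q)"
  proof (rule continuous_closed_preimage)
    show "continuous_on (- ball 0 (inverse B)) (inverse :: complex \<Rightarrow> complex)"
      using B(1) by (intro continuous_intros) auto
  qed (use assms in \<open>auto simp: compact_imp_closed\<close>)
  ultimately show ?thesis by simp
qed

lemma vimage_chart_outer_domain:
  "compact E \<Longrightarrow> chart_at_infinity -` outer_domain E = {w. w = 0 \<or> inverse w \<in> outside E}"
  by (auto simp: outer_domain_eq chart_at_infinity_def split: if_splits)

lemma open_vimage_chart_outer_domain:
  assumes "compact E"
  shows "open (chart_at_infinity -` outer_domain E)"
proof -
  have "closed {w. w \<noteq> 0 \<and> inverse w \<in> - outside E}"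
    by (rule closed_vimage_inverse[OF compact_Compl_outside[OF assms]])
  moreover have "- {w. w \<noteq> 0 \<and> inverse w \<in> - outside E} = chart_at_infinity -` outer_domain E"
    unfolding vimage_chart_outer_domain[OF assms] by auto
  ultimately show ?thesis by (metis open_Compl)
qed

section \<open>Cauchy transforms of finite measures\<close>

lemma finite_measure_integral_bound:
  fixes f :: "complex \<Rightarrow> complex"
  assumes "finite_measure P" and sets: "sets P = sets borel"
    and f: "f \<in> borel_measurable borel" and "AE x in P. norm (f x) \<le> B"
  shows "integrable P f" "norm (LINT x|P. f x) \<le> B * measure P UNIV"
proof -
  interpret finite_measure P by fact
  have sp: "space P = UNIV" using sets_eq_imp_space_eq[OF sets] by simp
  have fm: "f \<in> borel_measurable P"
    using f by (simp add: measurable_def sets sp)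
  show i: "integrable P f"
    by (rule integrable_const_bound[of f B]) (use assms fm in auto)
  have "norm (LINT x|P. f x) \<le> (LINT x|P. norm (f x))"
    by (rule integral_norm_bound)
  also have "\<dots> \<le> (LINT x|P. B)"
    by (rule integral_mono_AE) (use i assms in auto)
  also have "\<dots> = B * measure P UNIV"
    by (simp add: sp)
  finally show "norm (LINT x|P. f x) \<le> B * measure P UNIV" .
qed

text \<open>The four variations of a complex measure, and likewise the image measures of the two
  parts of a weight, satisfy these assumptions, so analyticity, behaviour at infinity and
  integrability of the Cauchy kernel are proved once for all of them.\<close>

locale finite_measure_on_compact =
  fixes P :: "complex measure" and E :: "complex set"
  assumes finP: "finite_measure P" and setsP: "sets P = sets borel"
    and compactE: "compact E" and AE_E: "AE x in P. x \<in> E"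
begin

definition CT :: "complex \<Rightarrow> complex" where
  "CT z = (LINT x|P. 1 / (x - z))"

lemma kernel_bound:
  fixes f :: "complex \<Rightarrow> complex"
  assumes "f \<in> borel_measurable borel" "\<And>x. x \<in> E \<Longrightarrow> norm (f x) \<le> B"
  shows "integrable P f" "norm (LINT x|P. f x) \<le> B * measure P UNIV"
proof -
  have "AE x in P. norm (f x) \<le> B" using AE_E assms(2) by auto
  then show "integrable P f" "norm (LINT x|P. f x) \<le> B * measure P UNIV"
    using finite_measure_integral_bound[OF finP setsP assms(1)] by auto
qed

lemma separated:
  assumes "z \<notin> E"
  obtains r where "r > 0" "\<And>x. x \<in> E \<Longrightarrow> 2 * r \<le> norm (x - z)"
proof -
  have "open (- E)" using compactE by (simp add: compact_imp_closed open_Compl)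
  then obtain r where r: "r > 0" "ball z r \<subseteq> - E"
    using assms by (meson ComplI openE)
  then have "2 * (r / 2) \<le> norm (x - z)" if "x \<in> E" for x
    using that by (force simp: dist_norm norm_minus_commute)
  with r(1) show thesis by (intro that[of "r / 2"]) auto
qed

lemma integrable_kernel:
  assumes "z \<notin> E"
  shows "integrable P (\<lambda>x. 1 / (x - z))"
proof -
  obtain r where r: "r > 0" "\<And>x. x \<in> E \<Longrightarrow> 2 * r \<le> norm (x - z)"
    using separated[OF assms] by blast
  show ?thesis
  proof (rule kernel_bound(1))
    fix x assume "x \<in> E"
    then show "norm (1 / (x - z)) \<le> 1 / (2 * r)"
      using r by (simp add: norm_divide frac_le)
  qed measurable
qed

lemma CT_has_derivative:
  assumes "z \<notin> E"
  shows "(CT has_field_derivative (LINT x|P. 1 / (x - z)\<^sup>2)) (at z)"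
proof -
  obtain r where r: "r > 0" "\<And>x. x \<in> E \<Longrightarrow> 2 * r \<le> norm (x - z)"
    using separated[OF assms] by blast
  define D where "D = (LINT x|P. 1 / (x - z)\<^sup>2)"
  define C where "C = 1 / (r * (2 * r)\<^sup>2) * measure P UNIV"
  have intD: "integrable P (\<lambda>x. 1 / (x - z)\<^sup>2)"
  proof (rule kernel_bound(1))
    fix x assume "x \<in> E"
    then have "(2 * r)\<^sup>2 \<le> (norm (x - z))\<^sup>2"
      using r by (intro power_mono) auto
    then show "norm (1 / (x - z)\<^sup>2) \<le> 1 / (2 * r)\<^sup>2"
      using r(1) by (simp add: norm_divide norm_power frac_le)
  qed measurable
  have bound: "norm ((CT w - CT z) / (w - z) - D) \<le> norm (w - z) * C"
    if w: "w \<in> ball z r" "w \<noteq> z" for w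
  proof -
    have far: "r \<le> norm (x - w)" "2 * r \<le> norm (x - z)" if "x \<in> E" for x
    proof -
      show 1: "2 * r \<le> norm (x - z)" by (rule r(2)[OF that])
      have "norm (x - z) \<le> norm (x - w) + norm (w - z)"
        using norm_triangle_ineq[of "x - w" "w - z"] by simp
      then show "r \<le> norm (x - w)"
        using 1 w(1) by (simp add: dist_norm norm_minus_commute)
    qed
    have "w \<notin> E" using far(1)[of w] r(1) by auto
    have kb: "norm (1 / ((x - w) * (x - z)\<^sup>2)) \<le> 1 / (r * (2 * r)\<^sup>2)" if "x \<in> E" for x
    proof -
      have "r * (2 * r)\<^sup>2 \<le> norm (x - w) * (norm (x - z))\<^sup>2"
        using far[OF that] r(1) by (intro mult_mono power_mono) auto
      then show ?thesis
        using r(1) by (simp add: norm_divide norm_mult norm_power frac_le)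
    qed
    \<comment> \<open>The exact remainder of the first order expansion of the kernel at
      \<open>z\<close>; on \<open>E\<close> its last factor is bounded uniformly for
      \<open>w\<close> in the ball.\<close>
    have ptw: "1 / (x - w) - 1 / (x - z) - (w - z) * (1 / (x - z)\<^sup>2)
        = (w - z)\<^sup>2 * (1 / ((x - w) * (x - z)\<^sup>2))" if "x \<in> E" for x
    proof -
      have "x - w \<noteq> 0" "x - z \<noteq> 0" using far[OF that] r(1) by auto
      then show ?thesis by (simp add: divide_simps) (simp add: algebra_simps power2_eq_square)
    qed
    have "CT w - CT z - (w - z) * D
        = (LINT x|P. 1 / (x - w) - 1 / (x - z) - (w - z) * (1 / (x - z)\<^sup>2))"
      unfolding CT_def D_def using integrable_kernel[OF \<open>w \<notin> E\<close>] integrable_kernel[OF assms] intD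
      by (simp del: times_divide_eq_right)
    also have "\<dots> = (LINT x|P. (w - z)\<^sup>2 * (1 / ((x - w) * (x - z)\<^sup>2)))"
    proof (rule integral_cong_AE)
      show "AE x in P. 1 / (x - w) - 1 / (x - z) - (w - z) * (1 / (x - z)\<^sup>2)
          = (w - z)\<^sup>2 * (1 / ((x - w) * (x - z)\<^sup>2))"
        using AE_E by eventually_elim (rule ptw)
    qed (simp_all add: measurable_cong_sets[OF setsP refl])
    also have "\<dots> = (w - z)\<^sup>2 * (LINT x|P. 1 / ((x - w) * (x - z)\<^sup>2))"
      by (rule integral_mult_right_zero)
    finally have eq: "CT w - CT z - (w - z) * D = (w - z)\<^sup>2 * (LINT x|P. 1 / ((x - w) * (x - z)\<^sup>2))" .
    have "(CT w - CT z) / (w - z) - D = (CT w - CT z - (w - z) * D) / (w - z)"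
      using w(2) by (simp add: diff_divide_distrib)
    also have "\<dots> = (w - z) * (LINT x|P. 1 / ((x - w) * (x - z)\<^sup>2))"
      unfolding eq using w(2) by (simp add: power2_eq_square)
    finally have "norm ((CT w - CT z) / (w - z) - D)
        = norm (w - z) * norm (LINT x|P. 1 / ((x - w) * (x - z)\<^sup>2))"
      by (simp add: norm_mult)
    also have "\<dots> \<le> norm (w - z) * C"
      unfolding C_def by (rule mult_left_mono[OF kernel_bound(2)[OF _ kb]]) simp_all
    finally show ?thesis .
  qed
  have "((\<lambda>w. (CT w - CT z) / (w - z) - D) \<longlongrightarrow> 0) (at z)"
  proof (rule Lim_null_comparison)
    show "\<forall>\<^sub>F w in at z. norm ((CT w - CT z) / (w - z) - D) \<le> norm (w - z) * C"
      unfolding eventually_at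
      by (rule exI[of _ r]) (use r(1) bound in \<open>auto simp: dist_commute\<close>)
    show "((\<lambda>w. norm (w - z) * C) \<longlongrightarrow> 0) (at z)"
      by (auto intro!: tendsto_eq_intros)
  qed
  then show ?thesis
    unfolding has_field_derivative_iff D_def[symmetric] by (rule LIM_zero_cancel)
qed

lemma CT_holomorphic: "CT holomorphic_on - E"
proof -
  have "open (- E)" using compactE by (simp add: compact_imp_closed open_Compl)
  then show ?thesis
    using CT_has_derivative unfolding holomorphic_on_open[OF \<open>open (- E)\<close>] by blast
qed

text \<open>Since \<open>z / (x - z) + 1 = x / (x - z)\<close>, the error is of order
  \<open>1 / norm z\<close>. The minus sign comes from the kernel
  \<open>1 / (x - z)\<close>.\<close>

lemma CT_at_infinity: "((\<lambda>z. z * CT z) \<longlongrightarrow> - of_real (measure P UNIV)) at_infinity"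
proof -
  interpret finite_measure P by (rule finP)
  obtain B where B: "B > 0" "\<And>x. x \<in> E \<Longrightarrow> norm x \<le> B"
    using compact_imp_bounded[OF compactE] bounded_pos by metis
  have sp: "space P = UNIV" using sets_eq_imp_space_eq[OF setsP] by simp
  have bound: "norm (z * CT z + of_real (measure P UNIV)) \<le> B / (norm z - B) * measure P UNIV"
    if z: "norm z > B" for z
  proof -
    have "z \<notin> E" using B(2)[of z] z by auto
    have far: "norm z - B \<le> norm (x - z)" if "x \<in> E" for x
      using norm_triangle_ineq2[of z x] B(2)[OF that] by (simp add: norm_minus_commute)
    have ptw: "z * (1 / (x - z)) + 1 = x / (x - z)" if "x \<in> E" for x
      using far[OF that] z by (auto simp: divide_simps)
    have "z * CT z + of_real (measure P UNIV) = (LINT x|P. z * (1 / (x - z)) + 1)"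
      unfolding CT_def using integrable_kernel[OF \<open>z \<notin> E\<close>]
      by (simp add: sp scaleR_conv_of_real del: times_divide_eq_right)
    also have "\<dots> = (LINT x|P. x / (x - z))"
    proof (rule integral_cong_AE)
      show "AE x in P. z * (1 / (x - z)) + 1 = x / (x - z)"
        using AE_E by eventually_elim (rule ptw)
    qed (simp_all add: measurable_cong_sets[OF setsP refl])
    also have "norm \<dots> \<le> B / (norm z - B) * measure P UNIV"
    proof (rule kernel_bound(2))
      fix x assume "x \<in> E"
      then show "norm (x / (x - z)) \<le> B / (norm z - B)"
        unfolding norm_divide using far B z by (intro frac_le) auto
    qed measurable
    finally show ?thesis .
  qed
  have "((\<lambda>z. z * CT z - - of_real (measure P UNIV)) \<longlongrightarrow> 0) at_infinity"
  proof (rule Lim_null_comparison)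
    show "\<forall>\<^sub>F z in at_infinity. norm (z * CT z - - of_real (measure P UNIV))
        \<le> B / (norm z - B) * measure P UNIV"
      unfolding eventually_at_infinity by (rule exI[of _ "B + 1"]) (use bound in auto)
    have "((\<lambda>t. B / (t - B) * measure P UNIV) \<longlongrightarrow> 0) at_top"
      by real_asymp
    then show "((\<lambda>z::complex. B / (norm z - B) * measure P UNIV) \<longlongrightarrow> 0) at_infinity"
      by (rule filterlim_compose) (rule filterlim_norm_at_top)
  qed
  then show ?thesis by (rule LIM_zero_cancel)
qed

end

section \<open>The Cauchy capacity is at most the analytic capacity\<close>

lemma tendsto_zero_of_times_ident:
  fixes f :: "complex \<Rightarrow> complex"
  assumes "((\<lambda>z. z * f z) \<longlongrightarrow> a) at_infinity"
  shows "(f \<longlongrightarrow> 0) at_infinity"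
proof -
  have "((\<lambda>z. inverse z * (z * f z)) \<longlongrightarrow> 0 * a) at_infinity"
    by (intro tendsto_mult tendsto_inverse_0 assms)
  moreover have "\<forall>\<^sub>F z in at_infinity. inverse z * (z * f z) = f z"
    unfolding eventually_at_infinity by (rule exI[of _ 1]) (auto simp: field_simps)
  ultimately show ?thesis
    by (simp add: tendsto_cong)
qed

lemma complex_borel_measure_Re_Im:
  assumes "complex_borel_measure \<nu>"
  shows "signed_borel_measure (\<lambda>A. Re (\<nu> A))" "signed_borel_measure (\<lambda>A. Im (\<nu> A))"
  unfolding signed_borel_measure_def
  by (intro allI impI sums_Re sums_Im assms[unfolded complex_borel_measure_def, rule_format]; assumption)+

lemma finite_measure_on_compact_positive_variation:
  assumes "signed_borel_measure \<sigma>" "compact E"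
    and "\<And>A. A \<in> sets borel \<Longrightarrow> A \<inter> E = {} \<Longrightarrow> \<sigma> A = 0"
  shows "finite_measure_on_compact (positive_variation \<sigma>) E"
proof (rule finite_measure_on_compact.intro)
  have "- E \<in> null_sets (positive_variation \<sigma>)"
    by (rule positive_variation_null[OF assms(1)])
       (use assms(2) in \<open>auto simp: compact_imp_closed borel_closed intro!: assms(3)\<close>)
  then show "AE x in positive_variation \<sigma>. x \<in> E"
    by (intro AE_I') auto
qed (simp_all add: assms(1,2) finite_measure_positive_variation)

text \<open>The variations of the real and the imaginary part are four finite measures concentrated
  on \<open>E\<close>, and the coefficients of their Cauchy transforms at infinity combine to
  \<open>- \<nu> E\<close>.\<close>

lemma cauchy_transform_properties:
  assumes E: "compact E" and \<nu>: "complex_borel_measure \<nu>" "supported_on \<nu> E"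
  shows "(\<lambda>z. cauchy_transform \<nu> (Some z)) holomorphic_on - E"
    and "((\<lambda>z. z * cauchy_transform \<nu> (Some z)) \<longlongrightarrow> - \<nu> E) at_infinity"
proof -
  note sgn = complex_borel_measure_Re_Im[OF \<nu>(1)]
  let ?P1 = "positive_variation (\<lambda>A. Re (\<nu> A))" and ?P2 = "positive_variation (\<lambda>A. - Re (\<nu> A))"
  let ?P3 = "positive_variation (\<lambda>A. Im (\<nu> A))" and ?P4 = "positive_variation (\<lambda>A. - Im (\<nu> A))"
  interpret P1: finite_measure_on_compact ?P1 E
    using sgn E \<nu>(2) by (intro finite_measure_on_compact_positive_variation) (auto simp: supported_on_def)
  interpret P2: finite_measure_on_compact ?P2 E
    using sgn E \<nu>(2) by (intro finite_measure_on_compact_positive_variation signed_borel_measure_uminus)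
      (auto simp: supported_on_def)
  interpret P3: finite_measure_on_compact ?P3 E
    using sgn E \<nu>(2) by (intro finite_measure_on_compact_positive_variation) (auto simp: supported_on_def)
  interpret P4: finite_measure_on_compact ?P4 E
    using sgn E \<nu>(2) by (intro finite_measure_on_compact_positive_variation signed_borel_measure_uminus)
      (auto simp: supported_on_def)
  have eq: "cauchy_transform \<nu> (Some z) = (P1.CT z - P2.CT z) + \<i> * (P3.CT z - P4.CT z)" for z
    by (simp add: cauchy_transform_def complex_measure_integral_def signed_integral_def
        P1.CT_def P2.CT_def P3.CT_def P4.CT_def)
  show "(\<lambda>z. cauchy_transform \<nu> (Some z)) holomorphic_on - E"
    unfolding eq by (intro holomorphic_intros P1.CT_holomorphic P2.CT_holomorphic
        P3.CT_holomorphic P4.CT_holomorphic)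
  have "\<nu> E = \<nu> UNIV"
  proof -
    have BE: "E \<in> sets borel" "- E \<in> sets borel" using E by (auto simp: compact_imp_closed borel_closed)
    then have "\<nu> (- E) = 0" using \<nu>(2) by (simp add: supported_on_def)
    moreover have "Re (\<nu> (E \<union> - E)) = Re (\<nu> E) + Re (\<nu> (- E))" "Im (\<nu> (E \<union> - E)) = Im (\<nu> E) + Im (\<nu> (- E))"
      using signed_borel_measure_Un[OF sgn(1) BE] signed_borel_measure_Un[OF sgn(2) BE] by auto
    ultimately show ?thesis by (simp add: complex_eq_iff)
  qed
  moreover have "Re (\<nu> UNIV) = measure ?P1 UNIV - measure ?P2 UNIV"
      "Im (\<nu> UNIV) = measure ?P3 UNIV - measure ?P4 UNIV"
    using Jordan_decomposition[OF sgn(1), of UNIV] Jordan_decomposition[OF sgn(2), of UNIV] by auto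
  ultimately have \<nu>E: "- \<nu> E = (- of_real (measure ?P1 UNIV) - - of_real (measure ?P2 UNIV))
      + \<i> * (- of_real (measure ?P3 UNIV) - - of_real (measure ?P4 UNIV))"
    by (simp add: complex_eq_iff)
  have eq': "z * cauchy_transform \<nu> (Some z)
      = (z * P1.CT z - z * P2.CT z) + \<i> * (z * P3.CT z - z * P4.CT z)" for z
    by (simp add: eq algebra_simps)
  show "((\<lambda>z. z * cauchy_transform \<nu> (Some z)) \<longlongrightarrow> - \<nu> E) at_infinity"
    unfolding eq' \<nu>E
    by (intro tendsto_add tendsto_diff tendsto_mult_left P1.CT_at_infinity P2.CT_at_infinity
        P3.CT_at_infinity P4.CT_at_infinity)
qed

text \<open>In the coordinate \<open>w = 1 / z\<close> the assumed limit makes the function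
  continuous at 0, so the singularity there is removable.\<close>

lemma sphere_holomorphic_onI:
  assumes E: "compact E" and hol: "(\<lambda>z. f (Some z)) holomorphic_on outside E"
    and lim: "((\<lambda>z. f (Some z)) \<longlongrightarrow> f None) at_infinity"
  shows "sphere_holomorphic_on f (outer_domain E)"
  unfolding sphere_holomorphic_on_def
proof
  show "f \<circ> Some holomorphic_on Some -` outer_domain E"
    unfolding vimage_Some_outer_domain[OF E] o_def by (rule hol)
  let ?T = "chart_at_infinity -` outer_domain E"
  show "f \<circ> chart_at_infinity holomorphic_on ?T"
  proof (rule no_isolated_singularity'[of "{0}"])
    have inv: "(\<lambda>z. f (Some z)) \<circ> inverse holomorphic_on ?T - {0}"
    proof (rule holomorphic_on_compose_gen[OF _ hol])
      show "inverse holomorphic_on ?T - {0}" by (rule holomorphic_on_inverse[OF holomorphic_on_ident]) simp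
      show "inverse ` (?T - {0}) \<subseteq> outside E"
        unfolding vimage_chart_outer_domain[OF E] by blast
    qed
    show "f \<circ> chart_at_infinity holomorphic_on ?T - {0}"
      by (rule holomorphic_transform[OF inv]) (simp add: chart_at_infinity_def)
    show "open ?T" by (rule open_vimage_chart_outer_domain[OF E])
    fix z :: complex assume "z \<in> {0}"
    have "((\<lambda>w. f (Some (inverse w))) \<longlongrightarrow> f None) (at 0)"
      by (rule filterlim_compose[OF lim filterlim_inverse_at_infinity])
    moreover have "\<forall>\<^sub>F w in at 0. f (Some (inverse w)) = (f \<circ> chart_at_infinity) w"
      by (auto simp: eventually_at chart_at_infinity_def intro: exI[of _ 1])
    ultimately have "((f \<circ> chart_at_infinity) \<longlongrightarrow> f None) (at 0)"
      by (rule Lim_transform_eventually)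
    then show "((f \<circ> chart_at_infinity) \<longlongrightarrow> (f \<circ> chart_at_infinity) z) (at z within ?T)"
      using \<open>z \<in> {0}\<close> by (auto simp: chart_at_infinity_def intro: tendsto_within_subset)
  qed simp
qed

lemma outer_domain_subset: "compact E \<Longrightarrow> outer_domain E \<subseteq> - Some ` E"
  using outside_no_overlap[of E, unfolded disjoint_iff] by (auto simp: outer_domain_eq)

lemma cauchy_capacity_le_analytic_capacity:
  assumes E: "compact E"
  shows "cauchy_capacity E \<le> analytic_capacity E"
  unfolding cauchy_capacity_def analytic_capacity_def
proof (rule SUP_least)
  fix \<nu> assume "\<nu> \<in> {\<nu>. complex_borel_measure \<nu> \<and> supported_on \<nu> E \<and>
                  (\<forall>z\<in>- Some ` E. cmod (cauchy_transform \<nu> z) \<le> 1)}"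
  then have \<nu>: "complex_borel_measure \<nu>" "supported_on \<nu> E"
    and bd: "\<And>z. z \<in> - Some ` E \<Longrightarrow> cmod (cauchy_transform \<nu> z) \<le> 1" by auto
  note ct = cauchy_transform_properties[OF E \<nu>]
  have None: "cauchy_transform \<nu> None = 0" by (simp add: cauchy_transform_def)
  have bd': "cmod (cauchy_transform \<nu> z) \<le> 1" if "z \<in> outer_domain E" for z
    using that outer_domain_subset[OF E] bd by blast
  have "sphere_holomorphic_on (cauchy_transform \<nu>) (outer_domain E)"
  proof (rule sphere_holomorphic_onI[OF E])
    show "(\<lambda>z. cauchy_transform \<nu> (Some z)) holomorphic_on outside E"
      by (rule holomorphic_on_subset[OF ct(1)]) (use outside_no_overlap[of E] in blast)
    show "((\<lambda>z. cauchy_transform \<nu> (Some z)) \<longlongrightarrow> cauchy_transform \<nu> None) at_infinity"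
      unfolding None by (rule tendsto_zero_of_times_ident[OF ct(2)])
  qed
  moreover have "bounded (cauchy_transform \<nu> ` outer_domain E)"
    using bd' by (auto simp: bounded_iff)
  moreover have "deriv_at_infinity (cauchy_transform \<nu>) = - \<nu> E"
    unfolding deriv_at_infinity_def None using ct(2) by (intro tendsto_Lim) (auto simp: trivial_limit_at_infinity)
  ultimately show "ereal (cmod (\<nu> E)) \<le>
      (SUP f\<in>{f \<in> H_infinity (outer_domain E). \<forall>z\<in>outer_domain E. cmod (f z) \<le> 1}.
        ereal (cmod (deriv_at_infinity f)))"
    using bd' by (intro SUP_upper2[of "cauchy_transform \<nu>"]) (auto simp: H_infinity_def)
qed

section \<open>Weak compactness for complex weights\<close>

text \<open>Helly selection is available on the line only. A measurable section of Schoenberg's curve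
  onto the four-dimensional cube carries joint laws of two complex variables to measures on
  \<open>[0, 1]\<close>, and continuity of the curve carries weak limits back.\<close>

definition schoenberg_fold :: "real \<Rightarrow> real" where
  "schoenberg_fold x = max 0 (min 1 (1 / 2 - cos (pi * x)))"

lemma schoenberg_fold_bounds: "0 \<le> schoenberg_fold x" "schoenberg_fold x \<le> 1"
  by (auto simp: schoenberg_fold_def)

lemma schoenberg_fold_periodic: "schoenberg_fold (2 * of_nat n + x) = schoenberg_fold x"
proof -
  have "cos (pi * (2 * of_nat n + x)) = cos (pi * x + 2 * real n * pi)"
    by (simp add: algebra_simps)
  also have "\<dots> = cos (pi * x)"
    by (simp only: cos_add cos_2npi sin_2npi mult_1_right mult_zero_right diff_zero)
  finally show ?thesis by (simp add: schoenberg_fold_def)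
qed

text \<open>Cosine takes the values \<open>1 / 2\<close> and \<open>- 1 / 2\<close> at
  \<open>pi / 3\<close> and \<open>2 * pi / 3\<close>, so the truncated function is constant, 0 or
  1, on the outer thirds of the unit interval. A point of the Cantor set lies in the one or the
  other according to its first digit.\<close>

lemma schoenberg_fold_0:
  assumes "0 \<le> x" "x \<le> 1 / 3"
  shows "schoenberg_fold x = 0"
proof -
  have "cos (pi / 3) \<le> cos (pi * x)"
    using assms by (intro cos_monotone_0_pi_le) auto
  then show ?thesis by (simp add: schoenberg_fold_def cos_60)
qed

lemma schoenberg_fold_1:
  assumes "2 / 3 \<le> x" "x \<le> 1"
  shows "schoenberg_fold x = 1"
proof -
  have "cos (pi * x) \<le> cos (2 / 3 * pi)"
    using assms by (intro cos_monotone_0_pi_le) auto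
  also have "cos (2 / 3 * pi) = - 1 / 2" by (simp add: cos_120)
  finally show ?thesis by (simp add: schoenberg_fold_def)
qed

text \<open>For \<open>a i\<close> in 0 and 1, the point of Cantor's set with ternary digits
  \<open>2 * a i\<close>.\<close>

definition cantor_point :: "(nat \<Rightarrow> real) \<Rightarrow> real" where
  "cantor_point a = (\<Sum>i. 2 * a i / 3 ^ Suc i)"

lemma geometric_3: "(\<lambda>i. 2 / 3 ^ Suc i :: real) sums 1"
  using sums_mult[OF geometric_sums[of "1 / 3 :: real"], of "2 / 3"]
  by (simp add: power_one_over field_simps)

lemma cantor_point_bounds:
  assumes "\<And>i. 0 \<le> a i \<and> a i \<le> 1"
  shows "summable (\<lambda>i. 2 * a i / 3 ^ Suc i)" "0 \<le> cantor_point a" "cantor_point a \<le> 1"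
proof -
  have le: "2 * a i / 3 ^ Suc i \<le> 2 / 3 ^ Suc i" for i
    using assms[of i] by (intro divide_right_mono) auto
  show s: "summable (\<lambda>i. 2 * a i / 3 ^ Suc i)"
    by (rule summable_comparison_test_ev[OF _ sums_summable[OF geometric_3]])
       (use le assms in auto)
  show "0 \<le> cantor_point a"
    unfolding cantor_point_def using assms by (intro suminf_nonneg s) auto
  show "cantor_point a \<le> 1"
    unfolding cantor_point_def using suminf_le[OF le s sums_summable[OF geometric_3]]
      sums_unique[OF geometric_3] by linarith
qed

lemma cantor_point_step:
  assumes "\<And>i. 0 \<le> a i \<and> a i \<le> 1"
  shows "3 * cantor_point a = 2 * a 0 + cantor_point (\<lambda>i. a (Suc i))"
proof -
  have s: "summable (\<lambda>i. 2 * a i / 3 ^ Suc i)" by (rule cantor_point_bounds(1)[OF assms])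
  have s': "summable (\<lambda>i. 2 * a (Suc i) / 3 ^ Suc (Suc i))"
    using s by (subst (asm) summable_Suc_iff[symmetric])
  have "cantor_point a = 2 * a 0 / 3 + (\<Sum>i. 2 * a (Suc i) / 3 ^ Suc (Suc i))"
    unfolding cantor_point_def using suminf_split_head[OF s] by simp
  moreover have "3 * (\<Sum>i. 2 * a (Suc i) / 3 ^ Suc (Suc i)) = cantor_point (\<lambda>i. a (Suc i))"
    unfolding cantor_point_def suminf_mult[OF s', symmetric] by simp
  ultimately show ?thesis by simp
qed

text \<open>The digits moved in front of the ternary point are 0 or 2, so together they form an even
  integer, which is invisible to a function of period 2.\<close>

lemma cantor_point_shift:
  assumes "\<And>i. a i = 0 \<or> a i = 1"
  shows "\<exists>n::nat. 3 ^ k * cantor_point a = 2 * of_nat n + cantor_point (\<lambda>i. a (i + k))"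
  using assms
proof (induction k arbitrary: a)
  case 0
  then show ?case by (intro exI[of _ 0]) simp
next
  case (Suc k)
  have b: "\<And>i. 0 \<le> a i \<and> a i \<le> 1" using Suc.prems by (metis order_refl zero_le_one)
  obtain n :: nat where
    n: "3 ^ k * cantor_point (\<lambda>i. a (Suc i)) = 2 * of_nat n + cantor_point (\<lambda>i. a (Suc (i + k)))"
    using Suc.IH[of "\<lambda>i. a (Suc i)"] Suc.prems by auto
  obtain m :: nat where m: "a 0 = of_nat m" using Suc.prems[of 0] by (metis of_nat_0 of_nat_1)
  have "3 ^ Suc k * cantor_point a = 3 ^ k * (3 * cantor_point a)" by simp
  also have "\<dots> = 2 * of_nat (3 ^ k * m + n) + cantor_point (\<lambda>i. a (i + Suc k))"
    unfolding cantor_point_step[OF b] using n m by (simp add: algebra_simps)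
  finally show ?case by blast
qed

lemma schoenberg_fold_cantor_point:
  assumes a: "\<And>i. a i = 0 \<or> a i = 1"
  shows "schoenberg_fold (3 ^ k * cantor_point a) = a k"
proof -
  obtain n :: nat where n: "3 ^ k * cantor_point a = 2 * of_nat n + cantor_point (\<lambda>i. a (i + k))"
    using cantor_point_shift[of a k, OF a] by blast
  let ?b = "\<lambda>i. a (i + k)" and ?c = "\<lambda>i. a (Suc i + k)"
  have b: "\<And>i. 0 \<le> ?b i \<and> ?b i \<le> 1" and c: "\<And>i. 0 \<le> ?c i \<and> ?c i \<le> 1"
    using a by (metis order_refl zero_le_one)+
  have step: "3 * cantor_point ?b = 2 * a k + cantor_point ?c"
    using cantor_point_step[of ?b, OF b] by simp
  have "schoenberg_fold (cantor_point ?b) = a k"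
    using a[of k]
  proof
    assume "a k = 0"
    then show ?thesis
      using step cantor_point_bounds(2,3)[of ?c, OF c] by (subst schoenberg_fold_0) auto
  next
    assume "a k = 1"
    then show ?thesis
      using step cantor_point_bounds(2,3)[of ?c, OF c] by (subst schoenberg_fold_1) auto
  qed
  then show ?thesis
    unfolding n schoenberg_fold_periodic .
qed

text \<open>Coordinates of Schoenberg's space-filling curve: on the Cantor set the fold reads off
  the digits with index congruent to \<open>j\<close> modulo 4 and makes them the binary digits of
  coordinate \<open>j\<close>.\<close>

definition schoenberg_coord :: "nat \<Rightarrow> real \<Rightarrow> real" where
  "schoenberg_coord j t = (\<Sum>n. schoenberg_fold (3 ^ (4 * n + j) * t) / 2 ^ Suc n)"

lemma geometric_2: "(\<lambda>i. 1 / 2 ^ Suc i :: real) sums 1"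
  using power_half_series by (simp add: power_one_over)

lemma schoenberg_coord_summable: "summable (\<lambda>n. schoenberg_fold (3 ^ (4 * n + j) * t) / 2 ^ Suc n)"
  by (rule summable_comparison_test_ev[OF _ sums_summable[OF geometric_2]])
     (auto simp: schoenberg_fold_bounds divide_right_mono)

lemma schoenberg_coord_bounds: "0 \<le> schoenberg_coord j t" "schoenberg_coord j t \<le> 1"
proof -
  show "0 \<le> schoenberg_coord j t"
    unfolding schoenberg_coord_def
    by (intro suminf_nonneg schoenberg_coord_summable) (simp add: schoenberg_fold_bounds)
  have "schoenberg_coord j t \<le> (\<Sum>i. 1 / 2 ^ Suc i)"
    unfolding schoenberg_coord_def
    by (intro suminf_le schoenberg_coord_summable sums_summable[OF geometric_2])
       (simp add: schoenberg_fold_bounds divide_right_mono)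
  then show "schoenberg_coord j t \<le> 1"
    using sums_unique[OF geometric_2] by simp
qed

lemma schoenberg_coord_continuous: "continuous_on UNIV (schoenberg_coord j)"
proof (rule uniform_limit_theorem)
  show "\<forall>\<^sub>F n in sequentially. continuous_on UNIV
      (\<lambda>t. \<Sum>i<n. schoenberg_fold (3 ^ (4 * i + j) * t) / 2 ^ Suc i)"
    unfolding schoenberg_fold_def by (intro always_eventually allI continuous_intros) auto
  show "uniform_limit UNIV (\<lambda>n t. \<Sum>i<n. schoenberg_fold (3 ^ (4 * i + j) * t) / 2 ^ Suc i)
      (schoenberg_coord j) sequentially"
    unfolding schoenberg_coord_def[abs_def]
    by (rule Weierstrass_m_test[OF _ sums_summable[OF geometric_2]])
       (auto simp: schoenberg_fold_bounds divide_right_mono)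
qed simp

definition binary_digit :: "nat \<Rightarrow> real \<Rightarrow> real" where
  "binary_digit n v = of_int \<lfloor>2 ^ Suc n * v\<rfloor> - 2 * of_int \<lfloor>2 ^ n * v\<rfloor>"

lemma binary_digit_cases: "binary_digit n v = 0 \<or> binary_digit n v = 1"
proof -
  let ?y = "2 ^ n * v"
  have "\<lfloor>2 * ?y\<rfloor> = 2 * \<lfloor>?y\<rfloor> \<or> \<lfloor>2 * ?y\<rfloor> = 2 * \<lfloor>?y\<rfloor> + 1"
    by linarith
  then show ?thesis
    by (auto simp: binary_digit_def mult.assoc)
qed

text \<open>The partial sums telescope to the dyadic truncations of \<open>v\<close>. The telescoped
  series starts at the integer part, which vanishes only for \<open>v < 1\<close>; hence values
  strictly below 1 are asked for wherever the section is used.\<close>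

lemma binary_digit_sums:
  assumes "0 \<le> v" "v < 1"
  shows "(\<lambda>n. binary_digit n v / 2 ^ Suc n) sums v"
proof -
  define F where "F n = of_int \<lfloor>2 ^ n * v\<rfloor> / (2 ^ n :: real)" for n
  have "binary_digit n v / 2 ^ Suc n = F (Suc n) - F n" for n
    by (simp add: binary_digit_def F_def field_simps)
  moreover have "F \<longlonglongrightarrow> v"
  proof (rule LIM_zero_cancel, rule Lim_null_comparison)
    show "\<forall>\<^sub>F n in sequentially. norm (F n - v) \<le> 1 / 2 ^ n"
    proof (intro always_eventually allI)
      fix n
      have "F n - v = (of_int \<lfloor>2 ^ n * v\<rfloor> - 2 ^ n * v) / 2 ^ n"
        by (simp add: F_def field_simps)
      moreover have "\<bar>of_int \<lfloor>2 ^ n * v\<rfloor> - 2 ^ n * v\<bar> \<le> 1" by linarith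
      ultimately show "norm (F n - v) \<le> 1 / 2 ^ n"
        by (simp add: divide_right_mono)
    qed
    show "(\<lambda>n. 1 / 2 ^ n :: real) \<longlonglongrightarrow> 0" by real_asymp
  qed
  moreover have "F 0 = 0" using assms by (simp add: F_def floor_eq_iff)
  ultimately show ?thesis
    using telescope_sums[of F v] by simp
qed

text \<open>Interleaves the binary digits of four numbers into the digits of one Cantor point; a
  right inverse of the curve on the half-open cube.\<close>

definition schoenberg_section :: "(nat \<Rightarrow> real) \<Rightarrow> real" where
  "schoenberg_section v = cantor_point (\<lambda>i. binary_digit (i div 4) (v (i mod 4)))"

lemma schoenberg_coord_section:
  assumes "j < 4" "0 \<le> v j" "v j < 1"
  shows "schoenberg_coord j (schoenberg_section v) = v j"
proof -
  have "schoenberg_fold (3 ^ (4 * n + j) * schoenberg_section v) = binary_digit n (v j)" for n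
    unfolding schoenberg_section_def
    by (subst schoenberg_fold_cantor_point) (use binary_digit_cases assms(1) in auto)
  then show ?thesis
    unfolding schoenberg_coord_def using sums_unique[OF binary_digit_sums[OF assms(2,3)]] by simp
qed

lemma schoenberg_section_bounds: "0 \<le> schoenberg_section v" "schoenberg_section v \<le> 1"
  unfolding schoenberg_section_def
  by (intro cantor_point_bounds; use binary_digit_cases in \<open>metis order_refl zero_le_one\<close>)+

text \<open>Binary digits jump, so the section is not continuous; measurability is what transports
  laws to the line.\<close>

lemma schoenberg_section_measurable:
  assumes [measurable]: "\<And>j. j < 4 \<Longrightarrow> (\<lambda>\<omega>. v \<omega> j) \<in> borel_measurable M"
  shows "(\<lambda>\<omega>. schoenberg_section (v \<omega>)) \<in> borel_measurable M"
proof -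
  have [measurable]: "(\<lambda>\<omega>. v \<omega> (i mod 4)) \<in> borel_measurable M" for i :: nat
    by (rule assms) simp
  show ?thesis
    unfolding schoenberg_section_def cantor_point_def binary_digit_def by measurable
qed

section \<open>Selection of a weakly convergent subsequence\<close>

text \<open>The joint law of \<open>X n\<close> and \<open>W n\<close> is carried to
  \<open>[0, 1]\<close> by the section, Helly selection gives a limit \<open>Q\<close> there, and
  the continuous coordinates of the curve read position and weight back as functions
  \<open>x\<close> and \<open>w\<close> of one real variable. For a continuous \<open>h\<close> the
  composition with \<open>x\<close> and \<open>w\<close> is bounded, because their ranges
  are.\<close>

lemma weak_compactness:
  fixes P :: "nat \<Rightarrow> 'a measure" and X W :: "nat \<Rightarrow> 'a \<Rightarrow> complex"
  assumes P: "\<And>n. prob_space (P n)"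
    and X [measurable]: "\<And>n. X n \<in> borel_measurable (P n)"
    and W [measurable]: "\<And>n. W n \<in> borel_measurable (P n)"
    and bX: "\<And>n \<omega>. norm (X n \<omega>) \<le> R" and bW: "\<And>n \<omega>. norm (W n \<omega>) \<le> R"
  obtains r Q x w where "strict_mono (r :: nat \<Rightarrow> nat)" "real_distribution Q"
    "continuous_on UNIV x" "continuous_on UNIV w" "bounded (range x)" "bounded (range w)"
    "\<And>h :: complex \<Rightarrow> complex \<Rightarrow> complex. continuous_on UNIV (\<lambda>(a, b). h a b) \<Longrightarrow>
       (\<lambda>n. LINT \<omega>|P (r n). h (X (r n) \<omega>) (W (r n) \<omega>)) \<longlonglongrightarrow> (LINT t|Q. h (x t) (w t))"
proof -
  \<comment> \<open>The factor 4 places the rescaled coordinates within \<open>1 / 4\<close> of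
    \<open>1 / 2\<close>, hence strictly below 1, as the binary expansion requires.\<close>
  define S where "S = 4 * (\<bar>R\<bar> + 1)"
  have S: "S > 0" by (simp add: S_def)
  define v where "v n \<omega> j = (if j = 0 then Re (X n \<omega>) else if j = 1 then Im (X n \<omega>)
      else if j = 2 then Re (W n \<omega>) else Im (W n \<omega>)) / S + 1 / 2" for n \<omega> and j :: nat
  have small: "\<bar>y\<bar> / S \<le> 1 / 4" if "\<bar>y\<bar> \<le> R" for y
    using that S by (simp add: S_def field_simps)
  have v01: "0 \<le> v n \<omega> j \<and> v n \<omega> j < 1" for n \<omega> j
  proof -
    define y where "y = (if j = 0 then Re (X n \<omega>) else if j = 1 then Im (X n \<omega>)
      else if j = 2 then Re (W n \<omega>) else Im (W n \<omega>))"
    have "\<bar>y\<bar> \<le> R"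
      unfolding y_def using abs_Re_le_cmod[of "X n \<omega>"] abs_Im_le_cmod[of "X n \<omega>"]
        abs_Re_le_cmod[of "W n \<omega>"] abs_Im_le_cmod[of "W n \<omega>"] bX[of n \<omega>] bW[of n \<omega>] by auto
    then have "\<bar>y / S\<bar> \<le> 1 / 4"
      using small S by simp
    then show ?thesis
      unfolding v_def y_def[symmetric] by linarith
  qed
  define T where "T n \<omega> = schoenberg_section (v n \<omega>)" for n \<omega>
  have T_meas [measurable]: "T n \<in> borel_measurable (P n)" for n
    unfolding T_def v_def by (rule schoenberg_section_measurable) measurable
  define \<mu> where "\<mu> n = distr (P n) borel (T n)" for n
  have \<mu>: "real_distribution (\<mu> n)" for n
    unfolding \<mu>_def using P by (intro prob_space.real_distribution_distr) auto
  have "tight \<mu>"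
    unfolding tight_def
  proof (intro conjI allI impI)
    fix e :: real assume "e > 0"
    show "\<exists>a b. a < b \<and> (\<forall>n. measure (\<mu> n) {a<..b} > 1 - e)"
    \<comment> \<open>The intervals in the definition of tightness are open on the left, so the left
      end has to lie below 0.\<close>
    proof (rule exI[of _ "-1"], rule exI[of _ 1], intro conjI allI)
      fix n
      interpret prob_space "P n" by (rule P)
      have "- 1 < schoenberg_section u" for u
        using schoenberg_section_bounds(1)[of u] by linarith
      then have "T n -` {-1<..1} \<inter> space (P n) = space (P n)"
        using schoenberg_section_bounds(2) by (auto simp: T_def)
      then have "measure (\<mu> n) {-1<..1} = 1"
        by (simp add: \<mu>_def measure_distr prob_space)
      then show "measure (\<mu> n) {-1<..1} > 1 - e" using \<open>e > 0\<close> by simp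
    qed simp
  qed (rule \<mu>)
  then obtain r Q where r: "strict_mono r" and Q: "real_distribution Q"
    and conv: "weak_conv_m (\<mu> \<circ> id \<circ> r) Q"
    using tight_imp_convergent_subsubsequence[of \<mu> id] by (auto simp: strict_mono_def)
  define c where "c j t = S * (schoenberg_coord j t - 1 / 2)" for j t
  have c_cont: "continuous_on UNIV (c j)" for j
    unfolding c_def[abs_def] by (intro continuous_intros schoenberg_coord_continuous)
  have c_bd: "\<bar>c j t\<bar> \<le> S" for j t
  proof -
    have "\<bar>schoenberg_coord j t - 1 / 2\<bar> \<le> 1"
      using schoenberg_coord_bounds[of j t] by linarith
    then show ?thesis using S by (simp add: c_def abs_mult mult_left_le)
  qed
  define x where "x t = Complex (c 0 t) (c 1 t)" for t
  define w where "w t = Complex (c 2 t) (c 3 t)" for t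
  have xcont: "continuous_on UNIV x" and wcont: "continuous_on UNIV w"
    unfolding x_def[abs_def] w_def[abs_def] by (intro continuous_on_Complex c_cont)+
  have bd: "norm (Complex (c i t) (c j t)) \<le> 2 * S" for i j t
    using cmod_le[of "Complex (c i t) (c j t)"] c_bd[of i t] c_bd[of j t] by simp
  have bx: "norm (x t) \<le> 2 * S" and bw: "norm (w t) \<le> 2 * S" for t
    by (simp_all only: x_def w_def bd)
  have cT: "c j (T n \<omega>) = S * (v n \<omega> j - 1 / 2)" if "j < 4" for j n \<omega>
    unfolding c_def T_def using schoenberg_coord_section[OF that] v01 by simp
  \<comment> \<open>The section is an exact right inverse, so the integrals of
    \<open>h (X n \<omega>) (W n \<omega>)\<close> become integrals of one and the same function on
    the line.\<close>
  have xT: "x (T n \<omega>) = X n \<omega>" and wT: "w (T n \<omega>) = W n \<omega>" for n \<omega>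
    using S by (simp_all add: x_def w_def cT complex_eq_iff) (simp_all add: v_def)
  show thesis
  proof (rule that[OF r Q xcont wcont])
    show "bounded (range x)" "bounded (range w)" using bx bw by (auto simp: bounded_iff)
    fix h :: "complex \<Rightarrow> complex \<Rightarrow> complex"
    assume h: "continuous_on UNIV (\<lambda>(a, b). h a b)"
    define g where "g t = h (x t) (w t)" for t
    have g_eq: "g = (\<lambda>(a, b). h a b) \<circ> (\<lambda>t. (x t, w t))" by (auto simp: g_def)
    have gcont: "continuous_on UNIV g"
      unfolding g_eq by (intro continuous_on_compose continuous_on_Pair xcont wcont
          continuous_on_subset[OF h]) auto
    have "compact (cball (0::complex) (2 * S) \<times> cball (0::complex) (2 * S))"
      by (intro compact_Times compact_cball)
    then have "compact ((\<lambda>(a, b). h a b) ` (cball 0 (2 * S) \<times> cball 0 (2 * S)))"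
      by (intro compact_continuous_image continuous_on_subset[OF h]) auto
    then obtain B where B: "\<And>p. p \<in> (\<lambda>(a, b). h a b) ` (cball 0 (2 * S) \<times> cball 0 (2 * S)) \<Longrightarrow> norm p \<le> B"
      using compact_imp_bounded bounded_iff by metis
    have gbd: "norm (g t) \<le> B" for t
      using bx[of t] bw[of t] by (intro B) (force simp: g_def)
    have gmeas [measurable]: "g \<in> borel_measurable borel"
      by (rule borel_measurable_continuous_onI[OF gcont])
    have "(\<lambda>n. integral\<^sup>L ((\<mu> \<circ> id \<circ> r) n) g) \<longlonglongrightarrow> integral\<^sup>L Q g"
    proof (rule weak_conv_imp_integral_bdd_continuous_conv)
      show "weak_conv_m (\<mu> \<circ> id \<circ> r) Q" by (rule conv)
      show "isCont g t" for t using gcont by (simp add: continuous_on_eq_continuous_at)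
      show "norm (g t) \<le> B" for t by (rule gbd)
    qed (use \<mu> Q in auto)
    moreover have "integral\<^sup>L (\<mu> n) g = (LINT \<omega>|P n. h (X n \<omega>) (W n \<omega>))" for n
      unfolding \<mu>_def by (subst integral_distr) (auto simp: g_def xT wT)
    ultimately show "(\<lambda>n. LINT \<omega>|P (r n). h (X (r n) \<omega>) (W (r n) \<omega>)) \<longlonglongrightarrow> (LINT t|Q. h (x t) (w t))"
      by (simp add: g_def[abs_def])
  qed
qed

section \<open>Cauchy's theorem for cycles around a compact set\<close>

text \<open>The two loops are joined by a path run forth and back, whose two contributions
  cancel.\<close>

lemma loop_sum:
  assumes U: "open U" "connected U"
    and 1: "valid_path \<gamma>" "pathfinish \<gamma> = pathstart \<gamma>" "path_image \<gamma> \<subseteq> U"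
    and 2: "valid_path \<delta>" "pathfinish \<delta> = pathstart \<delta>" "path_image \<delta> \<subseteq> U"
  obtains \<eta> where "valid_path \<eta>" "pathfinish \<eta> = pathstart \<eta>" "path_image \<eta> \<subseteq> U"
    "\<And>g. g holomorphic_on U \<Longrightarrow> contour_integral \<eta> g = contour_integral \<gamma> g + contour_integral \<delta> g"
proof -
  have "pathstart \<gamma> \<in> U" "pathstart \<delta> \<in> U"
    using 1(3) 2(3) by auto
  then obtain q where q: "polynomial_function q" "path_image q \<subseteq> U"
      "pathstart q = pathstart \<gamma>" "pathfinish q = pathstart \<delta>"
    using connected_open_polynomial_connected[OF U, of "pathstart \<gamma>" "pathstart \<delta>"] by blast
  have vq: "valid_path q" by (rule valid_path_polynomial_function[OF q(1)])
  have ci: "g contour_integrable_on p" if "g holomorphic_on U" "valid_path p" "path_image p \<subseteq> U" for g p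
    using contour_integrable_holomorphic_simple[OF that(1) U(1) that(2,3)] .
  let ?\<eta> = "\<gamma> +++ (q +++ (\<delta> +++ reversepath q))"
  show thesis
  proof (rule that[of ?\<eta>])
    show "valid_path ?\<eta>"
      using 1 2 q vq by (simp add: valid_path_join valid_path_reversepath)
    show "pathfinish ?\<eta> = pathstart ?\<eta>" using q 1 2 by simp
    show "path_image ?\<eta> \<subseteq> U"
      using 1 2 q by (simp add: path_image_join)
    fix g assume g: "g holomorphic_on U"
    note c1 = ci[OF g 1(1,3)] and c2 = ci[OF g 2(1,3)] and cq = ci[OF g vq q(2)]
    have c3: "g contour_integrable_on reversepath q"
      using cq vq by (simp add: contour_integrable_reversepath)
    have c4: "g contour_integrable_on (\<delta> +++ reversepath q)"
      using c2 c3 2(1) vq by (simp add: contour_integrable_join valid_path_reversepath)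
    have v4: "valid_path (\<delta> +++ reversepath q)"
      using 2 vq q by (simp add: valid_path_join valid_path_reversepath)
    have c5: "g contour_integrable_on (q +++ (\<delta> +++ reversepath q))"
      using cq c4 vq v4 by (simp add: contour_integrable_join)
    have v5: "valid_path (q +++ (\<delta> +++ reversepath q))"
      using 2 vq q v4 by (simp add: valid_path_join)
    show "contour_integral ?\<eta> g = contour_integral \<gamma> g + contour_integral \<delta> g"
      using c1 c2 c3 c4 c5 cq 1(1) 2(1) vq v4 v5
      by (simp add: contour_integral_reversepath valid_path_reversepath)
  qed
qed

text \<open>Turns a cycle into one closed path with the same integrals of holomorphic functions, the
  form in which Cauchy's global theorem is applied.\<close>

lemma cycle_loop:
  assumes U: "open U" "connected U" "U \<noteq> {}" and "finite \<Gamma>"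
    and "\<And>\<gamma>. \<gamma> \<in> \<Gamma> \<Longrightarrow> valid_path \<gamma> \<and> pathfinish \<gamma> = pathstart \<gamma> \<and> path_image \<gamma> \<subseteq> U"
  shows "\<exists>\<eta>. valid_path \<eta> \<and> pathfinish \<eta> = pathstart \<eta> \<and> path_image \<eta> \<subseteq> U \<and>
    (\<forall>g. g holomorphic_on U \<longrightarrow> contour_integral \<eta> g = (\<Sum>\<gamma>\<in>\<Gamma>. contour_integral \<gamma> g))"
  using assms(4,5)
proof (induction \<Gamma> rule: finite_induct)
  case empty
  obtain a where "a \<in> U" using U(3) by blast
  then show ?case
    by (intro exI[of _ "linepath a a"] conjI allI impI)
      (simp_all only: valid_path_linepath pathstart_linepath pathfinish_linepath path_image_linepath
        closed_segment_idem contour_integral_trivial sum.empty insert_subset empty_subsetI)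
next
  case (insert \<gamma> \<Gamma>)
  then obtain \<eta> where \<eta>: "valid_path \<eta>" "pathfinish \<eta> = pathstart \<eta>" "path_image \<eta> \<subseteq> U"
    "\<And>g. g holomorphic_on U \<Longrightarrow> contour_integral \<eta> g = (\<Sum>\<gamma>\<in>\<Gamma>. contour_integral \<gamma> g)"
    by auto
  have \<gamma>: "valid_path \<gamma>" "pathfinish \<gamma> = pathstart \<gamma>" "path_image \<gamma> \<subseteq> U"
    using insert.prems by auto
  obtain \<theta> where \<theta>: "valid_path \<theta>" "pathfinish \<theta> = pathstart \<theta>" "path_image \<theta> \<subseteq> U"
    "\<And>g. g holomorphic_on U \<Longrightarrow> contour_integral \<theta> g = contour_integral \<gamma> g + contour_integral \<eta> g"
    using loop_sum[OF U(1,2) \<gamma> \<eta>(1,2,3)] by blast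
  show ?case
  proof (intro exI[of _ \<theta>] conjI allI impI)
    fix g assume "g holomorphic_on U"
    then show "contour_integral \<theta> g = (\<Sum>\<gamma>\<in>insert \<gamma> \<Gamma>. contour_integral \<gamma> g)"
      using \<theta>(4) \<eta>(4) insert.hyps by simp
  qed (use \<theta> in auto)
qed

lemma winding_number_contour_integral:
  assumes "valid_path \<gamma>" "z \<notin> path_image \<gamma>"
  shows "contour_integral \<gamma> (\<lambda>w. 1 / (w - z)) = 2 * of_real pi * \<i> * winding_number \<gamma> z"
  using winding_number_valid_path[OF assms] by (simp add: field_simps)

text \<open>The cycle and the reverse of \<open>\<delta>\<close> are joined to one loop. Its winding
  number about a point off \<open>U\<close> is found by integrating \<open>1 / (w - z)\<close>,
  which is holomorphic on \<open>U\<close>, and is 0.\<close>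

lemma Cauchy_theorem_cycle:
  assumes U: "open U" "connected U" and "finite \<Gamma>"
    and \<Gamma>: "\<And>\<gamma>. \<gamma> \<in> \<Gamma> \<Longrightarrow> valid_path \<gamma> \<and> pathfinish \<gamma> = pathstart \<gamma> \<and> path_image \<gamma> \<subseteq> U"
    and \<delta>: "valid_path \<delta>" "pathfinish \<delta> = pathstart \<delta>" "path_image \<delta> \<subseteq> U"
    and wn: "\<And>z. z \<notin> U \<Longrightarrow> (\<Sum>\<gamma>\<in>\<Gamma>. winding_number \<gamma> z) = winding_number \<delta> z"
    and g: "g holomorphic_on U"
  shows "(\<Sum>\<gamma>\<in>\<Gamma>. contour_integral \<gamma> g) = contour_integral \<delta> g"
proof -
  have "U \<noteq> {}" using \<delta>(3) by auto
  then obtain \<eta> where \<eta>: "valid_path \<eta>" "pathfinish \<eta> = pathstart \<eta>" "path_image \<eta> \<subseteq> U"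
    "\<And>g. g holomorphic_on U \<Longrightarrow> contour_integral \<eta> g = (\<Sum>\<gamma>\<in>\<Gamma>. contour_integral \<gamma> g)"
    using cycle_loop[OF U _ \<open>finite \<Gamma>\<close> \<Gamma>] by auto
  have r\<delta>: "valid_path (reversepath \<delta>)" "pathfinish (reversepath \<delta>) = pathstart (reversepath \<delta>)"
    "path_image (reversepath \<delta>) \<subseteq> U"
    using \<delta> by (auto simp: valid_path_reversepath)
  obtain \<theta> where \<theta>: "valid_path \<theta>" "pathfinish \<theta> = pathstart \<theta>" "path_image \<theta> \<subseteq> U"
    "\<And>g. g holomorphic_on U \<Longrightarrow>
      contour_integral \<theta> g = contour_integral \<eta> g + contour_integral (reversepath \<delta>) g"
    using loop_sum[OF U \<eta>(1,2,3) r\<delta>] by blast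
  have \<theta>_eq: "contour_integral \<theta> g = (\<Sum>\<gamma>\<in>\<Gamma>. contour_integral \<gamma> g) - contour_integral \<delta> g"
    if "g holomorphic_on U" for g
    using \<theta>(4)[OF that] \<eta>(4)[OF that] \<delta>(1) by (simp add: contour_integral_reversepath)
  have "winding_number \<theta> z = 0" if z: "z \<notin> U" for z
  proof -
    have hol: "(\<lambda>w. 1 / (w - z)) holomorphic_on U"
      using z by (intro holomorphic_intros) auto
    have "2 * of_real pi * \<i> * winding_number \<theta> z
        = (\<Sum>\<gamma>\<in>\<Gamma>. 2 * of_real pi * \<i> * winding_number \<gamma> z) - 2 * of_real pi * \<i> * winding_number \<delta> z"
    proof -
      have "contour_integral \<theta> (\<lambda>w. 1 / (w - z)) = 2 * of_real pi * \<i> * winding_number \<theta> z"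
        by (rule winding_number_contour_integral) (use \<theta> z in auto)
      moreover have "contour_integral \<delta> (\<lambda>w. 1 / (w - z)) = 2 * of_real pi * \<i> * winding_number \<delta> z"
        by (rule winding_number_contour_integral) (use \<delta> z in auto)
      moreover have "contour_integral \<gamma> (\<lambda>w. 1 / (w - z)) = 2 * of_real pi * \<i> * winding_number \<gamma> z"
        if "\<gamma> \<in> \<Gamma>" for \<gamma>
        by (rule winding_number_contour_integral) (use \<Gamma>[OF that] z in auto)
      ultimately show ?thesis
        using \<theta>_eq[OF hol] by simp
    qed
    then have "2 * of_real pi * \<i> * winding_number \<theta> z = 0"
      using wn[OF z] by (simp add: sum_distrib_left[symmetric])
    then show ?thesis by simp
  qed
  then have "(g has_contour_integral 0) \<theta>"
    by (rule Cauchy_theorem_global[OF U(1) g \<theta>(1,2,3)])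
  then show ?thesis
    using \<theta>_eq[OF g] by (simp add: contour_integral_unique)
qed

text \<open>On the circle of radius \<open>R\<close> the function differs from \<open>b / w\<close>
  by \<open>o(1 / R)\<close>, while the length of the circle is \<open>2 * pi * R\<close>.\<close>

lemma contour_integral_large_circle:
  assumes lim: "((\<lambda>w. w * g w) \<longlongrightarrow> b) at_infinity"
    and hol: "g holomorphic_on - cball 0 R0"
  shows "((\<lambda>R. contour_integral (circlepath 0 R) g) \<longlongrightarrow> 2 * of_real pi * \<i> * b) at_top"
proof (rule tendstoI)
  fix e :: real assume "e > 0"
  define e' where "e' = e / (4 * pi)"
  have e': "e' > 0" using \<open>e > 0\<close> by (simp add: e'_def)
  obtain B where B: "\<And>w. norm w \<ge> B \<Longrightarrow> dist (w * g w) b < e'"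
    using tendstoD[OF lim e'] by (auto simp: eventually_at_infinity)
  have main: "dist (contour_integral (circlepath 0 R) g) (2 * of_real pi * \<i> * b) < e"
    if R: "R > max 1 (max B R0)" for R
  proof -
    have "R > 0" using R by simp
    have gi: "g contour_integrable_on circlepath 0 R"
      by (rule contour_integrable_continuous_circlepath)
         (use R in \<open>auto intro!: continuous_on_subset[OF holomorphic_on_imp_continuous_on[OF hol]]\<close>)
    have cont: "continuous_on (path_image (circlepath 0 R)) (\<lambda>w. 1 / (w - 0))"
      using \<open>R > 0\<close> by (intro continuous_intros) auto
    have "((\<lambda>w. 1 / (w - 0)) has_contour_integral 2 * of_real pi * \<i>) (circlepath 0 R)"
      using has_contour_integral_integral[OF contour_integrable_continuous_circlepath[OF cont]]
      unfolding contour_integral_circlepath[OF \<open>R > 0\<close>] .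
    then have "((\<lambda>w. b * (1 / (w - 0))) has_contour_integral b * (2 * of_real pi * \<i>)) (circlepath 0 R)"
      by (rule has_contour_integral_lmul)
    then have "((\<lambda>w. g w - b * (1 / (w - 0))) has_contour_integral
        contour_integral (circlepath 0 R) g - b * (2 * of_real pi * \<i>)) (circlepath 0 R)"
      by (rule has_contour_integral_diff[OF has_contour_integral_integral[OF gi]])
    then have "norm (contour_integral (circlepath 0 R) g - b * (2 * of_real pi * \<i>))
        \<le> (e' / R) * (2 * pi * R)"
    proof (rule has_contour_integral_bound_circlepath)
      fix w :: complex assume w: "norm (w - 0) = R"
      then have "w \<noteq> 0" using \<open>R > 0\<close> by auto
      then have "norm (g w - b * (1 / (w - 0))) = norm (w * g w - b) / R"
        using w by (simp add: field_simps flip: norm_divide norm_mult) (simp add: norm_mult norm_divide)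
      also have "\<dots> \<le> e' / R"
        using B[of w] w R by (intro divide_right_mono) (auto simp: dist_norm)
      finally show "norm (g w - b * (1 / (w - 0))) \<le> e' / R" .
    qed (use e' \<open>R > 0\<close> in auto)
    also have "\<dots> = e / 2" using \<open>R > 0\<close> by (simp add: e'_def)
    finally show ?thesis using \<open>e > 0\<close> by (simp add: dist_norm mult.commute)
  qed
  show "\<forall>\<^sub>F R in at_top. dist (contour_integral (circlepath 0 R) g) (2 * of_real pi * \<i> * b) < e"
    using eventually_gt_at_top[of "max 1 (max B R0)"] by eventually_elim (rule main)
qed

text \<open>The straight way from \<open>z\<close> to a first contact with the closure of
  \<open>outside E\<close> never enters \<open>outside E\<close>. Closed curves lying in
  \<open>outside E\<close> therefore have equal winding numbers at \<open>z\<close> and at the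
  boundary point \<open>b\<close>.\<close>

lemma segment_to_outside:
  assumes E: "compact E" and z: "z \<notin> outside E"
  obtains b where "b \<in> frontier (outside E)" "closed_segment z b \<subseteq> - outside (E :: complex set)"
proof (cases "z \<in> closure (outside E)")
  case True
  have "open (outside E)" using E by (simp add: compact_imp_closed open_outside)
  then have "z \<in> frontier (outside E)"
    using True z by (simp add: frontier_def interior_open)
  then show thesis using z by (intro that[of z]) auto
next
  case False
  have op: "open (outside E)" using E by (simp add: compact_imp_closed open_outside)
  have "outside E \<noteq> {}"
    using unbounded_outside[OF compact_imp_bounded[OF E]] by auto
  then have "closure (outside E) \<noteq> {}" by simp
  then obtain b where b: "b \<in> closure (outside E)" "open_segment z b \<inter> closure (outside E) = {}"
    using segment_to_point_exists[OF closed_closure] by metis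
  have "z \<noteq> b" using b(1) False by auto
  have "b \<notin> outside E"
  proof
    assume "b \<in> outside E"
    moreover have "b \<in> closure (open_segment z b)"
      using \<open>z \<noteq> b\<close> by (simp add: closure_open_segment)
    ultimately have "outside E \<inter> open_segment z b \<noteq> {}"
      using open_Int_closure_eq_empty[OF op] by blast
    then show False using b(2) closure_subset[of "outside E"] by blast
  qed
  then have "b \<in> frontier (outside E)"
    using b(1) op by (simp add: frontier_def interior_open)
  moreover have "closed_segment z b \<subseteq> - outside E"
    using b(2) z \<open>b \<notin> outside E\<close> closure_subset[of "outside E"]
    unfolding closed_segment_eq_open by blast
  ultimately show thesis by (rule that)
qed

lemma winding_number_constant_eq:
  assumes "path \<gamma>" "pathfinish \<gamma> = pathstart \<gamma>" "connected S" "S \<inter> path_image \<gamma> = {}" "x \<in> S" "y \<in> S"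
  shows "winding_number \<gamma> x = winding_number \<gamma> y"
  using winding_number_constant[OF assms(1-4)] assms(5,6) by (metis constant_on_def)

text \<open>The curves of the cycle inside bounded components of the complement do not contribute to the
  winding number about boundary points of the unbounded component.\<close>

lemma winding_number_outer_curves:
  assumes F: "compact F" and "finite \<Gamma>"
    and \<Gamma>: "\<And>\<gamma>. \<gamma> \<in> \<Gamma> \<Longrightarrow> path \<gamma> \<and> pathfinish \<gamma> = pathstart \<gamma> \<and> path_image \<gamma> \<inter> F = {}"
    and wn: "\<And>z. z \<in> F \<Longrightarrow> (\<Sum>\<gamma>\<in>\<Gamma>. winding_number \<gamma> z) = 1"
    and z: "z \<notin> outside F"
  shows "(\<Sum>\<gamma> | \<gamma> \<in> \<Gamma> \<and> path_image \<gamma> \<subseteq> outside F. winding_number \<gamma> z) = 1"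
proof -
  have op: "open (outside F)" using F by (simp add: compact_imp_closed open_outside)
  obtain b where b: "b \<in> frontier (outside F)" "closed_segment z b \<subseteq> - outside F"
    using segment_to_outside[OF F z] by blast
  have "b \<in> F"
    using b(1) frontier_outside_subset[of F] F by (auto simp: compact_imp_closed)
  \<comment> \<open>Such a curve lies in \<open>inside F\<close>. As \<open>b\<close> adheres to
    \<open>outside F\<close>, the set \<open>insert b (outside F)\<close> is connected, misses the
    curve and reaches points far away from it.\<close>
  have inner: "winding_number \<gamma> b = 0" if \<gamma>: "\<gamma> \<in> \<Gamma>" "\<not> path_image \<gamma> \<subseteq> outside F" for \<gamma>
  proof -
    have p: "path \<gamma>" "pathfinish \<gamma> = pathstart \<gamma>" "path_image \<gamma> \<inter> F = {}"
      using \<Gamma>[OF \<gamma>(1)] by auto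
    have disj: "path_image \<gamma> \<inter> outside F = {}"
    proof (rule ccontr)
      assume "path_image \<gamma> \<inter> outside F \<noteq> {}"
      moreover have "path_image \<gamma> \<subseteq> outside F \<union> inside F"
        using p(3) inside_Un_outside[of F] by blast
      moreover have "inside F \<inter> path_image \<gamma> \<noteq> {}"
        using \<gamma>(2) calculation(2) by blast
      moreover have "outside F \<inter> inside F \<inter> path_image \<gamma> = {}"
        using inside_Int_outside[of F] by blast
      ultimately show False
        using connectedD[OF connected_path_image[OF p(1)] op open_inside[OF compact_imp_closed[OF F]]]
        by blast
    qed
    have "connected (insert b (outside F))"
    proof (rule connected_intermediate_closure)
      show "connected (outside F)"
        by (rule connected_outside) (use F in \<open>auto simp: compact_imp_bounded\<close>)
      show "insert b (outside F) \<subseteq> closure (outside F)"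
        using b(1) closure_subset by (auto simp: frontier_def)
    qed auto
    moreover have "insert b (outside F) \<inter> path_image \<gamma> = {}"
      using disj p(3) \<open>b \<in> F\<close> by blast
    moreover obtain B where B: "path_image \<gamma> \<subseteq> ball 0 B"
      using compact_imp_bounded[OF compact_path_image[OF p(1)]] bounded_subset_ballD by metis
    obtain y where y: "y \<in> outside F" "y \<notin> ball 0 B"
      using outside_not_subset_bounded[OF compact_imp_bounded[OF F] bounded_ball] by metis
    have "winding_number \<gamma> y = 0"
      by (rule winding_number_zero_outside[OF p(1) convex_ball p(2) y(2) B])
    ultimately show ?thesis
      using winding_number_constant_eq[OF p(1,2), of "insert b (outside F)" b y] y(1) by simp
  qed
  have "(\<Sum>\<gamma> | \<gamma> \<in> \<Gamma> \<and> path_image \<gamma> \<subseteq> outside F. winding_number \<gamma> z)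
      = (\<Sum>\<gamma> | \<gamma> \<in> \<Gamma> \<and> path_image \<gamma> \<subseteq> outside F. winding_number \<gamma> b)"
  proof (rule sum.cong[OF refl])
    fix \<gamma> assume \<gamma>: "\<gamma> \<in> {\<gamma> \<in> \<Gamma>. path_image \<gamma> \<subseteq> outside F}"
    then show "winding_number \<gamma> z = winding_number \<gamma> b"
      using \<Gamma>[of \<gamma>] b(2) by (intro winding_number_constant_eq[of \<gamma> "closed_segment z b"]) auto
  qed
  also have "\<dots> = (\<Sum>\<gamma>\<in>\<Gamma>. winding_number \<gamma> b)"
    by (rule sum.mono_neutral_left) (use \<open>finite \<Gamma>\<close> inner in auto)
  finally show ?thesis using wn[OF \<open>b \<in> F\<close>] by simp
qed

text \<open>About every point off \<open>outside F\<close> the cycle has the winding number of a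
  large circle, so both have the same integral of \<open>g\<close>, and the one over the circle is
  read off at infinity.\<close>

lemma contour_integral_cycle_at_infinity:
  assumes F: "compact F" and "finite \<Gamma>"
    and \<Gamma>: "\<And>\<gamma>. \<gamma> \<in> \<Gamma> \<Longrightarrow> valid_path \<gamma> \<and> pathfinish \<gamma> = pathstart \<gamma> \<and> path_image \<gamma> \<subseteq> outside F"
    and wn: "\<And>z. z \<notin> outside F \<Longrightarrow> (\<Sum>\<gamma>\<in>\<Gamma>. winding_number \<gamma> z) = 1"
    and g: "g holomorphic_on outside F" and lim: "((\<lambda>w. w * g w) \<longlongrightarrow> b) at_infinity"
  shows "(\<Sum>\<gamma>\<in>\<Gamma>. contour_integral \<gamma> g) = 2 * of_real pi * \<i> * b"
proof -
  obtain R0 where R0: "R0 > 0" "- outside F \<subseteq> ball 0 R0"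
    using compact_imp_bounded[OF compact_Compl_outside[OF F]] by (meson bounded_subset_ballD)
  have eq: "contour_integral (circlepath 0 R) g = (\<Sum>\<gamma>\<in>\<Gamma>. contour_integral \<gamma> g)" if R: "R > R0" for R
  proof (rule Cauchy_theorem_cycle[OF _ _ \<open>finite \<Gamma>\<close> \<Gamma> _ _ _ _ g, symmetric])
    show "open (outside F)" using F by (simp add: compact_imp_closed open_outside)
    show "connected (outside F)"
      by (rule connected_outside) (use F in \<open>auto simp: compact_imp_bounded\<close>)
    show "path_image (circlepath 0 R) \<subseteq> outside F"
      using R R0 by (auto simp: subset_iff)
    fix z assume z: "z \<notin> outside F"
    then have "norm (z - 0) < R" using R R0 by auto
    then show "(\<Sum>\<gamma>\<in>\<Gamma>. winding_number \<gamma> z) = winding_number (circlepath 0 R) z"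
      using wn[OF z] winding_number_circlepath by metis
  qed auto
  have "((\<lambda>R. contour_integral (circlepath 0 R) g) \<longlongrightarrow> 2 * of_real pi * \<i> * b) at_top"
    by (rule contour_integral_large_circle[OF lim, of R0])
       (rule holomorphic_on_subset[OF g], use R0 in \<open>auto simp: subset_iff\<close>)
  moreover have "\<forall>\<^sub>F R in at_top. contour_integral (circlepath 0 R) g = (\<Sum>\<gamma>\<in>\<Gamma>. contour_integral \<gamma> g)"
    using eventually_gt_at_top[of R0] by eventually_elim (rule eq)
  ultimately have "((\<lambda>R::real. \<Sum>\<gamma>\<in>\<Gamma>. contour_integral \<gamma> g) \<longlongrightarrow> 2 * of_real pi * \<i> * b) at_top"
    by (simp add: tendsto_cong)
  then show ?thesis
    by (simp add: tendsto_const_iff)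
qed

section \<open>Bounded functions off sets of finite Painleve length\<close>

lemma set_lebesgue_integral_01:
  fixes f :: "real \<Rightarrow> 'a::euclidean_space"
  assumes "continuous_on {0..1} f"
  shows "integrable lborel (\<lambda>t. indicator {0..1} t *\<^sub>R f t)"
    and "(LINT t|lborel. indicator {0..1} t *\<^sub>R f t) = integral {0..1} f"
proof -
  have "set_integrable lborel {0..1} f"
    by (rule borel_integrable_atLeastAtMost'[OF assms])
  then show "integrable lborel (\<lambda>t. indicator {0..1} t *\<^sub>R f t)"
    "(LINT t|lborel. indicator {0..1} t *\<^sub>R f t) = integral {0..1} f"
    using set_borel_integral_eq_integral(2)[of "{0..1}" f]
    by (simp_all add: set_integrable_def set_lebesgue_integral_def)
qed

text \<open>The extra density \<open>1 / card I\<close> keeps the normalisation away from \<open>0\<close> without requiring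
  the curves to be non-constant.\<close>

lemma cycle_probability:
  fixes x y :: "'i \<Rightarrow> real \<Rightarrow> complex"
  assumes I: "finite I" "I \<noteq> {}"
    and xc: "\<And>i. i \<in> I \<Longrightarrow> continuous_on {0..1} (x i)"
    and yc: "\<And>i. i \<in> I \<Longrightarrow> continuous_on {0..1} (y i)"
    and len: "(\<Sum>i\<in>I. integral {0..1} (\<lambda>t. norm (y i t))) \<le> l"
  obtains P :: "('i \<times> real) measure" and X W where "prob_space P"
    "X \<in> borel_measurable P" "W \<in> borel_measurable P"
    "\<And>\<omega>. \<exists>i\<in>I. \<exists>t\<in>{0..1}. X \<omega> = x i t" "\<And>\<omega>. norm (W \<omega>) \<le> l + 1"
    "\<And>k. continuous_on UNIV k \<Longrightarrow>
      (LINT \<omega>|P. k (X \<omega>) * W \<omega>) = (\<Sum>i\<in>I. integral {0..1} (\<lambda>t. k (x i t) * y i t))"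
proof -
  obtain i0 where i0: "i0 \<in> I" using I(2) by blast
  define J where "J i = (if i \<in> I then i else i0)" for i
  have J: "J i \<in> I" and JI: "i \<in> I \<Longrightarrow> J i = i" for i using i0 by (auto simp: J_def)
  \<comment> \<open>Clamping the parameter, like the default index \<open>i0\<close>, makes the
    curves total continuous functions without changing them where the density lives.\<close>
  define c where "c t = max 0 (min 1 t)" for t :: real
  have c01: "c t \<in> {0..1}" and cid: "t \<in> {0..1} \<Longrightarrow> c t = t" for t by (auto simp: c_def)
  have cc: "continuous_on UNIV c" unfolding c_def[abs_def] by (intro continuous_intros)
  define xx where "xx i t = x (J i) (c t)" for i t
  define yy where "yy i t = y (J i) (c t)" for i t
  have xxc: "continuous_on UNIV (xx i)" and yyc: "continuous_on UNIV (yy i)" for i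
    unfolding xx_def[abs_def] yy_def[abs_def] using c01
    by (auto intro!: continuous_on_compose2[OF xc[OF J] cc] continuous_on_compose2[OF yc[OF J] cc])
  have [measurable]: "xx i \<in> borel_measurable borel" "yy i \<in> borel_measurable borel" for i
    by (intro borel_measurable_continuous_onI xxc yyc)+
  define n where "n = real (card I)"
  have n: "n > 0" using I by (simp add: n_def card_gt_0_iff)
  define L where "L = (\<Sum>i\<in>I. integral {0..1} (\<lambda>t. norm (y i t)))"
  have L: "0 \<le> L" "L \<le> l"
    unfolding L_def using len by (auto intro!: sum_nonneg integral_nonneg integrable_continuous_real
        continuous_on_norm yc)
  \<comment> \<open>Summed over all curves, the numerators integrate over \<open>{0..1}\<close> to
    \<open>L + 1\<close>, because the terms \<open>1 / n\<close> add up to 1.\<close>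
  define \<rho> where "\<rho> i t = (norm (yy i t) + 1 / n) / (L + 1)" for i t
  have \<rho>: "\<rho> i t > 0" for i t
    unfolding \<rho>_def using L n by (intro divide_pos_pos add_nonneg_pos) auto
  have \<rho>c: "continuous_on UNIV (\<rho> i)" for i
    unfolding \<rho>_def[abs_def] using L by (intro continuous_intros yyc) auto
  have [measurable]: "\<rho> i \<in> borel_measurable borel" for i
    by (intro borel_measurable_continuous_onI \<rho>c)
  define M where "M = count_space I \<Otimes>\<^sub>M (lborel :: real measure)"
  have meas: "f \<in> borel_measurable M" if "\<And>i. i \<in> I \<Longrightarrow> (\<lambda>t. f (i, t)) \<in> borel_measurable borel"
    for f :: "'i \<times> real \<Rightarrow> 'c::topological_space"
    unfolding M_def using I(1) that by (intro measurable_pair_measure_countable1)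
      (auto simp: countable_finite measurable_cong_sets[OF sets_lborel refl])
  define d where "d \<omega> = indicator {0..1} (snd \<omega>) * \<rho> (fst \<omega>) (snd \<omega>)" for \<omega>
  have dm [measurable]: "d \<in> borel_measurable M"
    by (rule meas) (simp add: d_def)
  have d0: "0 \<le> d \<omega>" for \<omega>
    using \<rho>[of "fst \<omega>" "snd \<omega>"] by (simp add: d_def)
  define P where "P = density M (\<lambda>\<omega>. ennreal (d \<omega>))"
  define X where "X \<omega> = xx (fst \<omega>) (snd \<omega>)" for \<omega>
  \<comment> \<open>\<open>W\<close> is \<open>yy\<close> divided by the density
    \<open>\<rho>\<close>, so that weight times density gives back \<open>yy\<close>; the quotient
    is bounded by \<open>L + 1\<close>.\<close>
  define W where "W \<omega> = of_real (L + 1) * yy (fst \<omega>) (snd \<omega>) / of_real (norm (yy (fst \<omega>) (snd \<omega>)) + 1 / n)" for \<omega>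
  have Xm [measurable]: "X \<in> borel_measurable M" and Wm [measurable]: "W \<in> borel_measurable M"
    by (rule meas, simp add: X_def W_def)+
  interpret I: finite_measure "count_space I" by (rule finite_measure_count_space[OF I(1)])
  interpret sI: sigma_finite_measure "count_space I" by (rule sigma_finite_measure_count_space_finite[OF I(1)])
  interpret pair_sigma_finite "count_space I" "lborel :: real measure" ..
  have fubini: "integrable M f \<and> (LINT \<omega>|M. f \<omega>) = (\<Sum>i\<in>I. LINT t|lborel. f (i, t))"
    if f: "f \<in> borel_measurable M" "\<And>i. i \<in> I \<Longrightarrow> integrable lborel (\<lambda>t. f (i, t))"
    for f :: "'i \<times> real \<Rightarrow> complex"
  proof -
    have "integrable (count_space I \<Otimes>\<^sub>M lborel) f"
    proof (rule Fubini_integrable)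
      show "f \<in> borel_measurable (count_space I \<Otimes>\<^sub>M lborel)" using f(1) by (simp add: M_def)
      show "integrable (count_space I) (\<lambda>i. LINT t|lborel. norm (f (i, t)))"
        using I(1) by (rule integrable_count_space)
      show "AE i in count_space I. integrable lborel (\<lambda>t. f (i, t))"
        using f(2) by (simp add: AE_count_space)
    qed
    then show ?thesis
      using integral_fst'[of f] I(1) by (simp add: M_def lebesgue_integral_count_space_finite)
  qed
  have yyy: "integral {0..1} (\<lambda>t. norm (yy i t)) = integral {0..1} (\<lambda>t. norm (y i t))" if "i \<in> I" for i
    by (rule integral_cong) (use that in \<open>simp add: yy_def JI cid\<close>)
  have prob: "prob_space P"
  proof
    have "emeasure P (space P) = (\<integral>\<^sup>+\<omega>. ennreal (d \<omega>) \<partial>M)"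
      unfolding P_def by (subst emeasure_density) (auto intro!: nn_integral_cong)
    also have "\<dots> = (\<integral>\<^sup>+i. \<integral>\<^sup>+t. ennreal (d (i, t)) \<partial>lborel \<partial>count_space I)"
      unfolding M_def by (rule lborel.nn_integral_fst[symmetric]) (simp flip: M_def)
    also have "\<dots> = (\<Sum>i\<in>I. \<integral>\<^sup>+t. ennreal (d (i, t)) \<partial>lborel)"
      by (rule nn_integral_count_space_finite[OF I(1)])
    also have "\<dots> = (\<Sum>i\<in>I. ennreal ((integral {0..1} (\<lambda>t. norm (y i t)) + 1 / n) / (L + 1)))"
    proof (rule sum.cong[OF refl])
      fix i assume i: "i \<in> I"
      note s = set_lebesgue_integral_01[OF continuous_on_subset[OF \<rho>c[of i] subset_UNIV]]
      have "(\<integral>\<^sup>+t. ennreal (d (i, t)) \<partial>lborel) = (\<integral>\<^sup>+t. ennreal (indicator {0..1} t *\<^sub>R \<rho> i t) \<partial>lborel)"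
        by (simp add: d_def)
      also have "\<dots> = ennreal (LINT t|lborel. indicator {0..1} t *\<^sub>R \<rho> i t)"
        by (rule nn_integral_eq_integral[OF s(1)]) (simp add: less_imp_le \<rho>)
      also have "\<dots> = ennreal (integral {0..1} (\<rho> i))"
        by (simp only: s(2))
      also have "integral {0..1} (\<rho> i) = (integral {0..1} (\<lambda>t. norm (yy i t)) + 1 / n) / (L + 1)"
      proof -
        have "(\<lambda>t. norm (yy i t)) integrable_on {0..1}"
          by (intro integrable_continuous_real continuous_intros continuous_on_subset[OF yyc]) auto
        then have "integral {0..1} (\<lambda>t. norm (yy i t) + 1 / n) = integral {0..1} (\<lambda>t. norm (yy i t)) + 1 / n"
          by (subst integral_add) auto
        then show ?thesis
          unfolding \<rho>_def[abs_def] by simp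
      qed
      finally show "(\<integral>\<^sup>+t. ennreal (d (i, t)) \<partial>lborel)
          = ennreal ((integral {0..1} (\<lambda>t. norm (y i t)) + 1 / n) / (L + 1))"
        by (simp only: yyy[OF i])
    qed
    also have "\<dots> = ennreal (\<Sum>i\<in>I. (integral {0..1} (\<lambda>t. norm (y i t)) + 1 / n) / (L + 1))"
      using L n by (intro sum_ennreal divide_nonneg_nonneg add_nonneg_nonneg integral_nonneg
          integrable_continuous_real continuous_on_norm yc) auto
    also have "(\<Sum>i\<in>I. (integral {0..1} (\<lambda>t. norm (y i t)) + 1 / n) / (L + 1))
        = (L + real (card I) * (1 / n)) / (L + 1)"
      by (simp add: sum_divide_distrib[symmetric] sum.distrib L_def)
    also have "\<dots> = 1" using L n by (simp add: n_def)
    finally show "emeasure P (space P) = 1" by simp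
  qed
  show thesis
  proof (rule that[OF prob])
    show "X \<in> borel_measurable P" "W \<in> borel_measurable P" by (simp_all add: P_def)
    show "\<exists>i\<in>I. \<exists>t\<in>{0..1}. X \<omega> = x i t" for \<omega>
      unfolding X_def xx_def using J c01 by blast
    show "norm (W \<omega>) \<le> l + 1" for \<omega>
    proof -
      let ?y = "yy (fst \<omega>) (snd \<omega>)"
      have "norm ?y + 1 / n > 0" using n by (intro add_nonneg_pos) auto
      moreover have "norm ?y \<le> norm ?y + 1 / n" using n by simp
      ultimately have "norm ?y / (norm ?y + 1 / n) \<le> 1" by (simp only: divide_le_eq_1_pos)
      moreover have "norm (W \<omega>) = (L + 1) * (norm ?y / (norm ?y + 1 / n))"
        unfolding W_def norm_divide norm_mult norm_of_real
        using \<open>norm ?y + 1 / n > 0\<close> L by simp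
      ultimately have "norm (W \<omega>) \<le> (L + 1) * 1"
        using L by (simp only:) (intro mult_left_mono; simp)
      then show ?thesis using L by simp
    qed
    fix k :: "complex \<Rightarrow> complex" assume k: "continuous_on UNIV k"
    have km [measurable]: "k \<in> borel_measurable borel"
      by (rule borel_measurable_continuous_onI[OF k])
    have ptw: "d \<omega> *\<^sub>R (k (X \<omega>) * W \<omega>)
        = indicator {0..1} (snd \<omega>) *\<^sub>R (k (xx (fst \<omega>) (snd \<omega>)) * yy (fst \<omega>) (snd \<omega>))" for \<omega>
    proof -
      let ?y = "yy (fst \<omega>) (snd \<omega>)"
      define q where "q = norm ?y + 1 / n"
      have q: "q > 0" unfolding q_def using n by (intro add_nonneg_pos) auto
      have "d \<omega> *\<^sub>R (k (X \<omega>) * W \<omega>)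
          = indicator {0..1} (snd \<omega>) *\<^sub>R ((of_real (q / (L + 1)) * (of_real (L + 1) / of_real q)) * (k (X \<omega>) * ?y))"
        unfolding d_def \<rho>_def W_def q_def[symmetric] by (simp add: scaleR_conv_of_real)
      also have "of_real (q / (L + 1)) * (of_real (L + 1) / of_real q) = (1 :: complex)"
      proof -
        have "L + 1 \<noteq> 0" using L by linarith
        then have "(q / (L + 1)) * ((L + 1) / q) = 1" using q by simp
        then show ?thesis by (metis of_real_1 of_real_divide of_real_mult)
      qed
      finally show ?thesis by (simp add: X_def)
    qed
    have "(LINT \<omega>|P. k (X \<omega>) * W \<omega>) = (LINT \<omega>|M. d \<omega> *\<^sub>R (k (X \<omega>) * W \<omega>))"
      unfolding P_def by (rule integral_density) (auto simp: d0)
    also have "\<dots> = (LINT \<omega>|M. indicator {0..1} (snd \<omega>) *\<^sub>R (k (xx (fst \<omega>) (snd \<omega>)) * yy (fst \<omega>) (snd \<omega>)))"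
      by (simp only: ptw)
    also have "\<dots> = (\<Sum>i\<in>I. LINT t|lborel. indicator {0..1} t *\<^sub>R (k (xx i t) * yy i t))"
    proof -
      let ?f = "\<lambda>\<omega>. indicator {0..1} (snd \<omega>) *\<^sub>R (k (xx (fst \<omega>) (snd \<omega>)) * yy (fst \<omega>) (snd \<omega>))"
      have "?f \<in> borel_measurable M" by (rule meas) simp
      moreover have "integrable lborel (\<lambda>t. ?f (i, t))" for i
        using set_lebesgue_integral_01(1)[of "\<lambda>t. k (xx i t) * yy i t"]
        by (simp add: continuous_on_mult continuous_on_compose2[OF k continuous_on_subset[OF xxc]]
            continuous_on_subset[OF yyc])
      ultimately show ?thesis using fubini[of ?f] by simp
    qed
    also have "\<dots> = (\<Sum>i\<in>I. integral {0..1} (\<lambda>t. k (x i t) * y i t))"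
    proof (rule sum.cong[OF refl])
      fix i assume i: "i \<in> I"
      have "(LINT t|lborel. indicator {0..1} t *\<^sub>R (k (xx i t) * yy i t))
          = integral {0..1} (\<lambda>t. k (xx i t) * yy i t)"
        by (rule set_lebesgue_integral_01(2))
           (intro continuous_on_mult continuous_on_compose2[OF k continuous_on_subset[OF xxc]]
            continuous_on_subset[OF yyc]; simp)
      also have "\<dots> = integral {0..1} (\<lambda>t. k (x i t) * y i t)"
        by (rule integral_cong) (use i in \<open>simp add: xx_def yy_def JI cid\<close>)
      finally show "(LINT t|lborel. indicator {0..1} t *\<^sub>R (k (xx i t) * yy i t))
          = integral {0..1} (\<lambda>t. k (x i t) * y i t)" .
    qed
    finally show "(LINT \<omega>|P. k (X \<omega>) * W \<omega>) = (\<Sum>i\<in>I. integral {0..1} (\<lambda>t. k (x i t) * y i t))" .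
  qed
qed

section \<open>Complex measures as images of weighted laws\<close>

text \<open>Weak limits arrive as a law \<open>Q\<close> on the line with a position
  \<open>x\<close> and a weight; the measure on \<open>F\<close> is the image under \<open>x\<close>
  of the weighted law.\<close>

locale weighted_image =
  fixes Q :: "real measure" and x :: "real \<Rightarrow> complex" and F :: "complex set"
  assumes Q: "real_distribution Q" and x [measurable]: "x \<in> borel_measurable borel"
    and F: "compact F" and AE_F: "AE t in Q. x t \<in> F"
begin

sublocale real_distribution Q by (rule Q)

definition pushforward :: "(real \<Rightarrow> real) \<Rightarrow> complex measure" where
  "pushforward p = distr (density Q (\<lambda>t. ennreal (p t))) borel x"

lemma sets_pushforward [simp]: "sets (pushforward p) = sets borel"
  by (simp add: pushforward_def)

lemma pushforward_props:
  assumes p [measurable]: "p \<in> borel_measurable borel" and p0: "\<And>t. 0 \<le> p t" and pB: "\<And>t. p t \<le> B"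
  shows "finite_measure_on_compact (pushforward p) F"
    and "A \<in> sets borel \<Longrightarrow> measure (pushforward p) A = (LINT t|Q. p t * indicator A (x t))"
    and "f \<in> borel_measurable borel \<Longrightarrow>
      (LINT \<xi>|pushforward p. f \<xi> :: complex) = (LINT t|Q. p t *\<^sub>R f (x t))"
proof -
  have em: "emeasure (pushforward p) A = ennreal (LINT t|Q. p t * indicator A (x t))"
    if [measurable]: "A \<in> sets borel" for A
  proof -
    have xA: "x -` A \<inter> space Q \<in> sets Q"
      by (rule measurable_sets[of x Q borel]) simp_all
    have "emeasure (pushforward p) A = emeasure (density Q (\<lambda>t. ennreal (p t))) (x -` A \<inter> space Q)"
      unfolding pushforward_def by (subst emeasure_distr) auto
    also have "\<dots> = (\<integral>\<^sup>+t. ennreal (p t) * indicator (x -` A \<inter> space Q) t \<partial>Q)"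
      by (rule emeasure_density[OF _ xA]) simp
    also have "\<dots> = (\<integral>\<^sup>+t. ennreal (p t * indicator A (x t)) \<partial>Q)"
      by (intro nn_integral_cong) (auto simp: indicator_def)
    also have "\<dots> = ennreal (LINT t|Q. p t * indicator A (x t))"
    proof (rule nn_integral_eq_integral)
      have "norm (p t * indicator A (x t)) \<le> \<bar>B\<bar>" for t
        using p0[of t] pB[of t] by (auto simp: indicator_def)
      then show "integrable Q (\<lambda>t. p t * indicator A (x t))"
        by (intro integrable_const_bound[of _ "\<bar>B\<bar>"]) simp_all
    qed (simp add: p0)
    finally show ?thesis .
  qed
  have "finite_measure (pushforward p)"
  proof
    show "emeasure (pushforward p) (space (pushforward p)) \<noteq> \<infinity>"
      using em[of UNIV] by (simp add: pushforward_def)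
  qed
  moreover have "AE \<xi> in pushforward p. \<xi> \<in> F"
  proof -
    have "F \<in> sets borel" using F by (simp add: compact_imp_closed borel_closed)
    then have "{\<xi> \<in> space borel. \<xi> \<in> F} \<in> sets borel" by simp
    moreover have "AE t in density Q (\<lambda>t. ennreal (p t)). x t \<in> F"
      using AE_F by (subst AE_density) auto
    ultimately show ?thesis
      unfolding pushforward_def by (subst AE_distr_iff) auto
  qed
  ultimately show "finite_measure_on_compact (pushforward p) F"
    by (intro finite_measure_on_compact.intro) (auto simp: F)
  show "measure (pushforward p) A = (LINT t|Q. p t * indicator A (x t))" if "A \<in> sets borel"
    using em[OF that] by (simp add: measure_def integral_nonneg_AE p0)
  show "(LINT \<xi>|pushforward p. f \<xi> :: complex) = (LINT t|Q. p t *\<^sub>R f (x t))"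
    if [measurable]: "f \<in> borel_measurable borel"
    unfolding pushforward_def by (subst integral_distr) (auto intro!: integral_density simp: p0)
qed

text \<open>Positive and negative part of \<open>u\<close> are pushed forward separately. As
  \<open>x\<close> need not be injective, the images may overlap and differ from the Jordan
  decomposition of \<open>\<sigma>\<close>; the integral is then identified by
  \<open>signed_integral_eq_diff\<close>.\<close>

lemma signed_measure_image:
  assumes u [measurable]: "u \<in> borel_measurable borel" and uB: "\<And>t. \<bar>u t\<bar> \<le> B"
    and \<sigma>: "\<And>A. A \<in> sets borel \<Longrightarrow> \<sigma> A = (LINT t|Q. u t * indicator A (x t))"
  shows "signed_borel_measure \<sigma>"
    and "A \<in> sets borel \<Longrightarrow> A \<inter> F = {} \<Longrightarrow> \<sigma> A = 0"
    and "z \<notin> F \<Longrightarrow> integrable Q (\<lambda>t. u t *\<^sub>R (1 / (x t - z))) \<and>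
      signed_integral \<sigma> (\<lambda>\<xi>. 1 / (\<xi> - z)) = (LINT t|Q. u t *\<^sub>R (1 / (x t - z)))"
proof -
  define p where "p t = max 0 (u t)" for t
  define n where "n t = max 0 (- u t)" for t
  have [measurable]: "p \<in> borel_measurable borel" "n \<in> borel_measurable borel"
    by (simp_all add: p_def[abs_def] n_def[abs_def])
  have pn: "0 \<le> p t" "p t \<le> B" "0 \<le> n t" "n t \<le> B" "u t = p t - n t" for t
    using uB[of t] by (auto simp: p_def n_def)
  note P = pushforward_props[of p B, OF _ pn(1,2)] and N = pushforward_props[of n B, OF _ pn(3,4)]
  interpret P: finite_measure_on_compact "pushforward p" F by (rule P(1)) simp
  interpret N: finite_measure_on_compact "pushforward n" F by (rule N(1)) simp
  interpret fP: finite_measure "pushforward p" by (rule P.finP)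
  interpret fN: finite_measure "pushforward n" by (rule N.finP)
  have diff: "\<sigma> A = measure (pushforward p) A - measure (pushforward n) A" if A [measurable]: "A \<in> sets borel" for A
  proof -
    have "integrable Q (\<lambda>t. q t * indicator A (x t))" if "q = p \<or> q = n" for q
      by (rule integrable_const_bound[of _ B])
         (use that pn in \<open>auto simp: indicator_def intro: order_trans\<close>)
    then have "(LINT t|Q. p t * indicator A (x t)) - (LINT t|Q. n t * indicator A (x t))
        = (LINT t|Q. p t * indicator A (x t) - n t * indicator A (x t))"
      by (intro Bochner_Integration.integral_diff[symmetric]) auto
    then show ?thesis
      using P(2)[of A] N(2)[of A] A \<sigma>[OF A] by (simp add: pn(5) left_diff_distrib)
  qed
  show sgn: "signed_borel_measure \<sigma>"
    unfolding signed_borel_measure_def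
  proof (intro allI impI)
    fix A :: "nat \<Rightarrow> complex set" assume A: "range A \<subseteq> sets borel" "disjoint_family A"
    have "(\<lambda>n'. measure (pushforward p) (A n') - measure (pushforward n) (A n'))
        sums (measure (pushforward p) (\<Union>n. A n) - measure (pushforward n) (\<Union>n. A n))"
      by (intro sums_diff fP.finite_measure_UNION fN.finite_measure_UNION) (use A in auto)
    moreover have "A m \<in> sets borel" for m using A(1) by blast
    ultimately show "(\<lambda>n. \<sigma> (A n)) sums \<sigma> (\<Union>n. A n)"
      by (simp add: diff sets.countable_UN)
  qed
  have null: "\<sigma> A = 0" if "A \<in> sets borel" "A \<inter> F = {}" for A
  proof -
    have "AE t in Q. u t * indicator A (x t) = 0"
      using AE_F by eventually_elim (use that(2) in \<open>auto simp: indicator_def\<close>)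
    then show ?thesis
      unfolding \<sigma>[OF that(1)] by (rule integral_eq_zero_AE)
  qed
  show "A \<in> sets borel \<Longrightarrow> A \<inter> F = {} \<Longrightarrow> \<sigma> A = 0" by (rule null)
  show "integrable Q (\<lambda>t. u t *\<^sub>R (1 / (x t - z))) \<and>
      signed_integral \<sigma> (\<lambda>\<xi>. 1 / (\<xi> - z)) = (LINT t|Q. u t *\<^sub>R (1 / (x t - z)))" if z: "z \<notin> F"
  proof
    let ?f = "\<lambda>\<xi>. 1 / (\<xi> - z)"
    obtain r where r: "r > 0" "\<And>\<xi>. \<xi> \<in> F \<Longrightarrow> 2 * r \<le> norm (\<xi> - z)"
      using P.separated[OF z] by blast
    have bd: "AE t in Q. norm (1 / (x t - z)) \<le> 1 / (2 * r)"
      using AE_F by eventually_elim (use r in \<open>auto simp: norm_divide intro!: frac_le\<close>)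
    have int: "integrable Q (\<lambda>t. q t *\<^sub>R ?f (x t))"
      if [measurable]: "q \<in> borel_measurable borel" and q: "\<And>t. \<bar>q t\<bar> \<le> B" for q
    proof (rule integrable_const_bound)
      have "norm (q t *\<^sub>R ?f (x t)) \<le> B * (1 / (2 * r))" if "norm (1 / (x t - z)) \<le> 1 / (2 * r)" for t
        unfolding norm_scaleR
        by (rule mult_mono[OF q that]) (use order_trans[OF abs_ge_zero q] in auto)
      with bd show "AE t in Q. norm (q t *\<^sub>R ?f (x t)) \<le> B * (1 / (2 * r))"
        by (rule eventually_mono)
    qed simp
    show "integrable Q (\<lambda>t. u t *\<^sub>R ?f (x t))" by (rule int[OF u uB])
    interpret PP: finite_measure_on_compact "positive_variation \<sigma>" F
      by (rule finite_measure_on_compact_positive_variation[OF sgn F null])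
    interpret NN: finite_measure_on_compact "positive_variation (\<lambda>A. - \<sigma> A)" F
      by (rule finite_measure_on_compact_positive_variation[OF signed_borel_measure_uminus[OF sgn] F])
         (simp add: null)
    have "signed_integral \<sigma> ?f = (LINT \<xi>|pushforward p. ?f \<xi>) - (LINT \<xi>|pushforward n. ?f \<xi>)"
      by (rule signed_integral_eq_diff[OF sgn sets_pushforward sets_pushforward P.finP N.finP diff
          P.integrable_kernel[OF z] N.integrable_kernel[OF z]
          PP.integrable_kernel[OF z] NN.integrable_kernel[OF z]])
    also have "\<dots> = (LINT t|Q. p t *\<^sub>R ?f (x t)) - (LINT t|Q. n t *\<^sub>R ?f (x t))"
      using P(3)[of ?f] N(3)[of ?f] by simp
    also have "\<dots> = (LINT t|Q. p t *\<^sub>R ?f (x t) - n t *\<^sub>R ?f (x t))"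
      by (intro Bochner_Integration.integral_diff[symmetric] int) (use pn in \<open>auto simp: abs_of_nonneg\<close>)
    also have "\<dots> = (LINT t|Q. u t *\<^sub>R ?f (x t))"
      by (simp only: pn(5) scaleR_left_diff_distrib)
    finally show "signed_integral \<sigma> ?f = (LINT t|Q. u t *\<^sub>R ?f (x t))" .
  qed
qed

lemma complex_measure_image:
  assumes w [measurable]: "w \<in> borel_measurable borel" and wB: "\<And>t. norm (w t) \<le> B"
  defines "\<nu> \<equiv> \<lambda>A. LINT t|Q. w t * indicator A (x t)"
  shows "complex_borel_measure \<nu>" "supported_on \<nu> F" "\<nu> F = (LINT t|Q. w t)"
    and "z \<notin> F \<Longrightarrow> cauchy_transform \<nu> (Some z) = (LINT t|Q. 1 / (x t - z) * w t)"
proof -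
  have int: "integrable Q (\<lambda>t. w t * indicator A (x t))" if [measurable]: "A \<in> sets borel" for A
  proof (rule integrable_const_bound)
    show "AE t in Q. norm (w t * indicator A (x t)) \<le> B"
      using wB by (auto simp: indicator_def norm_mult intro: order_trans[OF norm_ge_zero])
  qed simp
  have Re: "Re (\<nu> A) = (LINT t|Q. Re (w t) * indicator A (x t))"
   and Im: "Im (\<nu> A) = (LINT t|Q. Im (w t) * indicator A (x t))" if A: "A \<in> sets borel" for A
  proof -
    have "Re (w t * indicator A (x t)) = Re (w t) * indicator A (x t)"
      "Im (w t * indicator A (x t)) = Im (w t) * indicator A (x t)" for t
      by (auto simp: indicator_def)
    then show "Re (\<nu> A) = (LINT t|Q. Re (w t) * indicator A (x t))"
      "Im (\<nu> A) = (LINT t|Q. Im (w t) * indicator A (x t))"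
      unfolding \<nu>_def using integral_Re[OF int[OF A]] integral_Im[OF int[OF A]] by simp_all
  qed
  have ReB: "\<bar>Re (w t)\<bar> \<le> B" and ImB: "\<bar>Im (w t)\<bar> \<le> B" for t
    using abs_Re_le_cmod[of "w t"] abs_Im_le_cmod[of "w t"] wB[of t] by linarith+
  have [measurable]: "(\<lambda>t. Re (w t)) \<in> borel_measurable borel" "(\<lambda>t. Im (w t)) \<in> borel_measurable borel"
    by simp_all
  note R = signed_measure_image[of "\<lambda>t. Re (w t)" B "\<lambda>A. Re (\<nu> A)", OF _ ReB Re, simplified]
  note I = signed_measure_image[of "\<lambda>t. Im (w t)" B "\<lambda>A. Im (\<nu> A)", OF _ ImB Im, simplified]
  show "complex_borel_measure \<nu>"
    unfolding complex_borel_measure_def sums_complex_iff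
    using R(1) I(1) unfolding signed_borel_measure_def by blast
  show "supported_on \<nu> F"
    unfolding supported_on_def complex_eq_iff using R(2) I(2) by simp
  have "AE t in Q. w t * indicator F (x t) = w t"
    using AE_F by eventually_elim simp
  moreover have [measurable]: "F \<in> sets borel" using F by (simp add: compact_imp_closed borel_closed)
  ultimately show "\<nu> F = (LINT t|Q. w t)"
    unfolding \<nu>_def by (intro integral_cong_AE) auto
  show "cauchy_transform \<nu> (Some z) = (LINT t|Q. 1 / (x t - z) * w t)" if z: "z \<notin> F"
  proof -
    let ?f = "\<lambda>t. 1 / (x t - z)"
    have R3: "integrable Q (\<lambda>t. Re (w t) *\<^sub>R ?f t)"
        "signed_integral (\<lambda>A. Re (\<nu> A)) (\<lambda>\<xi>. 1 / (\<xi> - z)) = (LINT t|Q. Re (w t) *\<^sub>R ?f t)"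
      using signed_measure_image(3)[of "\<lambda>t. Re (w t)" B "\<lambda>A. Re (\<nu> A)", OF _ ReB Re z] by auto
    have I3: "integrable Q (\<lambda>t. Im (w t) *\<^sub>R ?f t)"
        "signed_integral (\<lambda>A. Im (\<nu> A)) (\<lambda>\<xi>. 1 / (\<xi> - z)) = (LINT t|Q. Im (w t) *\<^sub>R ?f t)"
      using signed_measure_image(3)[of "\<lambda>t. Im (w t)" B "\<lambda>A. Im (\<nu> A)", OF _ ImB Im z] by auto
    have "cauchy_transform \<nu> (Some z)
        = (LINT t|Q. Re (w t) *\<^sub>R ?f t) + \<i> * (LINT t|Q. Im (w t) *\<^sub>R ?f t)"
      by (simp only: cauchy_transform_def complex_measure_integral_def option.case R3(2) I3(2))
    also have "\<dots> = (LINT t|Q. Re (w t) *\<^sub>R ?f t + \<i> * (Im (w t) *\<^sub>R ?f t))"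
      unfolding integral_mult_right_zero[symmetric]
      by (rule Bochner_Integration.integral_add[symmetric, OF R3(1) integrable_mult_right[OF I3(1)]])
    also have "\<dots> = (LINT t|Q. ?f t * w t)"
    proof (rule Bochner_Integration.integral_cong[OF refl])
      fix t
      have "w t = of_real (Re (w t)) + \<i> * of_real (Im (w t))" by (rule complex_eq)
      then have "?f t * w t = ?f t * (of_real (Re (w t)) + \<i> * of_real (Im (w t)))" by simp
      then show "Re (w t) *\<^sub>R ?f t + \<i> * (Im (w t) *\<^sub>R ?f t) = ?f t * w t"
        by (simp add: scaleR_conv_of_real algebra_simps)
    qed
    finally show ?thesis .
  qed
qed

end

lemma analytic_jordan_curve_smooth:
  assumes "analytic_jordan_curve \<gamma>"
  shows "valid_path \<gamma>" "pathfinish \<gamma> = pathstart \<gamma>"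
    "continuous_on {0..1} (\<lambda>t. vector_derivative \<gamma> (at t))"
proof -
  obtain \<phi> A where A: "open A" "sphere 0 1 \<subseteq> A" "\<phi> holomorphic_on A" "\<gamma> = \<phi> \<circ> circlepath 0 1"
    using assms by (auto simp: analytic_jordan_curve_def)
  have pi: "path_image (circlepath 0 1) \<subseteq> A" using A(2) by simp
  show "valid_path \<gamma>"
    unfolding A(4) by (rule valid_path_compose_holomorphic[OF valid_path_circlepath A(3,1) pi])
  show "pathfinish \<gamma> = pathstart \<gamma>"
    unfolding A(4) pathfinish_compose pathstart_compose by simp
  have c: "circlepath 0 1 = (\<lambda>t. exp (2 * of_real pi * \<i> * of_real t))"
    by (auto simp: circlepath)
  have cA: "exp (2 * of_real pi * \<i> * of_real t) \<in> A" for t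
    using A(2) by (auto simp: subset_iff norm_exp_eq_Re)
  have "(\<gamma> has_vector_derivative (2 * of_real pi * \<i> * exp (2 * of_real pi * \<i> * of_real t))
      * deriv \<phi> (exp (2 * of_real pi * \<i> * of_real t))) (at t)" for t
    unfolding A(4) c
  proof (rule field_vector_diff_chain_at)
    show "((\<lambda>t. exp (2 * of_real pi * \<i> * of_real t)) has_vector_derivative
        2 * of_real pi * \<i> * exp (2 * of_real pi * \<i> * of_real t)) (at t)"
      by (rule has_vector_derivative_real_field) (auto intro!: derivative_eq_intros)
    show "(\<phi> has_field_derivative deriv \<phi> (exp (2 * of_real pi * \<i> * of_real t)))
        (at (exp (2 * of_real pi * \<i> * of_real t)))"
      by (rule holomorphic_derivI[OF A(3,1) cA])
  qed
  then have eq: "(\<lambda>t. vector_derivative \<gamma> (at t)) = (\<lambda>t. (2 * of_real pi * \<i> * exp (2 * of_real pi * \<i> * of_real t))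
      * deriv \<phi> (exp (2 * of_real pi * \<i> * of_real t)))"
    by (intro ext vector_derivative_at)
  have "continuous_on {0..1} (\<lambda>t. deriv \<phi> (exp (2 * of_real pi * \<i> * of_real t)))"
    by (rule continuous_on_compose2[OF holomorphic_on_imp_continuous_on[OF holomorphic_deriv[OF A(3,1)]]])
       (use cA in \<open>auto intro!: continuous_intros\<close>)
  then show "continuous_on {0..1} (\<lambda>t. vector_derivative \<gamma> (at t))"
    unfolding eq by (intro continuous_intros)
qed

section \<open>Representation of bounded functions by Cauchy transforms\<close>

text \<open>The Cauchy kernel made continuous on the whole plane, since weak convergence is tested
  on continuous functions. Writing the kernel as conjugate over squared modulus allows the pole to
  be removed by \<open>max\<close>, and nothing changes at distance at least \<open>d\<close> from
  \<open>z\<close>.\<close>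

definition reciprocal_cutoff :: "complex \<Rightarrow> real \<Rightarrow> complex \<Rightarrow> complex" where
  "reciprocal_cutoff z d \<xi> = cnj (\<xi> - z) / of_real ((max (norm (\<xi> - z)) d)\<^sup>2)"

lemma reciprocal_cutoff_continuous: "d > 0 \<Longrightarrow> continuous_on UNIV (reciprocal_cutoff z d)"
  unfolding reciprocal_cutoff_def[abs_def] by (intro continuous_intros) auto

lemma reciprocal_cutoff_eq:
  assumes "d \<le> norm (\<xi> - z)"
  shows "reciprocal_cutoff z d \<xi> = 1 / (\<xi> - z)"
proof -
  have "1 / (\<xi> - z) = 1 * cnj (\<xi> - z) / of_real ((norm (\<xi> - z))\<^sup>2)"
    by (rule complex_div_cnj)
  then show ?thesis
    using assms by (simp add: reciprocal_cutoff_def max_absorb1)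
qed

lemma tendsto_inverse_diff_at_infinity: "((\<lambda>\<xi>. inverse (\<xi> - z :: complex)) \<longlongrightarrow> 0) at_infinity"
proof (rule filterlim_compose[OF tendsto_inverse_0])
  have "filterlim (\<lambda>\<xi>. - z + \<xi>) at_infinity at_infinity"
    by (rule tendsto_add_filterlim_at_infinity[OF tendsto_const filterlim_ident])
  then show "filterlim (\<lambda>\<xi>. \<xi> - z) at_infinity at_infinity" by simp
qed

text \<open>The densities of \<open>- f dz / (2 \<pi> i)\<close> on cycles shrinking to
  \<open>F\<close> have total mass at most \<open>l\<close>, so a subsequence converges weakly. No
  estimate of the limits is required: by Cauchy's theorem the integrals against the kernel are
  eventually equal to the desired value.\<close>

lemma Cauchy_measure_of_bounded_function:
  assumes F: "finite_painleve_length F" and "F \<noteq> {}"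
    and f: "f holomorphic_on outside F" "\<And>z. z \<in> outside F \<Longrightarrow> norm (f z) \<le> 1"
    and lim: "((\<lambda>z. z * f z) \<longlongrightarrow> a) at_infinity"
  obtains \<nu> where "complex_borel_measure \<nu>" "supported_on \<nu> F" "\<nu> F = - a"
    "\<And>z. z \<in> outside F \<Longrightarrow> cauchy_transform \<nu> (Some z) = f z"
    "\<And>z. z \<in> inside F \<Longrightarrow> cauchy_transform \<nu> (Some z) = 0"
proof -
  obtain l where cF: "compact F" and l: "\<And>U. open U \<Longrightarrow> F \<subseteq> U \<Longrightarrow>
        \<exists>\<Gamma>. jordan_cycle \<Gamma> \<and> (\<forall>\<gamma>\<in>\<Gamma>. path_image \<gamma> \<subseteq> U) \<and> surrounds \<Gamma> F \<and>
             (\<Sum>\<gamma>\<in>\<Gamma>. curve_length \<gamma>) < l"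
    using F unfolding finite_painleve_length_def by blast
  have clF: "closed F" using cF by (rule compact_imp_closed)
  have op: "open (outside F)" using clF by (rule open_outside)
  define nbhd where "nbhd n = {z. infdist z F < 1 / real (Suc n)}" for n
  have "open (nbhd n)" "F \<subseteq> nbhd n" for n
    unfolding nbhd_def by (intro open_Collect_less continuous_intros) auto
  then have "\<forall>n. \<exists>\<Gamma>. jordan_cycle \<Gamma> \<and> (\<forall>\<gamma>\<in>\<Gamma>. path_image \<gamma> \<subseteq> nbhd n) \<and> surrounds \<Gamma> F \<and>
             (\<Sum>\<gamma>\<in>\<Gamma>. curve_length \<gamma>) < l"
    using l by blast
  then obtain \<Gamma> where \<Gamma>: "\<And>n. jordan_cycle (\<Gamma> n)" "\<And>n \<gamma>. \<gamma> \<in> \<Gamma> n \<Longrightarrow> path_image \<gamma> \<subseteq> nbhd n"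
      "\<And>n. surrounds (\<Gamma> n) F" "\<And>n. (\<Sum>\<gamma>\<in>\<Gamma> n. curve_length \<gamma>) < l"
    by metis
  have fin\<Gamma>: "finite (\<Gamma> n)" and aj: "\<gamma> \<in> \<Gamma> n \<Longrightarrow> analytic_jordan_curve \<gamma>" for n \<gamma>
    using \<Gamma>(1)[of n] by (auto simp: jordan_cycle_def)
  note smooth = analytic_jordan_curve_smooth[OF aj]
  \<comment> \<open>Curves in bounded components of the complement lie where nothing is known about
    \<open>f\<close> and are dropped; the remaining ones still have total winding number 1 about
    every point off \<open>outside F\<close>.\<close>
  define I where "I n = {\<gamma> \<in> \<Gamma> n. path_image \<gamma> \<subseteq> outside F}" for n
  have I: "finite (I n)" "I n \<subseteq> \<Gamma> n" for n using fin\<Gamma> by (auto simp: I_def)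
  have IV: "valid_path \<gamma> \<and> pathfinish \<gamma> = pathstart \<gamma> \<and> path_image \<gamma> \<subseteq> outside F" if "\<gamma> \<in> I n" for n \<gamma>
    using smooth[of \<gamma> n] that by (auto simp: I_def)
  have Iout: "\<gamma> t \<in> outside F" and Inb: "\<gamma> t \<in> nbhd n"
    if "\<gamma> \<in> I n" "t \<in> {0..1}" for n \<gamma> t
    using that \<Gamma>(2)[of \<gamma> n] by (auto simp: I_def path_image_def)
  have wn1: "(\<Sum>\<gamma>\<in>I n. winding_number \<gamma> z) = 1" if "z \<notin> outside F" for n z
    unfolding I_def
  proof (rule winding_number_outer_curves[OF cF fin\<Gamma> _ _ that])
    show "path \<gamma> \<and> pathfinish \<gamma> = pathstart \<gamma> \<and> path_image \<gamma> \<inter> F = {}" if "\<gamma> \<in> \<Gamma> n" for \<gamma>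
      using smooth[OF that] \<Gamma>(3)[of n] that by (auto simp: surrounds_def valid_path_imp_path)
    show "(\<Sum>\<gamma>\<in>\<Gamma> n. winding_number \<gamma> z) = 1" if "z \<in> F" for z
      using \<Gamma>(3)[of n] that by (auto simp: surrounds_def)
  qed
  obtain z0 where z0: "z0 \<in> F" using \<open>F \<noteq> {}\<close> by blast
  have "z0 \<notin> outside F" using z0 outside_no_overlap[of F] by blast
  then have Ine: "I n \<noteq> {}" for n using wn1[of z0 n] by auto
  \<comment> \<open>The minus sign belongs to the exterior: a cycle that winds once around
    \<open>F\<close> is negatively oriented as seen from the unbounded component.\<close>
  define y where "y \<gamma> t = - (1 / (2 * of_real pi * \<i>)) * (f (\<gamma> t) * vector_derivative \<gamma> (at t))" for \<gamma> t
  have \<gamma>c: "continuous_on {0..1} \<gamma>" if "\<gamma> \<in> I n" for n \<gamma>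
    using IV[OF that] valid_path_imp_path unfolding path_def by blast
  have yc: "continuous_on {0..1} (y \<gamma>)" if "\<gamma> \<in> I n" for n \<gamma>
  proof -
    have "continuous_on {0..1} (\<lambda>t. f (\<gamma> t))"
      by (rule continuous_on_compose2[OF holomorphic_on_imp_continuous_on[OF f(1)] \<gamma>c[OF that]])
         (use Iout[OF that] in auto)
    moreover have "continuous_on {0..1} (\<lambda>t. vector_derivative \<gamma> (at t))"
      using smooth(3)[of \<gamma> n] that I(2) by blast
    ultimately show ?thesis
      unfolding y_def[abs_def] by (intro continuous_intros)
  qed
  have len: "(\<Sum>\<gamma>\<in>I n. integral {0..1} (\<lambda>t. norm (y \<gamma> t))) \<le> l" for n
  proof -
    have "(\<Sum>\<gamma>\<in>I n. integral {0..1} (\<lambda>t. norm (y \<gamma> t))) \<le> (\<Sum>\<gamma>\<in>I n. curve_length \<gamma>)"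
    proof (rule sum_mono)
      fix \<gamma> assume \<gamma>: "\<gamma> \<in> I n"
      have vdc: "continuous_on {0..1} (\<lambda>t. vector_derivative \<gamma> (at t))"
        using smooth(3)[of \<gamma> n] \<gamma> I(2) by blast
      show "integral {0..1} (\<lambda>t. norm (y \<gamma> t)) \<le> curve_length \<gamma>"
        unfolding curve_length_def
      proof (rule integral_le)
        fix t :: real assume t: "t \<in> {0..1}"
        have "norm (y \<gamma> t) = 1 / (2 * pi) * (norm (f (\<gamma> t)) * norm (vector_derivative \<gamma> (at t)))"
          unfolding y_def by (simp add: norm_mult norm_divide)
        also have "\<dots> \<le> 1 * (1 * norm (vector_derivative \<gamma> (at t)))"
          using f(2)[OF Iout[OF \<gamma> t]] pi_gt3 by (intro mult_mono) (auto simp: field_simps)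
        finally show "norm (y \<gamma> t) \<le> norm (vector_derivative \<gamma> (at t))" by simp
      qed (intro integrable_continuous_real continuous_on_norm yc[OF \<gamma>] vdc)+
    qed
    also have "\<dots> \<le> (\<Sum>\<gamma>\<in>\<Gamma> n. curve_length \<gamma>)"
      using fin\<Gamma> I(2) smooth(3)[of _ n]
      by (intro sum_mono2) (auto simp: curve_length_def intro!: integral_nonneg
          integrable_continuous_real continuous_on_norm)
    finally show ?thesis using \<Gamma>(4)[of n] by linarith
  qed
  define S where "S n k = (\<Sum>\<gamma>\<in>I n. integral {0..1} (\<lambda>t. k (\<gamma> t) * y \<gamma> t))" for n k
  have S_eq: "S n k = - (1 / (2 * of_real pi * \<i>)) * (\<Sum>\<gamma>\<in>I n. contour_integral \<gamma> g)"
    if "\<And>\<gamma> t. \<gamma> \<in> I n \<Longrightarrow> t \<in> {0..1} \<Longrightarrow> k (\<gamma> t) * f (\<gamma> t) = g (\<gamma> t)" for n k g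
    unfolding S_def sum_distrib_left
  proof (rule sum.cong[OF refl])
    fix \<gamma> assume \<gamma>: "\<gamma> \<in> I n"
    have "integral {0..1} (\<lambda>t. k (\<gamma> t) * y \<gamma> t)
        = integral {0..1} (\<lambda>t. - (1 / (2 * of_real pi * \<i>)) * (g (\<gamma> t) * vector_derivative \<gamma> (at t)))"
    proof (rule integral_cong)
      fix t :: real assume "t \<in> {0..1}"
      from that[OF \<gamma> this] show "k (\<gamma> t) * y \<gamma> t
          = - (1 / (2 * of_real pi * \<i>)) * (g (\<gamma> t) * vector_derivative \<gamma> (at t))"
        by (simp add: y_def algebra_simps flip: that[OF \<gamma>])
    qed
    then show "integral {0..1} (\<lambda>t. k (\<gamma> t) * y \<gamma> t) = - (1 / (2 * of_real pi * \<i>)) * contour_integral \<gamma> g"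
      unfolding contour_integral_integral by (simp only: integral_mult_right)
  qed
  define good where "good n P X W \<longleftrightarrow> prob_space (P :: ((real \<Rightarrow> complex) \<times> real) measure) \<and>
      X \<in> borel_measurable P \<and> W \<in> borel_measurable P \<and>
      (\<forall>\<omega>. \<exists>\<gamma>\<in>I n. \<exists>t\<in>{0..1}. X \<omega> = \<gamma> t) \<and> (\<forall>\<omega>. norm (W \<omega>) \<le> l + 1) \<and>
      (\<forall>k. continuous_on UNIV k \<longrightarrow> (LINT \<omega>|P. k (X \<omega>) * W \<omega>) = S n k)" for n P X W
  have "\<exists>P X W. good n P X W" for n
    unfolding good_def S_def
    by (rule cycle_probability[of "I n" "\<lambda>\<gamma>. \<gamma>" y l, OF I(1) Ine \<gamma>c yc len]) blast+
  then obtain P X W where good: "\<And>n. good n (P n) (X n) (W n)"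
    by metis
  have P: "prob_space (P n)" and Xm: "X n \<in> borel_measurable (P n)"
    and Wm: "W n \<in> borel_measurable (P n)"
    and Xin: "\<exists>\<gamma>\<in>I n. \<exists>t\<in>{0..1}. X n \<omega> = \<gamma> t" and WB: "norm (W n \<omega>) \<le> l + 1"
    and PS: "continuous_on UNIV k \<Longrightarrow> (LINT \<omega>|P n. k (X n \<omega>) * W n \<omega>) = S n k" for n \<omega> k
    using good[of n] unfolding good_def by blast+
  obtain B where B: "B > 0" "\<And>\<xi>. \<xi> \<in> F \<Longrightarrow> norm \<xi> \<le> B"
    using compact_imp_bounded[OF cF] bounded_pos by metis
  have nbB: "norm \<xi> < B + 1" if "\<xi> \<in> nbhd n" for \<xi> n
  proof -
    obtain \<eta> where \<eta>: "\<eta> \<in> F" "infdist \<xi> F = dist \<xi> \<eta>"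
      using infdist_attains_inf[OF clF \<open>F \<noteq> {}\<close>] by metis
    have "1 / real (Suc n) \<le> 1" by simp
    then have "dist \<xi> \<eta> < 1" using that \<eta>(2) unfolding nbhd_def mem_Collect_eq by linarith
    then show ?thesis
      using B(2)[OF \<eta>(1)] norm_triangle_ineq2[of \<xi> \<eta>] by (simp add: dist_norm)
  qed
  have Xnb: "X n \<omega> \<in> nbhd n" for n \<omega> using Xin Inb by metis
  define R where "R = max (B + 1) (l + 1)"
  obtain r Q x w where r: "strict_mono (r :: nat \<Rightarrow> nat)" and Q: "real_distribution Q"
    and xw: "continuous_on UNIV x" "continuous_on UNIV w" "bounded (range w)"
    and conv: "\<And>h :: complex \<Rightarrow> complex \<Rightarrow> complex. continuous_on UNIV (\<lambda>(a, b). h a b) \<Longrightarrow>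
       (\<lambda>n. LINT \<omega>|P (r n). h (X (r n) \<omega>) (W (r n) \<omega>)) \<longlonglongrightarrow> (LINT t|Q. h (x t) (w t))"
  proof (rule weak_compactness[where P = P and X = X and W = W and R = R, OF P Xm Wm])
    show "norm (X n \<omega>) \<le> R" for n \<omega>
      using nbB[OF Xnb[of n \<omega>]] by (simp add: R_def)
    show "norm (W n \<omega>) \<le> R" for n \<omega>
      using WB[of n \<omega>] by (simp add: R_def)
  qed blast
  interpret real_distribution Q by (rule Q)
  have AE: "AE t in Q. x t \<in> F"
  proof -
    \<comment> \<open>The positions come arbitrarily close to \<open>F\<close>, so the integrals of
      this bounded continuous function tend to 0; its vanishing in the limit puts the limit law on
      \<open>F\<close>.\<close>
    define h where "h \<xi> = complex_of_real (min 1 (infdist \<xi> F))" for \<xi>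
    have hc: "continuous_on UNIV (\<lambda>(a, b::complex). h a)"
      unfolding h_def split_def by (intro continuous_intros)
    have hb: "h \<in> borel_measurable borel"
      unfolding h_def[abs_def] by (intro borel_measurable_continuous_onI continuous_intros)
    have "(\<lambda>n. LINT \<omega>|P (r n). h (X (r n) \<omega>)) \<longlonglongrightarrow> 0"
    proof (rule Lim_null_comparison)
      show "\<forall>\<^sub>F n in sequentially. norm (LINT \<omega>|P (r n). h (X (r n) \<omega>)) \<le> 1 / real (Suc n)"
      proof (intro always_eventually allI)
        fix n
        interpret Pn: prob_space "P (r n)" by (rule P)
        have le: "norm (h (X (r n) \<omega>)) \<le> 1 / real (Suc n)" for \<omega>
        proof -
          have "infdist (X (r n) \<omega>) F < 1 / real (Suc (r n))"
            using Xnb[of "r n" \<omega>] by (simp add: nbhd_def)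
          also have "\<dots> \<le> 1 / real (Suc n)"
            using strict_mono_imp_increasing[OF r, of n] by (intro divide_left_mono) auto
          finally have "infdist (X (r n) \<omega>) F \<le> 1 / real (Suc n)" by simp
          then show ?thesis
            using infdist_nonneg[of "X (r n) \<omega>" F] by (simp add: h_def)
        qed
        have hm: "(\<lambda>\<omega>. h (X (r n) \<omega>)) \<in> borel_measurable (P (r n))"
          by (rule measurable_compose[OF Xm hb])
        have "norm (LINT \<omega>|P (r n). h (X (r n) \<omega>)) \<le> (LINT \<omega>|P (r n). norm (h (X (r n) \<omega>)))"
          by (rule integral_norm_bound)
        also have "\<dots> \<le> (LINT \<omega>|P (r n). 1 / real (Suc n))"
          by (intro integral_mono Bochner_Integration.integrable_norm
              Pn.integrable_const_bound[of _ "1 / real (Suc n)"]) (use le hm in auto)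
        finally show "norm (LINT \<omega>|P (r n). h (X (r n) \<omega>)) \<le> 1 / real (Suc n)"
          by (simp add: Pn.prob_space)
      qed
      show "(\<lambda>n. 1 / real (Suc n)) \<longlonglongrightarrow> 0" by real_asymp
    qed
    then have "(LINT t|Q. h (x t)) = 0"
      using LIMSEQ_unique conv[OF hc] by blast
    moreover have "(LINT t|Q. h (x t)) = of_real (LINT t|Q. min 1 (infdist (x t) F))"
      unfolding h_def by (rule integral_complex_of_real)
    ultimately have z: "(LINT t|Q. min 1 (infdist (x t) F)) = 0" by simp
    have mc: "continuous_on UNIV (\<lambda>t. min 1 (infdist (x t) F))"
      by (intro continuous_intros xw)
    have mm: "(\<lambda>t. min 1 (infdist (x t) F)) \<in> borel_measurable Q"
      using borel_measurable_continuous_onI[OF mc] by simp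
    have "AE t in Q. min 1 (infdist (x t) F) = 0"
      using z by (subst (asm) integral_nonneg_eq_0_iff_AE)
         (auto intro!: integrable_const_bound[of _ 1] simp: mm infdist_nonneg)
    then show ?thesis
    proof eventually_elim
      case (elim t)
      then have "infdist (x t) F = 0" by (auto simp: min_def split: if_splits)
      then show ?case using in_closed_iff_infdist_zero[OF clF \<open>F \<noteq> {}\<close>] by simp
    qed
  qed
  have limit: "(LINT t|Q. k (x t) * w t) = c"
    if k: "continuous_on UNIV k" and c: "\<forall>\<^sub>F n in sequentially. S n k = c" for k c
  proof -
    have "continuous_on UNIV (\<lambda>(a, b). k a * b)"
      unfolding split_def by (intro continuous_on_mult continuous_on_snd continuous_on_id
          continuous_on_compose2[OF k continuous_on_fst[OF continuous_on_id]]) auto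
    from conv[OF this] have "(\<lambda>n. S (r n) k) \<longlonglongrightarrow> (LINT t|Q. k (x t) * w t)"
      by (simp add: PS[OF k])
    moreover have "(\<lambda>n. S (r n) k) \<longlonglongrightarrow> c"
    proof (rule tendsto_eventually)
      show "\<forall>\<^sub>F n in sequentially. S (r n) k = c"
        using eventually_compose_filterlim[OF c filterlim_subseq[OF r]] .
    qed
    ultimately show ?thesis by (rule LIMSEQ_unique)
  qed
  interpret weighted_image Q x F
    using Q xw(1) cF AE by unfold_locales (auto simp: borel_measurable_continuous_onI)
  obtain Bw where Bw: "\<And>t. norm (w t) \<le> Bw" using xw(3) by (auto simp: bounded_iff)
  have wm: "w \<in> borel_measurable borel" by (rule borel_measurable_continuous_onI[OF xw(2)])
  define \<nu> where "\<nu> A = (LINT t|Q. w t * indicator A (x t))" for A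
  note image = complex_measure_image[OF wm Bw, folded \<nu>_def[abs_def]]
  have at_inf: "S n k = - b"
    if "\<And>\<gamma> t. \<gamma> \<in> I n \<Longrightarrow> t \<in> {0..1} \<Longrightarrow> k (\<gamma> t) * f (\<gamma> t) = g (\<gamma> t)"
      "g holomorphic_on outside F" "((\<lambda>w. w * g w) \<longlongrightarrow> b) at_infinity" for n k g b
  proof -
    have "S n k = - (1 / (2 * of_real pi * \<i>)) * (\<Sum>\<gamma>\<in>I n. contour_integral \<gamma> g)"
      by (rule S_eq) (rule that(1))
    also have "(\<Sum>\<gamma>\<in>I n. contour_integral \<gamma> g) = 2 * of_real pi * \<i> * b"
      by (rule contour_integral_cycle_at_infinity[OF cF I(1) IV wn1 that(2,3)])
    finally show ?thesis by simp
  qed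
  have transform: "cauchy_transform \<nu> (Some z) = c"
    if z: "z \<notin> F" and c: "\<forall>\<^sub>F n in sequentially. \<forall>k.
      (\<forall>\<gamma>\<in>I n. \<forall>t\<in>{0..1}. \<gamma> t \<noteq> z \<and> k (\<gamma> t) = 1 / (\<gamma> t - z)) \<longrightarrow> S n k = c" for z c
  proof -
    define d where "d = infdist z F / 2"
    have d: "d > 0" using z clF \<open>F \<noteq> {}\<close> by (simp add: d_def infdist_pos_not_in_closed)
    let ?k = "reciprocal_cutoff z d"
    have far: "d \<le> norm (\<xi> - z)" if "infdist \<xi> F \<le> d" for \<xi>
      using infdist_triangle[of z F \<xi>] that by (simp add: d_def dist_norm norm_minus_commute)
    have "cauchy_transform \<nu> (Some z) = (LINT t|Q. 1 / (x t - z) * w t)"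
      by (rule image(4)[OF z])
    also have "\<dots> = (LINT t|Q. ?k (x t) * w t)"
    proof (rule integral_cong_AE)
      show "AE t in Q. 1 / (x t - z) * w t = ?k (x t) * w t"
        using AE by eventually_elim (simp add: reciprocal_cutoff_eq[OF far] less_imp_le[OF d])
      show "(\<lambda>t. 1 / (x t - z) * w t) \<in> borel_measurable Q"
        using wm by measurable
      have [measurable]: "?k \<in> borel_measurable borel"
        by (rule borel_measurable_continuous_onI[OF reciprocal_cutoff_continuous[OF d]])
      show "(\<lambda>t. ?k (x t) * w t) \<in> borel_measurable Q"
        using wm by measurable
    qed
    also have "\<dots> = c"
    proof (rule limit[OF reciprocal_cutoff_continuous[OF d]])
      have "\<forall>\<^sub>F n in sequentially. 1 / real (Suc n) < d"
        using d by real_asymp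
      then show "\<forall>\<^sub>F n in sequentially. S n ?k = c"
        using c
      proof eventually_elim
        case (elim n)
        have "\<gamma> t \<noteq> z \<and> ?k (\<gamma> t) = 1 / (\<gamma> t - z)" if "\<gamma> \<in> I n" "t \<in> {0..1}" for \<gamma> t
        proof -
          have "d \<le> norm (\<gamma> t - z)"
            using Inb[OF that] elim(1) by (intro far) (simp add: nbhd_def)
          then show ?thesis using d by (auto simp: reciprocal_cutoff_eq)
        qed
        with elim(2) show ?case by blast
      qed
    qed
    finally show ?thesis .
  qed
  show thesis
  proof (rule that[of \<nu>])
    show "complex_borel_measure \<nu>" "supported_on \<nu> F" by (rule image)+
    have "\<nu> F = (LINT t|Q. 1 * w t)" using image(3) by (simp add: \<nu>_def)
    also have "\<dots> = - a"
    proof (rule limit[of "\<lambda>_. 1"])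
      show "\<forall>\<^sub>F n in sequentially. S n (\<lambda>_. 1) = - a"
        by (intro always_eventually allI at_inf[OF _ f(1) lim]) simp
    qed simp
    finally show "\<nu> F = - a" .
  next
    fix z assume z: "z \<in> inside F"
    have zF: "z \<notin> F" "z \<notin> outside F"
      using z inside_no_overlap[of F] inside_Int_outside[of F] by blast+
    \<comment> \<open>For \<open>z\<close> in a bounded component the kernel has no pole in
      \<open>outside F\<close>, and since \<open>f\<close> itself decays, the product has
      coefficient 0 at infinity.\<close>
    have "(\<lambda>\<xi>. f \<xi> / (\<xi> - z)) holomorphic_on outside F"
      using zF(2) by (intro holomorphic_intros f(1)) auto
    moreover have "((\<lambda>\<xi>. \<xi> * (f \<xi> / (\<xi> - z))) \<longlongrightarrow> 0) at_infinity"
    proof -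
      have "((\<lambda>\<xi>. (\<xi> * f \<xi>) * inverse (\<xi> - z)) \<longlongrightarrow> a * 0) at_infinity"
        by (intro tendsto_mult lim tendsto_inverse_diff_at_infinity)
      then show ?thesis by (simp add: divide_inverse mult.assoc)
    qed
    ultimately have "S n k = - 0" if "\<forall>\<gamma>\<in>I n. \<forall>t\<in>{0..1}. \<gamma> t \<noteq> z \<and> k (\<gamma> t) = 1 / (\<gamma> t - z)" for n k
      by (rule at_inf[rotated]) (simp_all add: that)
    then show "cauchy_transform \<nu> (Some z) = 0"
      by (intro transform[OF zF(1)] always_eventually) auto
  next
    fix z assume z: "z \<in> outside F"
    have zF: "z \<notin> F" using z outside_no_overlap[of F] by blast
    \<comment> \<open>Subtracting \<open>f z\<close> removes the pole at \<open>z\<close>; the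
      subtracted constant reappears as the coefficient \<open>- f z\<close> of \<open>q\<close> at
      infinity.\<close>
    define q where "q \<xi> = (if \<xi> = z then deriv f z else (f \<xi> - f z) / (\<xi> - z))" for \<xi>
    have q: "q holomorphic_on outside F"
      unfolding q_def by (rule pole_lemma_open[OF f(1) op])
    have qlim: "((\<lambda>\<xi>. \<xi> * q \<xi>) \<longlongrightarrow> - f z) at_infinity"
    proof -
      have "((\<lambda>\<xi>. (\<xi> * f \<xi>) * inverse (\<xi> - z) - f z * (1 + z * inverse (\<xi> - z))) \<longlongrightarrow> a * 0 - f z * (1 + z * 0)) at_infinity"
        by (intro tendsto_intros lim tendsto_inverse_diff_at_infinity)
      moreover have "\<forall>\<^sub>F \<xi> in at_infinity. (\<xi> * f \<xi>) * inverse (\<xi> - z) - f z * (1 + z * inverse (\<xi> - z)) = \<xi> * q \<xi>"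
        unfolding eventually_at_infinity
      proof (intro exI[of _ "norm z + 1"] allI impI)
        fix \<xi> :: complex assume "norm z + 1 \<le> norm \<xi>"
        then have "\<xi> \<noteq> z" by auto
        then show "(\<xi> * f \<xi>) * inverse (\<xi> - z) - f z * (1 + z * inverse (\<xi> - z)) = \<xi> * q \<xi>"
        proof -
          have "(\<xi> - z) * inverse (\<xi> - z) = 1" using \<open>\<xi> \<noteq> z\<close> by simp
          then have "1 + z * inverse (\<xi> - z) = \<xi> * inverse (\<xi> - z)"
            by (simp only: left_diff_distrib) (simp add: diff_eq_eq)
          moreover have "\<xi> * q \<xi> = (\<xi> * f \<xi>) * inverse (\<xi> - z) - f z * (\<xi> * inverse (\<xi> - z))"
            using \<open>\<xi> \<noteq> z\<close> by (simp add: q_def divide_inverse algebra_simps)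
          ultimately show ?thesis by simp
        qed
      qed
      ultimately show ?thesis
        by (auto intro: Lim_transform_eventually)
    qed
    \<comment> \<open>A path in \<open>outside F\<close> from \<open>z\<close> to a far point has
      positive distance from \<open>F\<close>. Late curves are closer to \<open>F\<close> than that,
      so they miss the path and have winding number 0 about \<open>z\<close>.\<close>
    obtain z1 where z1: "z1 \<in> outside F" "z1 \<notin> ball 0 (B + 1)"
      using outside_not_subset_bounded[OF compact_imp_bounded[OF cF] bounded_ball] by metis
    have "connected (outside F)"
      by (rule connected_outside) (use cF in \<open>auto simp: compact_imp_bounded\<close>)
    then obtain p where p: "path p" "path_image p \<subseteq> outside F" "pathstart p = z" "pathfinish p = z1"
      using connected_open_path_connected[OF op] z z1(1) unfolding path_connected_def by blast
    have "path_image p \<inter> F = {}" using p(2) outside_no_overlap[of F] by blast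
    then obtain d where d: "d > 0" "\<And>\<xi> \<eta>. \<xi> \<in> path_image p \<Longrightarrow> \<eta> \<in> F \<Longrightarrow> d \<le> dist \<xi> \<eta>"
      using separate_compact_closed[OF compact_path_image[OF p(1)] clF] by metis
    have "\<forall>\<^sub>F n in sequentially. 1 / real (Suc n) < d"
      using d(1) by real_asymp
    then have "\<forall>\<^sub>F n in sequentially. \<forall>k.
      (\<forall>\<gamma>\<in>I n. \<forall>t\<in>{0..1}. \<gamma> t \<noteq> z \<and> k (\<gamma> t) = 1 / (\<gamma> t - z)) \<longrightarrow> S n k = f z"
    proof eventually_elim
      case (elim n)
      have off: "path_image p \<inter> path_image \<gamma> = {}" if "\<gamma> \<in> I n" for \<gamma>
      proof -
        have "d \<le> infdist \<xi> F" if "\<xi> \<in> path_image p" for \<xi>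
          using d(2)[OF that] \<open>F \<noteq> {}\<close> by (simp add: infdist_def le_cINF_iff)
        moreover have "infdist \<xi> F < 1 / real (Suc n)" if "\<xi> \<in> path_image \<gamma>" for \<xi>
          using \<Gamma>(2)[of \<gamma> n] \<open>\<gamma> \<in> I n\<close> I(2) that by (auto simp: nbhd_def)
        ultimately show ?thesis using elim by fastforce
      qed
      have w0: "winding_number \<gamma> z = 0" if "\<gamma> \<in> I n" for \<gamma>
      proof -
        have pg: "path \<gamma>" "pathfinish \<gamma> = pathstart \<gamma>"
          using IV[OF that] by (auto simp: valid_path_imp_path)
        have "path_image \<gamma> \<subseteq> ball 0 (B + 1)"
          by (auto simp: path_image_def intro!: nbB[of _ n] Inb[OF that])
        then have "winding_number \<gamma> z1 = 0"
          by (intro winding_number_zero_outside[OF pg(1) convex_ball pg(2) z1(2)])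
        moreover have "winding_number \<gamma> z = winding_number \<gamma> z1"
          by (rule winding_number_constant_eq[OF pg connected_path_image[OF p(1)] off[OF that]])
             (use p(3,4) in auto)
        ultimately show ?thesis by simp
      qed
      have znot: "z \<notin> path_image \<gamma>" if "\<gamma> \<in> I n" for \<gamma>
        using off[OF that] p(3) by (metis disjoint_iff pathstart_in_path_image)
      have ci: "contour_integral \<gamma> (\<lambda>\<xi>. f \<xi> / (\<xi> - z)) = contour_integral \<gamma> q" if \<gamma>: "\<gamma> \<in> I n" for \<gamma>
      proof -
        have vp: "valid_path \<gamma>" "path_image \<gamma> \<subseteq> outside F - {z}"
          using IV[OF \<gamma>] znot[OF \<gamma>] by auto
        have h: "(\<lambda>\<xi>. f \<xi> / (\<xi> - z)) holomorphic_on outside F - {z}" "(\<lambda>\<xi>. f z * (1 / (\<xi> - z))) holomorphic_on outside F - {z}"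
          by (intro holomorphic_intros holomorphic_on_subset[OF f(1)]; auto)+
        note int = contour_integrable_holomorphic_simple[OF _ open_delete[OF op] vp]
        have "contour_integral \<gamma> q = contour_integral \<gamma> (\<lambda>\<xi>. f \<xi> / (\<xi> - z) - f z * (1 / (\<xi> - z)))"
          by (rule contour_integral_cong) (use znot[OF \<gamma>] in \<open>auto simp: q_def diff_divide_distrib\<close>)
        also have "\<dots> = contour_integral \<gamma> (\<lambda>\<xi>. f \<xi> / (\<xi> - z)) - contour_integral \<gamma> (\<lambda>\<xi>. f z * (1 / (\<xi> - z)))"
          by (rule contour_integral_diff[OF int[OF h(1)] int[OF h(2)]])
        also have "contour_integral \<gamma> (\<lambda>\<xi>. f z * (1 / (\<xi> - z))) = f z * contour_integral \<gamma> (\<lambda>\<xi>. 1 / (\<xi> - z))"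
          by (rule contour_integral_lmul[OF int]) (intro holomorphic_intros; auto)
        also have "contour_integral \<gamma> (\<lambda>\<xi>. 1 / (\<xi> - z)) = 0"
          using winding_number_contour_integral[OF vp(1) znot[OF \<gamma>]] w0[OF \<gamma>] by simp
        finally show ?thesis by simp
      qed
      show ?case
      proof (intro allI impI)
        fix k assume k: "\<forall>\<gamma>\<in>I n. \<forall>t\<in>{0..1}. \<gamma> t \<noteq> z \<and> k (\<gamma> t) = 1 / (\<gamma> t - z)"
        have "S n k = - (1 / (2 * of_real pi * \<i>)) * (\<Sum>\<gamma>\<in>I n. contour_integral \<gamma> (\<lambda>\<xi>. f \<xi> / (\<xi> - z)))"
          by (rule S_eq) (use k in auto)
        also have "(\<Sum>\<gamma>\<in>I n. contour_integral \<gamma> (\<lambda>\<xi>. f \<xi> / (\<xi> - z))) = (\<Sum>\<gamma>\<in>I n. contour_integral \<gamma> q)"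
          by (rule sum.cong[OF refl ci])
        also have "\<dots> = 2 * of_real pi * \<i> * (- f z)"
          by (rule contour_integral_cycle_at_infinity[OF cF I(1) IV wn1 q qlim])
        finally show "S n k = f z" by simp
      qed
    qed
    then show "cauchy_transform \<nu> (Some z) = f z"
      by (rule transform[OF zF])
  qed
qed

section \<open>Conformal maps of the exterior of a continuum\<close>

text \<open>The exterior of \<open>K\<close> is seen through the inversion \<open>z \<mapsto> 1 / (z - a)\<close> about a point
  \<open>a\<close> of \<open>K\<close>; then \<open>u\<close> is a Riemann map of the exterior with \<open>\<infinity> \<mapsto> 0\<close>, and \<open>g\<close> is the inverse of the
  Riemann map in the inverted coordinate.\<close>

definition exterior_map :: "complex set \<Rightarrow> complex \<Rightarrow> (complex \<Rightarrow> complex) \<Rightarrow> (complex \<Rightarrow> complex) \<Rightarrow> bool" where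
  "exterior_map K a g u \<longleftrightarrow> a \<in> K \<and> g holomorphic_on ball 0 1 \<and> inj_on g (ball 0 1) \<and> g 0 = 0 \<and>
     u holomorphic_on - K \<and> (\<forall>z. z \<notin> K \<longrightarrow> u z \<in> ball 0 1 \<and> g (u z) = inverse (z - a)) \<and>
     (\<forall>\<zeta>\<in>ball 0 1. \<zeta> \<noteq> 0 \<longrightarrow> a + inverse (g \<zeta>) \<notin> K)"

lemma exterior_mapD:
  assumes "exterior_map K a g u"
  shows "a \<in> K" "g holomorphic_on ball 0 1" "inj_on g (ball 0 1)" "g 0 = 0" "u holomorphic_on - K"
    and "\<And>z. z \<notin> K \<Longrightarrow> norm (u z) < 1" "\<And>z. z \<notin> K \<Longrightarrow> g (u z) = inverse (z - a)"
    and "\<And>\<zeta>. norm \<zeta> < 1 \<Longrightarrow> \<zeta> \<noteq> 0 \<Longrightarrow> a + inverse (g \<zeta>) \<notin> K"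
  using assms unfolding exterior_map_def by auto

lemma exterior_map_nonzero:
  assumes "exterior_map K a g u"
  shows "z \<notin> K \<Longrightarrow> u z \<noteq> 0" and "norm \<zeta> < 1 \<Longrightarrow> \<zeta> \<noteq> 0 \<Longrightarrow> g \<zeta> \<noteq> 0"
    and "norm \<zeta> < 1 \<Longrightarrow> \<zeta> \<noteq> 0 \<Longrightarrow> u (a + inverse (g \<zeta>)) = \<zeta>"
    and "z \<notin> K \<Longrightarrow> a + inverse (g (u z)) = z"
    and "inj_on u (- K)"
proof -
  note D = exterior_mapD[OF assms]
  show "u z \<noteq> 0" if "z \<notin> K"
  proof
    assume "u z = 0"
    then have "inverse (z - a) = 0" using D(4) D(7)[OF that] by simp
    then show False using D(1) that by auto
  qed
  show nz: "g \<zeta> \<noteq> 0" if "norm \<zeta> < 1" "\<zeta> \<noteq> 0" for \<zeta>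
    using inj_onD[OF D(3), of \<zeta> 0] D(4) that by auto
  show "u (a + inverse (g \<zeta>)) = \<zeta>" if \<zeta>: "norm \<zeta> < 1" "\<zeta> \<noteq> 0"
  proof -
    note n = D(8)[OF \<zeta>]
    have "g (u (a + inverse (g \<zeta>))) = g \<zeta>"
      unfolding D(7)[OF n] by simp
    then show ?thesis
      using inj_onD[OF D(3), of "u (a + inverse (g \<zeta>))" \<zeta>] D(6)[OF n] \<zeta> by simp
  qed
  show rt: "a + inverse (g (u z)) = z" if "z \<notin> K" for z
    unfolding D(7)[OF that] by simp
  show "inj_on u (- K)"
    by (rule inj_on_inverseI[of _ "\<lambda>\<zeta>. a + inverse (g \<zeta>)"]) (simp add: rt)
qed

lemma closed_vimage_inverse_shift:
  fixes Q :: "complex set"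
  assumes "compact Q"
  shows "closed {z. z \<noteq> a \<and> inverse (z - a) \<in> Q}"
proof -
  have "closed ((\<lambda>z. z - a) -` {w. w \<noteq> 0 \<and> inverse w \<in> Q})"
    by (intro closed_vimage closed_vimage_inverse assms continuous_intros)
  moreover have "(\<lambda>z. z - a) -` {w. w \<noteq> 0 \<and> inverse w \<in> Q} = {z. z \<noteq> a \<and> inverse (z - a) \<in> Q}"
    by auto
  ultimately show ?thesis by simp
qed

text \<open>Under inversion the set corresponds to the compact image of a smaller disc under
  \<open>g\<close>; in particular it cannot accumulate at \<open>K\<close>, off which alone
  \<open>u\<close> is controlled.\<close>

lemma exterior_map_closed_sublevel:
  assumes e: "exterior_map K a g u" and "\<rho> < 1"
  shows "closed {z. z \<notin> K \<and> norm (u z) \<le> \<rho>}"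
proof -
  note D = exterior_mapD[OF e] and N = exterior_map_nonzero[OF e]
  have "compact (g ` cball 0 \<rho>)"
    using \<open>\<rho> < 1\<close> by (intro compact_continuous_image compact_cball
        continuous_on_subset[OF holomorphic_on_imp_continuous_on[OF D(2)]]) auto
  then have "closed {z. z \<noteq> a \<and> inverse (z - a) \<in> g ` cball 0 \<rho>}"
    by (rule closed_vimage_inverse_shift)
  moreover have "{z. z \<noteq> a \<and> inverse (z - a) \<in> g ` cball 0 \<rho>} = {z. z \<notin> K \<and> norm (u z) \<le> \<rho>}"
  proof (intro set_eqI iffI)
    fix z assume "z \<in> {z. z \<noteq> a \<and> inverse (z - a) \<in> g ` cball 0 \<rho>}"
    then obtain \<zeta> where \<zeta>: "z \<noteq> a" "inverse (z - a) = g \<zeta>" "norm \<zeta> \<le> \<rho>" by auto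
    have "\<zeta> \<noteq> 0" using \<zeta>(1,2) D(4) by auto
    moreover have "norm \<zeta> < 1" using \<zeta>(3) \<open>\<rho> < 1\<close> by simp
    moreover have "z = a + inverse (g \<zeta>)" using \<zeta>(2) by (metis add_diff_cancel_left' diff_add_cancel inverse_inverse_eq add.commute)
    ultimately show "z \<in> {z. z \<notin> K \<and> norm (u z) \<le> \<rho>}"
      using D(8) N(3) \<zeta>(3) by auto
  next
    fix z assume "z \<in> {z. z \<notin> K \<and> norm (u z) \<le> \<rho>}"
    then show "z \<in> {z. z \<noteq> a \<and> inverse (z - a) \<in> g ` cball 0 \<rho>}"
      using D(1) D(7)[of z] by (auto intro!: image_eqI[of _ g "u z"])
  qed
  ultimately show ?thesis by simp
qed

text \<open>In the inverted coordinate the exterior becomes a plane domain \<open>S\<close>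
  containing 0. Connectedness of \<open>K\<close> makes it simply connected, and the second point of
  \<open>K\<close> makes it a proper subset of the plane. The decay estimate is Schwarz's lemma on
  the exterior of a disc about \<open>a\<close> that contains \<open>K\<close>.\<close>

lemma exterior_map_exists:
  assumes K: "compact K" "connected K" "connected (- K)" and a: "a \<in> K" and b: "b \<in> K" "b \<noteq> a"
  obtains g u where "exterior_map K a g u"
    "\<And>d z. d > 0 \<Longrightarrow> (\<And>x. x \<in> K \<Longrightarrow> norm (x - a) \<le> d) \<Longrightarrow> norm (z - a) > d \<Longrightarrow> norm (u z) \<le> d / norm (z - a)"
proof -
  define T where "T = {w. w \<noteq> 0 \<and> inverse w \<in> (\<lambda>z. z - a) ` K}"
  have Tiff: "w \<in> T \<longleftrightarrow> w \<noteq> 0 \<and> a + inverse w \<in> K" for w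
    unfolding T_def by (auto simp: image_iff) (metis add_diff_cancel_left')
  have "compact ((\<lambda>z. z - a) ` K)"
    by (intro compact_continuous_image K continuous_intros)
  then have clT: "closed T" unfolding T_def by (rule closed_vimage_inverse)
  define S where "S = - T"
  have opS: "open S" unfolding S_def using clT by (simp add: open_Compl)
  have Siff: "w \<in> S \<longleftrightarrow> w = 0 \<or> a + inverse w \<notin> K" for w by (auto simp: S_def Tiff)
  have inS: "inverse (z - a) \<in> S" if "z \<notin> K" for z
    using that by (simp add: Siff)
  have conS: "connected S"
  proof -
    let ?Q = "(\<lambda>z. inverse (z - a)) ` (- K)"
    have "connected ?Q"
      by (intro connected_continuous_image K continuous_intros) (use a in auto)
    moreover have "?Q \<subseteq> S" using inS by auto
    moreover have "S \<subseteq> closure ?Q"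
    proof
      fix w assume w: "w \<in> S"
      show "w \<in> closure ?Q"
      proof (cases "w = 0")
        case False
        then have "w = inverse ((a + inverse w) - a)" "a + inverse w \<in> - K"
          using w by (auto simp: Siff)
        then have "w \<in> ?Q"
          using imageI[of "a + inverse w" "- K" "\<lambda>z. inverse (z - a)"] by simp
        then show ?thesis by (rule subsetD[OF closure_subset])
      next
        case True
        obtain B where B: "B > 0" "\<And>x. x \<in> K \<Longrightarrow> norm x \<le> B"
          using compact_imp_bounded[OF K(1)] bounded_pos by metis
        show ?thesis
          unfolding closure_approachable
        proof (intro allI impI)
          fix e :: real assume e: "e > 0"
          define t where "t = B + norm a + 2 / e"
          define z where "z = a + complex_of_real t"
          have "0 < 1 / e" "2 / e = 2 * (1 / e)" using e by simp_all
          then have t: "t > 1 / e" "t > 0"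
            using B(1) norm_ge_zero[of a] unfolding t_def by linarith+
          have "norm z \<ge> t - norm a"
            using norm_triangle_ineq2[of "complex_of_real t" "- a"] t by (simp add: z_def add.commute)
          moreover have "B < t - norm a" using e by (simp add: t_def)
          ultimately have "norm z > B" by linarith
          then have "z \<in> - K" using B(2)[of z] by auto
          moreover have "dist (inverse (z - a)) w < e"
          proof -
            have "inverse t < e" using t e by (simp add: field_simps)
            then show ?thesis using t(2) True by (simp add: z_def dist_norm norm_inverse)
          qed
          ultimately show "\<exists>y\<in>?Q. dist y w < e" by (intro bexI[OF _ imageI])
        qed
      qed
    qed
    ultimately show ?thesis by (rule connected_intermediate_closure)
  qed
  \<comment> \<open>By the theorem of Sura and Bura a bounded component of the complement of
    \<open>S\<close> would lie in a compact, relatively clopen part of it; inverted, this is a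
    nonempty clopen part of \<open>K\<close> that misses \<open>a\<close>.\<close>
  have unb: "\<not> bounded C" if C: "C \<in> components (- S)" for C
  proof
    assume "bounded C"
    have ST: "- S = T" by (simp add: S_def)
    have C': "C \<in> components T" using C ST by simp
    have "compact C"
      using closed_components[OF clT C'] \<open>bounded C\<close> by (simp add: compact_eq_bounded_closed)
    then obtain K' where K': "openin (top_of_set T) K'" "compact K'" "C \<subseteq> K'"
      using Sura_Bura_clopen_subset[OF closed_imp_locally_compact[OF clT] C' _ open_UNIV subset_UNIV] by metis
    obtain W where W: "open W" "K' = T \<inter> W" using K'(1) by (auto simp: openin_open)
    define A where "A = (\<lambda>w. a + inverse w) ` K'"
    have "compact A"
      unfolding A_def using W(2) by (intro compact_continuous_image K' continuous_intros) (auto simp: Tiff)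
    then have "closedin (top_of_set K) A"
      using W(2) by (intro closed_subset) (auto simp: A_def Tiff compact_imp_closed)
    moreover have "openin (top_of_set K) A"
    proof -
      have "open ((- {a}) \<inter> (\<lambda>z. inverse (z - a)) -` W)"
        by (intro continuous_open_preimage W continuous_intros) auto
      moreover have "A = K \<inter> ((- {a}) \<inter> (\<lambda>z. inverse (z - a)) -` W)"
      proof (intro set_eqI iffI)
        fix z assume "z \<in> A"
        then show "z \<in> K \<inter> ((- {a}) \<inter> (\<lambda>z. inverse (z - a)) -` W)"
          unfolding A_def W(2) by (auto simp: Tiff)
      next
        fix z assume z: "z \<in> K \<inter> ((- {a}) \<inter> (\<lambda>z. inverse (z - a)) -` W)"
        then have "z = a + inverse (inverse (z - a))" "inverse (z - a) \<in> K'"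
          by (auto simp: W(2) Tiff)
        then show "z \<in> A"
          using imageI[of "inverse (z - a)" K' "\<lambda>w. a + inverse w"] unfolding A_def by simp
      qed
      ultimately show ?thesis by (auto simp: openin_open)
    qed
    ultimately have "A = {} \<or> A = K"
      using K(2) unfolding connected_clopen by blast
    moreover have "A \<noteq> {}" using K'(3) in_components_nonempty[OF C'] by (auto simp: A_def)
    moreover have "a \<notin> A" unfolding A_def W(2) by (auto simp: Tiff)
    ultimately show False using a by blast
  qed
  have "simply_connected S"
    unfolding simply_connected_eq_unbounded_complement_components[OF opS] using conS unb by blast
  moreover have "S \<noteq> {}" using Siff[of 0] by auto
  moreover have "S \<noteq> UNIV"
    using b Siff[of "inverse (b - a)"] by auto
  ultimately obtain f g0 where f: "f holomorphic_on S" "g0 holomorphic_on ball 0 1"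
      "\<And>z. z \<in> S \<Longrightarrow> f z \<in> ball 0 1" "\<And>z. z \<in> S \<Longrightarrow> g0 (f z) = z"
      "\<And>z. z \<in> ball 0 1 \<Longrightarrow> g0 z \<in> S" "\<And>z. z \<in> ball 0 1 \<Longrightarrow> f (g0 z) = z"
    using Riemann_mapping_theorem[of S] opS by blast
  have "0 \<in> S" by (simp add: Siff)
  \<comment> \<open>A disc automorphism moves \<open>f 0\<close>, the image of infinity, to the
    origin.\<close>
  obtain \<phi> \<psi> where \<phi>: "\<phi> (f 0) = 0" "\<phi> holomorphic_on ball 0 1" "\<phi> ` ball 0 1 \<subseteq> ball 0 1"
      "\<psi> holomorphic_on ball 0 1" "\<psi> ` ball 0 1 \<subseteq> ball 0 1"
      "\<And>z. z \<in> ball 0 1 \<Longrightarrow> \<phi> (\<psi> z) = z" "\<And>z. z \<in> ball 0 1 \<Longrightarrow> \<psi> (\<phi> z) = z"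
    using ball_biholomorphism_exists[OF f(3)[OF \<open>0 \<in> S\<close>]] by metis
  define h where "h = \<phi> \<circ> f"
  define g where "g = g0 \<circ> \<psi>"
  have h: "h holomorphic_on S"
    unfolding h_def by (rule holomorphic_on_compose_gen[OF f(1) \<phi>(2)]) (use f(3) in auto)
  have hb: "h z \<in> ball 0 1" and gh: "g (h z) = z" if "z \<in> S" for z
  proof -
    show "h z \<in> ball 0 1" using f(3)[OF that] \<phi>(3) unfolding h_def o_def by blast
    show "g (h z) = z" using f(4)[OF that] \<phi>(7)[OF f(3)[OF that]] by (simp add: h_def g_def)
  qed
  have g: "g holomorphic_on ball 0 1"
    unfolding g_def by (rule holomorphic_on_compose_gen[OF \<phi>(4) f(2)]) (use \<phi>(5) in auto)
  have gS: "g \<zeta> \<in> S" and hg: "h (g \<zeta>) = \<zeta>" if "\<zeta> \<in> ball 0 1" for \<zeta>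
  proof -
    have "\<psi> \<zeta> \<in> ball 0 1" using \<phi>(5) that by blast
    then show "g \<zeta> \<in> S" "h (g \<zeta>) = \<zeta>"
      using f(5,6)[of "\<psi> \<zeta>"] \<phi>(6)[OF that] by (auto simp: h_def g_def)
  qed
  have h0: "h 0 = 0" using \<phi>(1) by (simp add: h_def)
  have g0: "g 0 = 0" using gh[OF \<open>0 \<in> S\<close>] h0 by simp
  have ginj: "inj_on g (ball 0 1)" by (rule inj_on_inverseI[of _ h]) (rule hg)
  define u where "u = h \<circ> (\<lambda>z. inverse (z - a))"
  show thesis
  proof (rule that[of g u])
    show "exterior_map K a g u"
      unfolding exterior_map_def
    proof (intro conjI allI impI ballI)
      show "a \<in> K" by (rule a)
      show "u holomorphic_on - K"
        unfolding u_def
      proof (rule holomorphic_on_compose_gen[OF _ h])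
        show "(\<lambda>z. inverse (z - a)) holomorphic_on - K"
          using a by (intro holomorphic_on_inverse holomorphic_intros) auto
      qed (use inS in auto)
      show "u z \<in> ball 0 1" "g (u z) = inverse (z - a)" if "z \<notin> K" for z
        using hb[OF inS[OF that]] gh[OF inS[OF that]] by (auto simp: u_def)
      fix \<zeta> :: complex assume \<zeta>: "\<zeta> \<in> ball 0 1" "\<zeta> \<noteq> 0"
      have "g \<zeta> \<noteq> 0" using inj_onD[OF ginj, of \<zeta> 0] g0 \<zeta> by auto
      then show "a + inverse (g \<zeta>) \<notin> K" using gS[OF \<zeta>(1)] by (simp add: Siff)
    qed (rule g ginj g0)+
    fix d :: real and z assume d: "d > 0" "\<And>x. x \<in> K \<Longrightarrow> norm (x - a) \<le> d" and z: "norm (z - a) > d"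
    \<comment> \<open>For \<open>0 < norm w < 1\<close> the point \<open>a + d / w\<close> has
      distance more than \<open>d\<close> from \<open>a\<close> and so lies off \<open>K\<close>;
      hence \<open>h\<close> after scaling by \<open>1 / d\<close> maps the unit disc into itself
      and fixes 0.\<close>
    have scaled: "w / of_real d \<in> S" if w: "norm w < 1" for w :: complex
    proof (rule ccontr)
      assume "w / of_real d \<notin> S"
      then have "w \<noteq> 0" "a + inverse (w / of_real d) \<in> K" by (auto simp: Siff)
      then have "norm (inverse (w / of_real d)) \<le> d" using d(2)[of "a + inverse (w / of_real d)"] by simp
      then have "d / norm w \<le> d" using d(1) by (simp add: norm_divide norm_inverse)
      then show False using \<open>w \<noteq> 0\<close> w d(1) by (simp add: field_simps)
    qed
    have hol: "(\<lambda>w. h (w / of_real d)) holomorphic_on ball 0 1"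
    proof (rule holomorphic_on_compose_gen[of "\<lambda>w. w / of_real d" _ h S, unfolded o_def])
      show "(\<lambda>w. w / of_real d) holomorphic_on ball 0 (1::real)"
        using d(1) by (intro holomorphic_intros) auto
    qed (use h scaled in auto)
    define w where "w = of_real d / (z - a)"
    have w: "norm w = d / norm (z - a)" using d(1) by (simp add: w_def norm_divide)
    moreover have "norm (z - a) > 0" using z d(1) by linarith
    ultimately have w1: "norm w < 1" using z by simp
    have "norm (h (w / of_real d)) \<le> norm w"
      by (rule Schwarz_Lemma(1)[OF hol]) (use h0 hb[OF scaled] w1 in auto)
    moreover have "w / of_real d = inverse (z - a)" using d(1) by (simp add: w_def divide_inverse)
    ultimately show "norm (u z) \<le> d / norm (z - a)" by (simp add: u_def w)
  qed
qed

text \<open>The square root of \<open>1 - g / w0\<close>, normalised to be \<open>-1\<close> at the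
  origin, omits 0 because \<open>g\<close> omits \<open>w0\<close>, and omits 1 because
  \<open>g\<close> vanishes only at the origin, where the root is \<open>-1\<close>. Schottky's
  theorem bounds it in terms of \<open>t\<close> alone.\<close>

lemma omitted_value_bound:
  assumes g: "g holomorphic_on ball 0 1" "g 0 = 0"
    and nz: "\<And>\<zeta>. norm \<zeta> < 1 \<Longrightarrow> \<zeta> \<noteq> 0 \<Longrightarrow> g \<zeta> \<noteq> 0"
    and om: "\<And>\<zeta>. norm \<zeta> < 1 \<Longrightarrow> g \<zeta> \<noteq> w0" and M: "norm w0 \<le> M"
    and t: "0 < t" "t < 1" "norm \<zeta> \<le> t"
  defines "t' \<equiv> 2 * t / (1 + t)"
  shows "norm (g \<zeta>) \<le> M * (1 + (exp (pi * exp (pi * (2 + 2 * 1 + 12 * t' / (1 - t')))))\<^sup>2)"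
proof -
  have "w0 \<noteq> 0" using om[of 0] g(2) by auto
  have "(\<lambda>\<zeta>. 1 - g \<zeta> / w0) holomorphic_on ball 0 1"
    using \<open>w0 \<noteq> 0\<close> by (intro holomorphic_intros g(1)) auto
  moreover have "\<forall>\<zeta>\<in>ball 0 1. 1 - g \<zeta> / w0 \<noteq> 0"
  proof
    fix \<zeta> :: complex assume "\<zeta> \<in> ball 0 1"
    then show "1 - g \<zeta> / w0 \<noteq> 0"
      using om[of \<zeta>] \<open>w0 \<noteq> 0\<close> by (auto simp: field_simps)
  qed
  ultimately obtain s where s: "s holomorphic_on ball 0 1" "\<And>\<zeta>. \<zeta> \<in> ball 0 1 \<Longrightarrow> 1 - g \<zeta> / w0 = (s \<zeta>)\<^sup>2"
    using simply_connected_eq_holomorphic_sqrt[OF open_ball, THEN iffD1,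
        OF convex_imp_simply_connected[OF convex_ball], THEN conjunct2, rule_format,
        of "\<lambda>\<zeta>. 1 - g \<zeta> / w0" 0 1] by auto
  have s0: "(s 0)\<^sup>2 = 1" using s(2)[of 0] g(2) by simp
  then have "s 0 \<noteq> 0" by auto
  define f where "f \<zeta> = - s \<zeta> / s 0" for \<zeta>
  have f2: "(f \<zeta>)\<^sup>2 = 1 - g \<zeta> / w0" if "norm \<zeta> < 1" for \<zeta>
    using s(2)[of \<zeta>] s0 that by (simp add: f_def power_divide)
  have f0: "f 0 = - 1" using \<open>s 0 \<noteq> 0\<close> by (simp add: f_def)
  \<comment> \<open>Schottky's theorem is used on the closed disc, for the function scaled by
    \<open>\<rho>\<close>; the quotient \<open>t / \<rho>\<close> is the \<open>t'\<close> of the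
    statement.\<close>
  define \<rho> where "\<rho> = (1 + t) / 2"
  have \<rho>: "0 < \<rho>" "\<rho> < 1" using t by (auto simp: \<rho>_def)
  have t': "0 < t'" "t' < 1" "t / \<rho> = t'" using t by (auto simp: t'_def \<rho>_def field_simps)
  have small: "norm (of_real \<rho> * z) < 1" if "z \<in> cball 0 1" for z :: complex
  proof -
    have "\<rho> * norm z \<le> \<rho> * 1" using that \<rho> by (intro mult_left_mono) auto
    then show ?thesis using \<rho> unfolding norm_mult norm_of_real by linarith
  qed
  have hol: "(\<lambda>z. f (of_real \<rho> * z)) holomorphic_on cball 0 1"
    unfolding f_def using small \<open>s 0 \<noteq> 0\<close>
    by (intro holomorphic_intros holomorphic_on_compose_gen[of "\<lambda>z. of_real \<rho> * z" _ s "ball 0 1", unfolded o_def] s(1)) auto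
  have omits: "\<not> (f (of_real \<rho> * z) = 0 \<or> f (of_real \<rho> * z) = 1)" if z: "z \<in> cball 0 1" for z
  proof
    assume "f (of_real \<rho> * z) = 0 \<or> f (of_real \<rho> * z) = 1"
    then show False
    proof
      assume "f (of_real \<rho> * z) = 0"
      then have "g (of_real \<rho> * z) = w0" using f2[OF small[OF z]] \<open>w0 \<noteq> 0\<close> by (simp add: field_simps)
      then show False using om[OF small[OF z]] by simp
    next
      assume 1: "f (of_real \<rho> * z) = 1"
      then have "g (of_real \<rho> * z) = 0" using f2[OF small[OF z]] \<open>w0 \<noteq> 0\<close> by simp
      then have "of_real \<rho> * z = 0" using nz[OF small[OF z]] by blast
      then have "f (of_real \<rho> * z) = - 1" using f0 by (simp only:)
      then show False using 1 by simp
    qed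
  qed
  have "norm (\<zeta> / of_real \<rho>) \<le> t'"
    using t(3) \<rho> by (simp add: norm_divide divide_right_mono flip: t'(3))
  then have "norm (f (of_real \<rho> * (\<zeta> / of_real \<rho>))) \<le> exp (pi * exp (pi * (2 + 2 * 1 + 12 * t' / (1 - t'))))"
    by (intro Schottky[OF hol _ omits t'(1,2)]) (auto simp: f0)
  then have fb: "norm (f \<zeta>) \<le> exp (pi * exp (pi * (2 + 2 * 1 + 12 * t' / (1 - t'))))"
    using \<rho> by simp
  have "g \<zeta> = w0 * (1 - (f \<zeta>)\<^sup>2)"
    using f2[of \<zeta>] t \<open>w0 \<noteq> 0\<close> by simp
  also have "norm \<dots> \<le> norm w0 * (1 + (norm (f \<zeta>))\<^sup>2)"
    unfolding norm_mult using norm_triangle_ineq4[of 1 "(f \<zeta>)\<^sup>2"] by (intro mult_left_mono) (auto simp: norm_power)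
  also have "\<dots> \<le> M * (1 + (exp (pi * exp (pi * (2 + 2 * 1 + 12 * t' / (1 - t')))))\<^sup>2)"
    using M fb by (intro mult_mono add_mono power_mono order_refl) (auto intro: order_trans[OF norm_ge_zero])
  finally show ?thesis .
qed

section \<open>Convergence of exterior maps\<close>

lemma tendsto_uniform_limit_compose:
  fixes g :: "complex \<Rightarrow> complex"
  assumes ul: "uniform_limit K gs g sequentially" and cont: "continuous_on K g"
    and x: "x \<longlonglongrightarrow> l" and xK: "\<forall>\<^sub>F n in sequentially. x n \<in> K" and "l \<in> K"
  shows "(\<lambda>n. gs n (x n)) \<longlonglongrightarrow> g l"
proof -
  have "(\<lambda>n. g (x n)) \<longlonglongrightarrow> g l"
    by (rule continuous_on_tendsto_compose[OF cont x \<open>l \<in> K\<close> xK])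
  moreover have "(\<lambda>n. gs n (x n) - g (x n)) \<longlonglongrightarrow> 0"
  proof (rule tendstoI)
    fix e :: real assume "e > 0"
    have "\<forall>\<^sub>F n in sequentially. \<forall>z\<in>K. dist (gs n z) (g z) < e"
      using uniform_limitD[OF ul \<open>e > 0\<close>] .
    then show "\<forall>\<^sub>F n in sequentially. dist (gs n (x n) - g (x n)) 0 < e"
      using xK by eventually_elim (simp add: dist_norm)
  qed
  ultimately show ?thesis
    using tendsto_add by fastforce
qed

text \<open>\<open>approach\<close> is what kernel convergence provides. The points \<open>p\<close>
  and \<open>q\<close> keep the continua \<open>Ls n\<close> from shrinking to a point.\<close>

locale shrinking_continua =
  fixes L :: "complex set" and Ls :: "nat \<Rightarrow> complex set" and p q :: complex
  assumes L: "compact L" "connected L" "connected (- L)"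
    and Ls: "\<And>n. compact (Ls n)" "\<And>n. connected (Ls n)" "\<And>n. connected (- Ls n)"
      "\<And>n. Ls n \<subseteq> L" "\<And>n. Ls n \<noteq> {}"
    and approach: "\<And>z e. z \<in> frontier L \<Longrightarrow> e > 0 \<Longrightarrow> \<forall>\<^sub>F n in sequentially. ball z e \<inter> Ls n \<noteq> {}"
    and pq: "p \<in> frontier L" "q \<in> frontier L" "p \<noteq> q"
begin

lemma closest_point_tendsto:
  assumes "z \<in> frontier L"
  shows "(\<lambda>n. closest_point (Ls n) z) \<longlonglongrightarrow> z"
proof (rule tendstoI)
  fix e :: real assume "e > 0"
  show "\<forall>\<^sub>F n in sequentially. dist (closest_point (Ls n) z) z < e"
    using approach[OF assms \<open>e > 0\<close>]
  proof eventually_elim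
    case (elim n)
    then obtain y where "y \<in> Ls n" "dist z y < e" by auto
    then show ?case
      using closest_point_le[OF compact_imp_closed[OF Ls(1)], of y n z] by (simp add: dist_commute)
  qed
qed

lemma closest_point_in_Ls: "closest_point (Ls n) z \<in> Ls n"
  using closest_point_in_set[OF compact_imp_closed[OF Ls(1)] Ls(5)] .

lemma frontier_in_L: "z \<in> frontier L \<Longrightarrow> z \<in> L"
  using frontier_subset_closed[OF compact_imp_closed[OF L(1)]] by blast

text \<open>The maps \<open>us\<close> are bounded by 1 and the maps \<open>gs\<close> omit values
  of bounded size, so both form normal families, and the limits turn out to be an exterior map of
  \<open>L\<close>. The centres \<open>a n\<close> of the inversions vary; they converge to
  \<open>p\<close>, the centre for the limit.\<close>

lemma limit_exterior_map:
  obtains r a b g u gs us where "strict_mono (r :: nat \<Rightarrow> nat)" "exterior_map L b g u"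
    "\<And>n. exterior_map (Ls (r n)) (a n) (gs n) (us n)"
    "\<And>K. compact K \<Longrightarrow> K \<subseteq> - L \<Longrightarrow> uniform_limit K us u sequentially"
proof -
  \<comment> \<open>For large \<open>n\<close> the points of \<open>Ls n\<close> closest to
    \<open>p\<close> and \<open>q\<close> are more than half of \<open>dist p q\<close> apart; this
    bounds the omitted value \<open>inverse (c n - a n)\<close> by \<open>1 / d\<close>.\<close>
  define d where "d = dist p q / 2"
  have d: "d > 0" using pq(3) by (simp add: d_def)
  have "(\<lambda>n. dist (closest_point (Ls n) p) (closest_point (Ls n) q)) \<longlonglongrightarrow> dist p q"
    by (intro tendsto_dist closest_point_tendsto pq)
  moreover have "d < dist p q" using d unfolding d_def by simp
  ultimately have "\<forall>\<^sub>F n in sequentially. d < dist (closest_point (Ls n) p) (closest_point (Ls n) q)"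
    by (rule order_tendstoD(1))
  then obtain N where N: "\<And>n. n \<ge> N \<Longrightarrow> d < dist (closest_point (Ls n) p) (closest_point (Ls n) q)"
    by (auto simp: eventually_sequentially)
  define r0 where "r0 n = n + N" for n
  have r0: "strict_mono r0" by (simp add: r0_def strict_mono_def)
  define a where "a n = closest_point (Ls (r0 n)) p" for n
  define c where "c n = closest_point (Ls (r0 n)) q" for n
  have a_in: "a n \<in> Ls (r0 n)" and c_in: "c n \<in> Ls (r0 n)" for n
    by (simp_all add: a_def c_def closest_point_in_Ls)
  have a_lim: "a \<longlonglongrightarrow> p"
    unfolding a_def using LIMSEQ_subseq_LIMSEQ[OF closest_point_tendsto[OF pq(1)] r0] by (simp add: o_def)
  have ac: "d < dist (a n) (c n)" for n
    using N[of "n + N"] by (simp add: a_def c_def r0_def)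
  have "c n \<noteq> a n" for n using ac[of n] d by auto
  obtain B where B: "B > 0" "\<And>x. x \<in> L \<Longrightarrow> norm x \<le> B"
    using compact_imp_bounded[OF L(1)] bounded_pos by metis
  have diam: "norm (x - a n) \<le> 2 * B" if "x \<in> Ls (r0 n)" for x n
    using norm_triangle_ineq4[of x "a n"] B(2)[of x] B(2)[of "a n"] that a_in[of n] Ls(4)[of "r0 n"] by force
  define decay where "decay n u \<longleftrightarrow> (\<forall>z. norm (z - a n) > 2 * B \<longrightarrow> norm (u z) \<le> 2 * B / norm (z - a n))"
    for n and u :: "complex \<Rightarrow> complex"
  have "\<exists>g u. exterior_map (Ls (r0 n)) (a n) g u \<and> decay n u" for n
  proof -
    obtain g u where gu: "exterior_map (Ls (r0 n)) (a n) g u"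
      "\<And>d z. d > 0 \<Longrightarrow> (\<And>x. x \<in> Ls (r0 n) \<Longrightarrow> norm (x - a n) \<le> d) \<Longrightarrow> norm (z - a n) > d
        \<Longrightarrow> norm (u z) \<le> d / norm (z - a n)"
      using exterior_map_exists[OF Ls(1,2,3) a_in c_in \<open>c n \<noteq> a n\<close>] by blast
    have "decay n u"
      unfolding decay_def using gu(2)[of "2 * B"] diam B(1) by auto
    then show ?thesis using gu(1) by blast
  qed
  then obtain gs us where e: "\<And>n. exterior_map (Ls (r0 n)) (a n) (gs n) (us n)"
      and dec: "\<And>n. decay n (us n)" by metis
  note D = exterior_mapD[OF e] and Nz = exterior_map_nonzero[OF e]
  have opL: "open (- L)" using L(1) by (simp add: compact_imp_closed open_Compl)
  have notL: "z \<notin> Ls (r0 n)" if "z \<notin> L" for z n using that Ls(4) by blast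
  obtain u r1 where u: "u holomorphic_on - L" and r1: "strict_mono (r1 :: nat \<Rightarrow> nat)"
    and upt: "\<And>z. z \<in> - L \<Longrightarrow> (\<lambda>n. us (r1 n) z) \<longlonglongrightarrow> u z"
    and uunif: "\<And>K. compact K \<Longrightarrow> K \<subseteq> - L \<Longrightarrow> uniform_limit K (us \<circ> r1) u sequentially"
  proof (rule Montel[OF opL, of "range us" us])
    show "h holomorphic_on - L" if h: "h \<in> range us" for h
    proof -
      obtain n where "h = us n" using h by blast
      then show ?thesis using holomorphic_on_subset[OF D(5)[of n]] Ls(4)[of "r0 n"] by auto
    qed
    show "\<exists>B. \<forall>h\<in>range us. \<forall>z\<in>K. norm (h z) \<le> B" if "K \<subseteq> - L" for K
      using that D(6)[OF notL] by (intro exI[of _ 1]) (force intro: less_imp_le)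
  qed (blast | simp)+
  have gbound: "\<exists>M. \<forall>n. \<forall>\<zeta>. norm \<zeta> \<le> t \<longrightarrow> norm (gs n \<zeta>) \<le> M" if t: "0 < t" "t < 1" for t
  proof -
    define t' where "t' = 2 * t / (1 + t)"
    have "norm (gs n \<zeta>) \<le> (1 / d) * (1 + (exp (pi * exp (pi * (2 + 2 * 1 + 12 * t' / (1 - t')))))\<^sup>2)"
      if "norm \<zeta> \<le> t" for n \<zeta>
      unfolding t'_def
    proof (rule omitted_value_bound[OF D(2,4) Nz(2), of n])
      fix \<xi> :: complex assume \<xi>: "norm \<xi> < 1"
      show "gs n \<xi> \<noteq> inverse (c n - a n)"
      proof
        assume eq: "gs n \<xi> = inverse (c n - a n)"
        then have "\<xi> \<noteq> 0" using D(4)[of n] \<open>c n \<noteq> a n\<close> by auto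
        then have "a n + inverse (gs n \<xi>) \<notin> Ls (r0 n)" by (rule D(8)[OF \<xi>])
        then show False using c_in[of n] eq by simp
      qed
    next
      show "norm (inverse (c n - a n)) \<le> 1 / d"
        using ac[of n] d unfolding inverse_eq_divide norm_divide norm_one
        by (intro frac_le) (auto simp: dist_norm norm_minus_commute)
    qed (use t that in auto)
    then show ?thesis by blast
  qed
  obtain g r2 where g: "g holomorphic_on ball 0 1" and r2: "strict_mono (r2 :: nat \<Rightarrow> nat)"
    and gpt: "\<And>z. z \<in> ball 0 1 \<Longrightarrow> (\<lambda>n. gs (r1 (r2 n)) z) \<longlonglongrightarrow> g z"
    and gunif: "\<And>K. compact K \<Longrightarrow> K \<subseteq> ball 0 1 \<Longrightarrow> uniform_limit K (\<lambda>n. gs (r1 (r2 n))) g sequentially"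
  proof (rule Montel[OF open_ball, of "range gs" 0 1 "\<lambda>n. gs (r1 n)"])
    show "\<exists>B. \<forall>h\<in>range gs. \<forall>z\<in>K. norm (h z) \<le> B" if K: "compact K" "K \<subseteq> ball 0 1" for K
    proof -
      obtain t where t: "0 < t" "t < 1" "K \<subseteq> cball 0 t"
      proof (cases "K = {}")
        case True
        then show ?thesis using that[of "1 / 2"] by auto
      next
        case False
        then obtain z where z: "z \<in> K" "\<And>w. w \<in> K \<Longrightarrow> norm w \<le> norm z"
          using continuous_attains_sup[OF K(1) False continuous_on_norm_id] by auto
        have n1: "norm z < 1" using z(1) K(2) by auto
        have "norm w \<le> (1 + norm z) / 2" if "w \<in> K" for w
        proof -
          have "norm w + norm w \<le> norm z + 1" using z(2)[OF that] n1 by (intro add_mono) auto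
          then show ?thesis by (simp add: field_simps)
        qed
        then show ?thesis
          using n1 by (intro that[of "(1 + norm z) / 2"]) (auto intro!: add_pos_nonneg)
      qed
      then show ?thesis using gbound[OF t(1,2)] by (fastforce simp: subset_iff)
    qed
    show "h holomorphic_on ball 0 1" if "h \<in> range gs" for h using that D(2) by auto
  qed (auto simp: o_def)
  define r where "r = r0 \<circ> r1 \<circ> r2"
  have r: "strict_mono r" unfolding r_def using r0 r1 r2 by (simp add: strict_mono_o)
  define s where "s = r1 \<circ> r2"
  have s: "strict_mono s" unfolding s_def using r1 r2 by (simp add: strict_mono_o)
  have upt': "(\<lambda>n. us (s n) z) \<longlonglongrightarrow> u z" if "z \<in> - L" for z
    using LIMSEQ_subseq_LIMSEQ[OF upt[OF that] r2] by (simp add: s_def o_def)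
  have uunif': "uniform_limit K (\<lambda>n. us (s n)) u sequentially" if "compact K" "K \<subseteq> - L" for K
    using filterlim_compose[OF uunif[OF that] filterlim_subseq[OF r2]] by (simp add: s_def o_def)
  have a_lim': "(\<lambda>n. a (s n)) \<longlonglongrightarrow> p"
    using LIMSEQ_subseq_LIMSEQ[OF a_lim s] by (simp add: o_def)
  \<comment> \<open>A reference point so far from \<open>L\<close> that the decay estimate gives
    \<open>norm (us n z1) \<le> 2 / 9\<close> for all \<open>n\<close>; this excludes a unimodular
    constant as limit.\<close>
  define z1 :: complex where "z1 = of_real (10 * B)"
  have z1: "z1 \<in> - L" using B(2)[of z1] B(1) by (auto simp: z1_def)
  have far: "norm (z1 - a n) \<ge> 9 * B" for n
    using norm_triangle_ineq2[of z1 "a n"] B(1) B(2)[of "a n"] a_in[of n] Ls(4)[of "r0 n"] by (force simp: z1_def)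
  have "norm (us n z1) \<le> 1 / 2" for n
  proof -
    have "norm (us n z1) \<le> 2 * B / norm (z1 - a n)"
      using dec[of n] far[of n] B(1) unfolding decay_def by auto
    also have "\<dots> \<le> 2 * B / (9 * B)"
      using far[of n] B(1) by (intro divide_left_mono mult_pos_pos) auto
    also have "\<dots> \<le> 1 / 2" using B(1) by simp
    finally show ?thesis .
  qed
  then have uz1: "norm (u z1) \<le> 1 / 2"
    by (intro LIMSEQ_le_const2[OF tendsto_norm[OF upt'[OF z1]]]) auto
  have u1: "norm (u z) \<le> 1" if "z \<in> - L" for z
    using D(6)[OF notL] that by (intro LIMSEQ_le_const2[OF tendsto_norm[OF upt'[OF that]]]) (auto intro: less_imp_le)
  have ulb: "norm (u z) < 1" if z: "z \<in> - L" for z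
  proof (rule ccontr)
    assume "\<not> norm (u z) < 1"
    then have "norm (u z) = 1" using u1[OF z] by simp
    then have "u constant_on - L"
      using u1 z by (intro maximum_modulus_principle[OF u opL L(3) opL subset_refl z]) auto
    then have "u z = u z1" using z z1 by (auto simp: constant_on_def)
    then show False using \<open>norm (u z) = 1\<close> uz1 by simp
  qed
  have pL: "p \<in> L" by (rule frontier_in_L[OF pq(1)])
  have gu: "g (u z) = inverse (z - p)" if z: "z \<in> - L" for z
  proof -
    define t where "t = (1 + norm (u z)) / 2"
    have t: "norm (u z) < t" "t < 1" using ulb[OF z] by (auto simp: t_def)
    have sub: "cball 0 t \<subseteq> ball (0::complex) 1" using t(2) by auto
    have "(\<lambda>n. gs (s n) (us (s n) z)) \<longlonglongrightarrow> g (u z)"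
    proof (rule tendsto_uniform_limit_compose[where K = "cball 0 t" and gs = "\<lambda>n. gs (s n)" and g = g
          and x = "\<lambda>n. us (s n) z" and l = "u z"])
      show "uniform_limit (cball 0 t) (\<lambda>n. gs (s n)) g sequentially"
        using gunif[OF compact_cball sub] by (simp add: s_def)
      show "continuous_on (cball 0 t) g"
        using continuous_on_subset[OF holomorphic_on_imp_continuous_on[OF g] sub] .
      show "(\<lambda>n. us (s n) z) \<longlonglongrightarrow> u z" by (rule upt'[OF z])
      show "\<forall>\<^sub>F n in sequentially. us (s n) z \<in> cball 0 t"
        using order_tendstoD(2)[OF tendsto_norm[OF upt'[OF z]] t(1)] by eventually_elim simp
      show "u z \<in> cball 0 t" using t(1) by simp
    qed
    moreover have "gs (s n) (us (s n) z) = inverse (z - a (s n))" for n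
      using D(7)[OF notL] z by simp
    ultimately have "(\<lambda>n. inverse (z - a (s n))) \<longlonglongrightarrow> g (u z)" by simp
    moreover have "(\<lambda>n. inverse (z - a (s n))) \<longlonglongrightarrow> inverse (z - p)"
      using z pL by (intro tendsto_intros a_lim') auto
    ultimately show ?thesis by (rule LIMSEQ_unique)
  qed
  have g0: "g 0 = 0"
    using gpt[of 0] D(4) by (simp add: LIMSEQ_const_iff)
  have nonconst: "\<not> g constant_on ball 0 1"
  proof
    assume "g constant_on ball 0 1"
    then have "g (u z1) = g 0" using ulb[OF z1] by (auto simp: constant_on_def)
    then show False using gu[OF z1] g0 z1 pL by auto
  qed
  have ginj: "inj_on g (ball 0 1)"
    by (rule Hurwitz_injective[OF open_ball connected_ball D(2) g gunif nonconst D(3)])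
  \<comment> \<open>If the limit map hit \<open>L\<close>, its connected image would contain a
    boundary point \<open>z0\<close> of \<open>L\<close>. Points \<open>y n\<close> of the continua
    tend to \<open>z0\<close>, and \<open>gs\<close> omits the values belonging to them; by
    Hurwitz's theorem the limit omits the value belonging to \<open>z0\<close>, a
    contradiction.\<close>
  have gout: "p + inverse (g \<zeta>) \<notin> L" if \<zeta>: "norm \<zeta> < 1" "\<zeta> \<noteq> 0" for \<zeta>
  proof
    assume inL: "p + inverse (g \<zeta>) \<in> L"
    have gnz: "g \<xi> \<noteq> 0" if "\<xi> \<in> ball 0 1 - {0}" for \<xi>
      using inj_onD[OF ginj, of \<xi> 0] g0 that by auto
    let ?G = "(\<lambda>\<xi>. p + inverse (g \<xi>)) ` (ball 0 1 - {0})"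
    have "connected ?G"
      using gnz by (intro connected_continuous_image connected_open_delete continuous_intros
          continuous_on_subset[OF holomorphic_on_imp_continuous_on[OF g]]) auto
    moreover have "?G \<inter> L \<noteq> {}"
    proof -
      have "p + inverse (g \<zeta>) \<in> ?G"
        using imageI[of \<zeta> "ball 0 1 - {0}" "\<lambda>\<xi>. p + inverse (g \<xi>)"] \<zeta> by simp
      then have "p + inverse (g \<zeta>) \<in> ?G \<inter> L" using inL by (rule IntI)
      then show ?thesis by (metis empty_iff)
    qed
    moreover have "?G - L \<noteq> {}"
    proof -
      have "u z1 \<noteq> 0" using gu[OF z1] g0 z1 pL by auto
      moreover have "p + inverse (g (u z1)) = z1" using gu[OF z1] by simp
      ultimately have "z1 \<in> ?G"
        using imageI[of "u z1" "ball 0 1 - {0}" "\<lambda>\<xi>. p + inverse (g \<xi>)"] ulb[OF z1] by simp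
      then have "z1 \<in> ?G - L" using z1 by (simp only: Diff_iff Compl_iff) simp
      then show ?thesis by (metis empty_iff)
    qed
    ultimately have "?G \<inter> frontier L \<noteq> {}" by (rule connected_Int_frontier)
    then obtain v where v: "v \<in> ?G" "v \<in> frontier L" by (metis disjoint_iff)
    from v(1) obtain \<xi> where "v = p + inverse (g \<xi>)" "\<xi> \<in> ball 0 1 - {0}" by (rule imageE)
    with v(2) have \<xi>: "\<xi> \<in> ball 0 1 - {0}" "p + inverse (g \<xi>) \<in> frontier L" by simp_all
    define z0 where "z0 = p + inverse (g \<xi>)"
    have "z0 \<noteq> p" using gnz[OF \<xi>(1)] by (simp add: z0_def)
    define y where "y n = closest_point (Ls (r0 (s n))) z0" for n
    have y_in: "y n \<in> Ls (r0 (s n))" for n by (simp add: y_def closest_point_in_Ls)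
    have "strict_mono (\<lambda>n. r0 (s n))" using r by (simp add: r_def s_def o_def)
    then have y_lim: "y \<longlonglongrightarrow> z0"
      unfolding y_def using LIMSEQ_subseq_LIMSEQ[OF closest_point_tendsto, of z0 "\<lambda>n. r0 (s n)"] \<xi>(2)
      by (simp add: o_def z0_def)
    have w_lim: "(\<lambda>n. inverse (y n - a (s n))) \<longlonglongrightarrow> inverse (z0 - p)"
      using \<open>z0 \<noteq> p\<close> by (intro tendsto_intros y_lim a_lim') auto
    have gx: "g \<xi> = inverse (z0 - p)" by (simp add: z0_def)
    have "(\<lambda>n. y n - a (s n)) \<longlonglongrightarrow> z0 - p" by (intro tendsto_diff y_lim a_lim')
    then have "\<forall>\<^sub>F n in sequentially. y n - a (s n) \<noteq> 0"
      using \<open>z0 \<noteq> p\<close> by (intro tendsto_imp_eventually_ne) auto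
    \<comment> \<open>The shift by \<open>N'\<close> ensures that the omitted value is never
      \<open>inverse 0 = 0\<close>, which \<open>gs\<close> does take at the origin.\<close>
    then obtain N' where N': "\<And>n. n \<ge> N' \<Longrightarrow> y n \<noteq> a (s n)" by (auto simp: eventually_sequentially)
    define F where "F n \<zeta> = gs (s (n + N')) \<zeta> - inverse (y (n + N') - a (s (n + N')))" for n \<zeta>
    have shift: "filterlim (\<lambda>n. n + N') sequentially sequentially"
      by (rule filterlim_add_const_nat_at_top)
    have "g \<xi> - inverse (z0 - p) \<noteq> 0"
    proof (rule Hurwitz_no_zeros[OF open_ball connected_ball, of F 0 1 "\<lambda>\<zeta>. g \<zeta> - inverse (z0 - p)" \<xi>])
      show "F n holomorphic_on ball 0 1" for n
        unfolding F_def by (intro holomorphic_intros D(2))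
      show "(\<lambda>\<zeta>. g \<zeta> - inverse (z0 - p)) holomorphic_on ball 0 1"
        by (intro holomorphic_intros g)
      show "uniform_limit K F (\<lambda>\<zeta>. g \<zeta> - inverse (z0 - p)) sequentially" if "compact K" "K \<subseteq> ball 0 1" for K
        unfolding F_def
      proof (rule uniform_limit_minus)
        show "uniform_limit K (\<lambda>n. gs (s (n + N'))) g sequentially"
          using filterlim_compose[OF gunif[OF that] shift] by (simp add: s_def)
        have "(\<lambda>n. inverse (y (n + N') - a (s (n + N')))) \<longlonglongrightarrow> inverse (z0 - p)"
          using filterlim_compose[OF w_lim shift] .
        then show "uniform_limit K (\<lambda>n x. inverse (y (n + N') - a (s (n + N')))) (\<lambda>x. inverse (z0 - p)) sequentially"
          by (auto simp: uniform_limit_iff tendsto_iff elim: eventually_mono)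
      qed
      show "\<not> (\<lambda>\<zeta>. g \<zeta> - inverse (z0 - p)) constant_on ball 0 1"
      proof
        assume "(\<lambda>\<zeta>. g \<zeta> - inverse (z0 - p)) constant_on ball 0 1"
        then obtain k where "\<And>\<zeta>. \<zeta> \<in> ball 0 1 \<Longrightarrow> g \<zeta> - inverse (z0 - p) = k" by (auto simp: constant_on_def)
        then have "\<And>\<zeta>. \<zeta> \<in> ball 0 1 \<Longrightarrow> g \<zeta> = k + inverse (z0 - p)" by (simp add: diff_eq_eq)
        then show False using nonconst unfolding constant_on_def by blast
      qed
      show "F n \<zeta> \<noteq> 0" if "\<zeta> \<in> ball 0 1" for n \<zeta>
      proof
        assume "F n \<zeta> = 0"
        then have eq: "gs (s (n + N')) \<zeta> = inverse (y (n + N') - a (s (n + N')))" by (simp add: F_def)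
        then have "\<zeta> \<noteq> 0" using D(4) N'[of "n + N'"] by auto
        then have "a (s (n + N')) + inverse (gs (s (n + N')) \<zeta>) \<notin> Ls (r0 (s (n + N')))"
          using that by (intro D(8)) auto
        then show False using y_in[of "n + N'"] eq by simp
      qed
    qed (use \<xi> in auto)
    then show False using gx by simp
  qed
  show thesis
  proof (rule that[OF r])
    show "exterior_map L p g u"
      unfolding exterior_map_def using pL g ginj g0 u ulb gu gout by auto
    show "exterior_map (Ls (r n)) (a (s n)) (gs (s n)) (us (s n))" for n
      using e[of "s n"] by (simp add: r_def s_def)
    show "uniform_limit K (\<lambda>n. us (s n)) u sequentially" if "compact K" "K \<subseteq> - L" for K
      by (rule uunif'[OF that])
  qed
qed

end

section \<open>Splitting along an annulus\<close>

text \<open>After removal of the pole at \<open>\<zeta>\<close> the two circles, being homotopic in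
  \<open>U\<close>, give equal integrals; the outer circle has winding number 1 about
  \<open>\<zeta>\<close> and the inner one 0.\<close>

lemma annulus_Cauchy_formula:
  assumes U: "open U" and X: "X holomorphic_on U" and sub: "cball 0 t - ball 0 s \<subseteq> U"
    and \<zeta>: "0 < s" "s < norm \<zeta>" "norm \<zeta> < t"
  shows "contour_integral (circlepath 0 t) (\<lambda>\<xi>. X \<xi> / (\<xi> - \<zeta>)) -
      contour_integral (circlepath 0 s) (\<lambda>\<xi>. X \<xi> / (\<xi> - \<zeta>)) = 2 * of_real pi * \<i> * X \<zeta>"
proof -
  define Y where "Y \<xi> = (if \<xi> = \<zeta> then deriv X \<zeta> else (X \<xi> - X \<zeta>) / (\<xi> - \<zeta>))" for \<xi>
  have Y: "Y holomorphic_on U" unfolding Y_def by (rule pole_lemma_open[OF X U])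
  have im: "path_image (circlepath 0 \<rho>) = sphere 0 \<rho>" if "\<rho> > 0" for \<rho> :: real
    using that by simp
  have sphU: "sphere 0 \<rho> \<subseteq> U" if "s \<le> \<rho>" "\<rho> \<le> t" for \<rho>
    using sub that by auto
  have "homotopic_loops U (circlepath 0 t) (circlepath 0 s)"
  proof (rule homotopic_loops_linear)
    fix \<tau> :: real assume "\<tau> \<in> {0..1}"
    show "closed_segment (circlepath 0 t \<tau>) (circlepath 0 s \<tau>) \<subseteq> U"
    proof
      fix y assume "y \<in> closed_segment (circlepath 0 t \<tau>) (circlepath 0 s \<tau>)"
      then obtain v where v: "0 \<le> v" "v \<le> 1"
        "y = (1 - v) *\<^sub>R circlepath 0 t \<tau> + v *\<^sub>R circlepath 0 s \<tau>"
        by (auto simp: closed_segment_def)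
      define k where "k = (1 - v) * t + v * s"
      have ks: "s \<le> k" "k \<le> t"
      proof -
        have "(1 - v) * s \<le> (1 - v) * t" "v * s \<le> v * t"
          using v \<zeta> by (auto intro!: mult_left_mono)
        then show "s \<le> k" "k \<le> t" unfolding k_def by (auto simp: algebra_simps)
      qed
      have "y = of_real k * exp (2 * of_real pi * \<i> * of_real \<tau>)"
        using v(3) by (simp add: circlepath k_def scaleR_conv_of_real algebra_simps)
      then have "norm y = k" using ks \<zeta>(1) by (simp add: norm_mult norm_exp_eq_Re)
      then show "y \<in> U" using sphU[OF ks] by auto
    qed
  qed (auto simp: valid_path_imp_path)
  then have hom: "contour_integral (circlepath 0 t) Y = contour_integral (circlepath 0 s) Y"
    by (rule Cauchy_theorem_homotopic_loops[OF _ U Y]) auto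
  have eq: "contour_integral (circlepath 0 \<rho>) Y = contour_integral (circlepath 0 \<rho>) (\<lambda>\<xi>. X \<xi> / (\<xi> - \<zeta>))
      - X \<zeta> * (2 * of_real pi * \<i> * winding_number (circlepath 0 \<rho>) \<zeta>)"
    if \<rho>: "s \<le> \<rho>" "\<rho> \<le> t" "norm \<zeta> \<noteq> \<rho>" for \<rho>
  proof -
    have "\<rho> > 0" using \<rho>(1) \<zeta>(1) by simp
    have pU: "path_image (circlepath 0 \<rho>) \<subseteq> U - {\<zeta>}"
      using sphU[OF \<rho>(1,2)] \<rho>(3) \<open>\<rho> > 0\<close> by auto
    have h: "(\<lambda>\<xi>. X \<xi> / (\<xi> - \<zeta>)) holomorphic_on U - {\<zeta>}" "(\<lambda>\<xi>. X \<zeta> * (1 / (\<xi> - \<zeta>))) holomorphic_on U - {\<zeta>}"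
      "(\<lambda>\<xi>. 1 / (\<xi> - \<zeta>)) holomorphic_on U - {\<zeta>}"
      by (intro holomorphic_intros holomorphic_on_subset[OF X]; auto)+
    note int = contour_integrable_holomorphic_simple[OF _ open_delete[OF U] valid_path_circlepath pU]
    have "contour_integral (circlepath 0 \<rho>) Y
        = contour_integral (circlepath 0 \<rho>) (\<lambda>\<xi>. X \<xi> / (\<xi> - \<zeta>) - X \<zeta> * (1 / (\<xi> - \<zeta>)))"
      by (rule contour_integral_cong) (use pU in \<open>auto simp: Y_def diff_divide_distrib\<close>)
    also have "\<dots> = contour_integral (circlepath 0 \<rho>) (\<lambda>\<xi>. X \<xi> / (\<xi> - \<zeta>))
        - contour_integral (circlepath 0 \<rho>) (\<lambda>\<xi>. X \<zeta> * (1 / (\<xi> - \<zeta>)))"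
      by (rule contour_integral_diff[OF int[OF h(1)] int[OF h(2)]])
    also have "contour_integral (circlepath 0 \<rho>) (\<lambda>\<xi>. X \<zeta> * (1 / (\<xi> - \<zeta>)))
        = X \<zeta> * contour_integral (circlepath 0 \<rho>) (\<lambda>\<xi>. 1 / (\<xi> - \<zeta>))"
      by (rule contour_integral_lmul[OF int[OF h(3)]])
    also have "contour_integral (circlepath 0 \<rho>) (\<lambda>\<xi>. 1 / (\<xi> - \<zeta>))
        = 2 * of_real pi * \<i> * winding_number (circlepath 0 \<rho>) \<zeta>"
      by (rule winding_number_contour_integral) (use pU in auto)
    finally show ?thesis .
  qed
  have "winding_number (circlepath 0 t) \<zeta> = 1"
    by (rule winding_number_circlepath) (use \<zeta> in simp)
  moreover have "winding_number (circlepath 0 s) \<zeta> = 0"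
  proof (rule winding_number_zero_outside)
    show "path_image (circlepath 0 s) \<subseteq> cball 0 s" using \<zeta>(1) by auto
    show "\<zeta> \<notin> cball 0 s" using \<zeta>(2) by simp
  qed (auto simp: valid_path_imp_path)
  ultimately show ?thesis
    using hom eq[of t] eq[of s] \<zeta> by (simp add: algebra_simps)
qed

lemma Cauchy_type_integral_holomorphic:
  assumes \<gamma>: "valid_path \<gamma>" and vd: "continuous_on {0..1} (\<lambda>t. vector_derivative \<gamma> (at t))"
    and d: "continuous_on (path_image \<gamma>) d"
  shows "(\<lambda>z. contour_integral \<gamma> (\<lambda>w. d w / (w - z))) holomorphic_on - path_image \<gamma>"
proof -
  have op: "open (- path_image \<gamma>)"
    using closed_valid_path_image[OF \<gamma>] by (simp add: open_Compl)
  have "bounded ((\<lambda>t. vector_derivative \<gamma> (at t)) ` {0..1})"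
    by (intro compact_imp_bounded compact_continuous_image vd compact_Icc)
  then obtain B where "\<forall>t\<in>{0..1}. norm (vector_derivative \<gamma> (at t)) \<le> B"
    unfolding bounded_iff ball_simps by blast
  note B = this[rule_format]
  have int: "((\<lambda>w. d w / (w - z) ^ 1) has_contour_integral contour_integral \<gamma> (\<lambda>w. d w / (w - z))) \<gamma>"
    if z: "z \<in> UNIV - path_image \<gamma>" for z
  proof -
    have "(\<lambda>w. d w / (w - z)) contour_integrable_on \<gamma>"
      unfolding contour_integrable_on
    proof (rule integrable_continuous_real)
      have "continuous_on {0..1} \<gamma>"
        using valid_path_imp_path[OF \<gamma>] by (simp add: path_def)
      note \<gamma>c = this
      have "continuous_on {0..1} (\<lambda>t. d (\<gamma> t))"
        by (rule continuous_on_compose2[OF d \<gamma>c]) (auto simp: path_image_def)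
      moreover have "continuous_on {0..1} (\<lambda>t. \<gamma> t - z)"
        by (rule continuous_on_diff[OF \<gamma>c continuous_on_const])
      moreover have "\<forall>t\<in>{0..1}. \<gamma> t - z \<noteq> 0" using z by (auto simp: path_image_def)
      ultimately have "continuous_on {0..1} (\<lambda>t. d (\<gamma> t) / (\<gamma> t - z))"
        by (rule continuous_on_divide)
      then show "continuous_on {0..1} (\<lambda>t. d (\<gamma> t) / (\<gamma> t - z) * vector_derivative \<gamma> (at t))"
        by (rule continuous_on_mult[OF _ vd])
    qed
    then show ?thesis by (simp add: has_contour_integral_integral)
  qed
  have "(\<lambda>z. contour_integral \<gamma> (\<lambda>w. d w / (w - z))) field_differentiable at z" if "z \<in> - path_image \<gamma>" for z
    using Cauchy_next_derivative(2)[OF d B int one_neq_zero open_UNIV \<gamma>, of z] that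
    unfolding field_differentiable_def by auto
  then show ?thesis
    by (auto simp: holomorphic_on_def field_differentiable_at_within)
qed

text \<open>Cauchy's estimate with radius \<open>r\<close>, available at every point of the smaller
  ball, bounds the derivative by \<open>1 / r\<close>.\<close>

lemma bounded_holomorphic_Lipschitz:
  assumes "f holomorphic_on ball w (2 * r)" "\<And>z. z \<in> ball w (2 * r) \<Longrightarrow> norm (f z) \<le> 1"
    and r: "r > 0" and v: "v \<in> ball w r"
  shows "norm (f v - f w) \<le> norm (v - w) / r"
proof -
  have der: "norm (deriv f \<xi>) \<le> 1 / r" if \<xi>: "\<xi> \<in> ball w r" for \<xi>
  proof -
    have sub: "cball \<xi> r \<subseteq> ball w (2 * r)"
    proof
      fix y assume "y \<in> cball \<xi> r"
      then show "y \<in> ball w (2 * r)"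
        using \<xi> dist_triangle[of w y \<xi>] by simp
    qed
    have "norm ((deriv ^^ 1) f \<xi>) \<le> fact 1 * 1 / r ^ 1"
    proof (rule Cauchy_inequality)
      show "f holomorphic_on ball \<xi> r"
        by (rule holomorphic_on_subset[OF assms(1)]) (use sub ball_subset_cball in blast)
      show "continuous_on (cball \<xi> r) f"
        by (rule holomorphic_on_imp_continuous_on[OF holomorphic_on_subset[OF assms(1) sub]])
      show "norm (f x) \<le> 1" if "norm (\<xi> - x) = r" for x
        using that sub by (intro assms(2)) (auto simp: dist_norm subset_iff)
    qed (rule r)
    then show ?thesis by simp
  qed
  have "norm (f v - f w) \<le> (1 / r) * norm (v - w)"
  proof (rule field_differentiable_bound[of "ball w r" f "deriv f"])
    show "(f has_field_derivative deriv f z) (at z within ball w r)" if "z \<in> ball w r" for z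
    proof (rule has_field_derivative_at_within, rule holomorphic_derivI[OF assms(1) open_ball])
      show "z \<in> ball w (2 * r)" using that r by auto
    qed
  qed (use der r v in auto)
  then show ?thesis by simp
qed

section \<open>Level sets of exterior maps\<close>

text \<open>By the open mapping theorem \<open>g\<close> maps a small disc onto a neighbourhood of
  0, so the sublevel set contains a neighbourhood of infinity.\<close>

lemma exterior_map_bounded:
  assumes e: "exterior_map K a g u" and K: "bounded K" and "\<tau> > 0"
  shows "bounded (- {z. z \<notin> K \<and> norm (u z) < \<tau>})"
proof -
  note D = exterior_mapD[OF e]
  define \<tau>' where "\<tau>' = min \<tau> 1"
  have \<tau>': "0 < \<tau>'" "\<tau>' \<le> 1" "\<tau>' \<le> \<tau>" using \<open>\<tau> > 0\<close> by (auto simp: \<tau>'_def)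
  have sub: "ball 0 \<tau>' \<subseteq> ball (0::complex) 1" using \<tau>' by auto
  have "open (g ` ball 0 \<tau>')"
    by (rule open_mapping_thm3[OF holomorphic_on_subset[OF D(2) sub] open_ball inj_on_subset[OF D(3) sub]])
  moreover have "0 \<in> g ` ball 0 \<tau>'" using D(4) \<tau>'(1) by (intro image_eqI[of _ _ 0]) auto
  ultimately obtain c where c: "c > 0" "ball 0 c \<subseteq> g ` ball 0 \<tau>'"
    by (meson openE)
  have far: "norm (z - a) \<le> 1 / c" if z: "z \<notin> K" "norm (u z) \<ge> \<tau>" for z
  proof (rule ccontr)
    assume "\<not> norm (z - a) \<le> 1 / c"
    then have "norm (z - a) > 1 / c" by simp
    moreover from this have "norm (z - a) > 0" using c(1) by (meson divide_pos_pos less_trans zero_less_one)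
    ultimately have "inverse (norm (z - a)) < c"
      using c(1) by (simp add: field_simps)
    then have "norm (inverse (z - a)) < c" by (simp only: norm_inverse)
    then have "g (u z) \<in> ball 0 c" using D(7)[OF z(1)] by simp
    then obtain \<xi> where \<xi>: "g (u z) = g \<xi>" "\<xi> \<in> ball 0 \<tau>'" using c(2) by blast
    then have "u z = \<xi>" using inj_onD[OF D(3) \<xi>(1)] D(6)[OF z(1)] sub by auto
    then show False using \<xi>(2) z(2) \<tau>'(3) by simp
  qed
  have "- {z. z \<notin> K \<and> norm (u z) < \<tau>} \<subseteq> K \<union> cball a (1 / c)"
  proof
    fix x assume "x \<in> - {z. z \<notin> K \<and> norm (u z) < \<tau>}"
    then have "x \<in> K \<or> x \<notin> K \<and> norm (u x) \<ge> \<tau>" by auto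
    then show "x \<in> K \<union> cball a (1 / c)"
      using far[of x] by (auto simp: dist_norm norm_minus_commute)
  qed
  moreover have "bounded (K \<union> cball a (1 / c))" using K by simp
  ultimately show ?thesis by (rule bounded_subset[rotated])
qed

lemma exterior_map_open_sublevel:
  assumes "exterior_map K a g u" "closed K"
  shows "open {z. z \<notin> K \<and> norm (u z) < \<tau>}"
proof -
  have "open ((- K) \<inter> u -` ball 0 \<tau>)"
    by (intro continuous_open_preimage holomorphic_on_imp_continuous_on exterior_mapD(5)[OF assms(1)])
       (use assms(2) in auto)
  moreover have "(- K) \<inter> u -` ball 0 \<tau> = {z. z \<notin> K \<and> norm (u z) < \<tau>}" by auto
  ultimately show ?thesis by simp
qed

text \<open>Minimum principle for \<open>\<bar>u'\<bar>\<close> on the part of the complement of \<open>N\<close> enclosed by the level curve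
  \<open>\<bar>u\<bar> = s\<close>: since \<open>u'\<close> is injective and has no zeros, \<open>\<bar>u'\<bar>\<close> has no local minimum.\<close>

lemma exterior_map_lower_bound:
  assumes e: "exterior_map L b g u" and e': "exterior_map N a g' u'" and NL: "N \<subseteq> L"
    and L: "compact L" and N: "compact N" and s: "0 < s" "s < 1" and \<rho>: "\<rho> < 1"
    and curve: "\<And>z. z \<notin> L \<Longrightarrow> norm (u z) = s \<Longrightarrow> norm (u' z) > \<rho>"
    and z: "z \<notin> N" "z \<in> L \<or> norm (u z) \<ge> s"
  shows "norm (u' z) > \<rho>"
proof (rule ccontr)
  assume neg: "\<not> norm (u' z) > \<rho>"
  have clL: "closed L" and clN: "closed N" using L N by (auto simp: compact_imp_closed)
  \<comment> \<open>If the claim fails, this compact region contains a point at which the modulus of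
    \<open>u'\<close> is minimal.\<close>
  define B where "B = {z. z \<notin> N \<and> norm (u' z) \<le> \<rho>} \<inter> - {z. z \<notin> L \<and> norm (u z) < s}"
  have zB: "z \<in> B" using neg z by (auto simp: B_def)
  have "bounded B"
    using exterior_map_bounded[OF e compact_imp_bounded[OF L] s(1)] by (rule bounded_subset) (auto simp: B_def)
  moreover have "closed B"
    unfolding B_def by (intro closed_Int exterior_map_closed_sublevel[OF e' \<rho>] closed_Compl
        exterior_map_open_sublevel[OF e clL])
  ultimately have "compact B" by (simp add: compact_eq_bounded_closed)
  moreover have "continuous_on B (\<lambda>z. norm (u' z))"
    by (intro continuous_on_norm continuous_on_subset[OF holomorphic_on_imp_continuous_on[OF exterior_mapD(5)[OF e']]])
       (auto simp: B_def)
  ultimately obtain y where y: "y \<in> B" "\<And>x. x \<in> B \<Longrightarrow> norm (u' y) \<le> norm (u' x)"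
    using continuous_attains_inf[of B "\<lambda>z. norm (u' z)"] zB by auto
  define W where "W = - N \<inter> - {z. z \<notin> L \<and> norm (u z) \<le> s}"
  have opW: "open W"
    unfolding W_def using clN exterior_map_closed_sublevel[OF e s(2)] by (intro open_Int open_Compl)
  \<comment> \<open>On the level curve the modulus of \<open>u'\<close> exceeds
    \<open>\<rho>\<close>, so the minimum is taken at an interior point.\<close>
  have "y \<in> W"
    using y(1) curve[of y] by (force simp: B_def W_def)
  have "open (u' ` W)"
  proof (rule open_mapping_thm3[OF _ opW])
    show "u' holomorphic_on W"
      by (rule holomorphic_on_subset[OF exterior_mapD(5)[OF e']]) (auto simp: W_def)
    show "inj_on u' W"
      by (rule inj_on_subset[OF exterior_map_nonzero(5)[OF e']]) (auto simp: W_def)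
  qed
  then obtain \<epsilon> where \<epsilon>: "\<epsilon> > 0" "ball (u' y) \<epsilon> \<subseteq> u' ` W"
    using \<open>y \<in> W\<close> by (meson imageI openE)
  have uy: "norm (u' y) > 0" using exterior_map_nonzero(1)[OF e', of y] y(1) by (auto simp: B_def)
  define \<tau> where "\<tau> = min 1 (\<epsilon> / norm (u' y)) / 2"
  have \<tau>: "0 < \<tau>" "\<tau> < 1" "\<tau> * norm (u' y) < \<epsilon>"
  proof -
    show "0 < \<tau>" "\<tau> < 1" using \<epsilon>(1) uy by (auto simp: \<tau>_def)
    have "0 < min 1 (\<epsilon> / norm (u' y))" using \<epsilon>(1) uy by simp
    moreover have "x / 2 < x" if "0 < x" for x :: real using that by simp
    ultimately have "\<tau> < min 1 (\<epsilon> / norm (u' y))" unfolding \<tau>_def by blast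
    then have "\<tau> < \<epsilon> / norm (u' y)" by (rule less_le_trans[OF _ min.cobounded2])
    then show "\<tau> * norm (u' y) < \<epsilon>" using uy by (simp add: pos_less_divide_eq)
  qed
  have "u' y - of_real (1 - \<tau>) * u' y = of_real \<tau> * u' y" by (simp add: algebra_simps)
  then have "of_real (1 - \<tau>) * u' y \<in> ball (u' y) \<epsilon>"
    using \<tau> by (simp add: dist_norm norm_mult)
  then obtain x where x: "x \<in> W" "u' x = of_real (1 - \<tau>) * u' y" using \<epsilon>(2) by (metis imageE subsetD)
  have "norm (u' x) = (1 - \<tau>) * norm (u' y)" using x(2) \<tau> by (simp add: norm_mult del: of_real_diff)
  also have "\<dots> < norm (u' y)" using \<tau>(1) uy by simp
  finally have less: "norm (u' x) < norm (u' y)" .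
  moreover have "norm (u' y) \<le> \<rho>" using y(1) by (simp add: B_def)
  ultimately have "x \<in> B" using x(1) by (auto simp: B_def W_def)
  then show False using y(2)[of x] less by simp
qed

text \<open>One step of the approximation: \<open>f\<close> is kept away from the continuum and replaced by
  \<open>f \<circ> G \<circ> u'\<close> near it; the two functions nearly agree on an annulus, and the small difference
  \<open>d\<close> is split there by Cauchy integrals.\<close>

lemma glue_step:
  assumes e: "exterior_map L b g u" and e': "exterior_map N a g' u'" and NL: "N \<subseteq> L"
    and L: "compact L" and N: "compact N" and M: "compact M" "M \<inter> L = {}"
    and rad: "0 < \<rho>" "\<rho> < s'" "s' < s" "s < m" "m < t" "t < 1"
    and M\<rho>: "\<And>z. z \<in> M \<Longrightarrow> norm (u z) \<le> \<rho>"
    and curve: "\<And>z. z \<notin> L \<Longrightarrow> norm (u z) = s' \<Longrightarrow> norm (u' z) > \<rho>"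
    and K: "\<And>\<zeta>. \<zeta> \<in> sphere 0 s \<union> sphere 0 t \<Longrightarrow> norm (deriv (\<lambda>\<zeta>. b + inverse (g \<zeta>)) \<zeta>) \<le> k" "k > 0"
    and \<delta>: "\<delta> > 0" "\<And>w z. w \<notin> L \<Longrightarrow> norm (u w) = t \<Longrightarrow> z \<notin> L \<Longrightarrow> norm (u z) \<le> m \<Longrightarrow> \<delta> \<le> dist w z"
      "\<And>w z. w \<notin> L \<Longrightarrow> norm (u w) = s \<Longrightarrow> z \<in> L \<or> norm (u z) \<ge> m \<Longrightarrow> \<delta> \<le> dist w z"
    and f: "f holomorphic_on - (L \<union> M)" "\<And>z. z \<in> - (L \<union> M) \<Longrightarrow> norm (f z) \<le> 1"
    and close: "\<And>w. w \<notin> L \<Longrightarrow> norm (u w) \<in> {s, t} \<Longrightarrow> norm (f (b + inverse (g (u' w))) - f w) \<le> \<epsilon>" "\<epsilon> > 0"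
    and lim: "(f \<longlongrightarrow> c) at_infinity" "((\<lambda>z. z * (f z - c)) \<longlongrightarrow> \<alpha>) at_infinity"
  obtains F \<alpha>' where "F holomorphic_on - (N \<union> M)" "\<And>z. z \<in> - (N \<union> M) \<Longrightarrow> norm (F z) \<le> 1 + k * \<epsilon> / \<delta>"
    "(F \<longlongrightarrow> c) at_infinity" "((\<lambda>z. z * (F z - c)) \<longlongrightarrow> \<alpha>') at_infinity" "norm (\<alpha>' - \<alpha>) \<le> k * \<epsilon>"
proof -
  note D = exterior_mapD[OF e] and E = exterior_map_nonzero[OF e]
  note D' = exterior_mapD[OF e'] and E' = exterior_map_nonzero[OF e']
  have clL: "closed L" and clN: "closed N" and clM: "closed M"
    using L N M by (auto simp: compact_imp_closed)
  define G where "G \<zeta> = b + inverse (g \<zeta>)" for \<zeta>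
  have G_out: "G \<zeta> \<notin> L" and uG: "u (G \<zeta>) = \<zeta>" if "norm \<zeta> < 1" "\<zeta> \<noteq> 0" for \<zeta>
    using D(8)[OF that] E(3)[OF that] by (simp_all add: G_def)
  have Gu: "G (u z) = z" if "z \<notin> L" for z using E(4)[OF that] by (simp add: G_def)
  have GM: "G \<zeta> \<notin> M" if "\<rho> < norm \<zeta>" "norm \<zeta> < 1" for \<zeta>
  proof
    assume "G \<zeta> \<in> M"
    moreover have "\<zeta> \<noteq> 0" using that(1) rad(1) by auto
    ultimately show False using M\<rho>[of "G \<zeta>"] uG[OF that(2)] that(1) by simp
  qed
  have G_hol: "G holomorphic_on ball 0 1 - {0}"
    unfolding G_def[abs_def]
    by (intro holomorphic_on_add holomorphic_on_const holomorphic_on_inverse holomorphic_on_subset[OF D(2)])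
       (use E(2) in auto)
  have G_inj: "inj_on G (ball 0 1 - {0})"
    by (rule inj_on_inverseI[of _ u]) (use uG in auto)
  have opP: "open (ball (0::complex) 1 - {0})" by (intro open_delete open_ball)
  \<comment> \<open>The set on which \<open>f \<circ> G \<circ> u'\<close> is formed. By the minimum
    principle the modulus of \<open>u'\<close> exceeds \<open>\<rho>\<close> there, so
    \<open>G (u' z)\<close> avoids \<open>M\<close>.\<close>
  define B' where "B' = - N \<inter> - {z. z \<notin> L \<and> norm (u z) \<le> s'}"
  have opB': "open B'"
    unfolding B'_def using clN exterior_map_closed_sublevel[OF e, of s'] rad by (intro open_Int open_Compl) auto
  have lower: "\<rho> < norm (u' z)" if "z \<in> B'" for z
    by (rule exterior_map_lower_bound[OF e e' NL L N _ _ _ curve]) (use that rad in \<open>auto simp: B'_def\<close>)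
  have Gu': "G (u' z) \<in> - (L \<union> M)" and u'P: "u' z \<in> ball 0 1 - {0}" if z: "z \<in> B'" for z
  proof -
    have "z \<notin> N" using z by (simp add: B'_def)
    then show "u' z \<in> ball 0 1 - {0}" using D'(6) E'(1) by auto
    then show "G (u' z) \<in> - (L \<union> M)"
      using G_out[of "u' z"] GM[OF lower[OF z]] by auto
  qed
  define H where "H z = f (G (u' z))" for z
  have H_hol: "H holomorphic_on B'"
  proof -
    have "u' holomorphic_on B'" by (rule holomorphic_on_subset[OF D'(5)]) (auto simp: B'_def)
    then have "G \<circ> u' holomorphic_on B'"
      by (rule holomorphic_on_compose_gen[OF _ G_hol]) (use u'P in auto)
    then have "f \<circ> (G \<circ> u') holomorphic_on B'"
      by (rule holomorphic_on_compose_gen[OF _ f(1)]) (use Gu' in auto)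
    then show ?thesis by (simp add: H_def[abs_def] o_def)
  qed
  define An where "An = ball (0::complex) 1 - cball 0 s'"
  have opAn: "open An" by (simp add: An_def open_Diff)
  have An_P: "An \<subseteq> ball 0 1 - {0}" using rad by (auto simp: An_def)
  have GAn: "G \<zeta> \<in> B'" "G \<zeta> \<in> - (L \<union> M)" if \<zeta>: "\<zeta> \<in> An" for \<zeta>
  proof -
    have n: "norm \<zeta> < 1" "\<zeta> \<noteq> 0" "s' < norm \<zeta>" "\<rho> < norm \<zeta>" using \<zeta> rad by (auto simp: An_def)
    show "G \<zeta> \<in> B'" using G_out[OF n(1,2)] uG[OF n(1,2)] n(3) NL by (auto simp: B'_def)
    show "G \<zeta> \<in> - (L \<union> M)" using G_out[OF n(1,2)] GM[OF n(4,1)] by simp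
  qed
  define d where "d w = H w - f w" for w
  have d_hol: "d holomorphic_on B' \<inter> - (L \<union> M)"
    unfolding d_def[abs_def]
    by (intro holomorphic_on_diff holomorphic_on_subset[OF H_hol] holomorphic_on_subset[OF f(1)]) auto
  have dG_hol: "(\<lambda>\<zeta>. d (G \<zeta>)) holomorphic_on An"
    by (rule holomorphic_on_compose_gen[OF holomorphic_on_subset[OF G_hol An_P] d_hol, unfolded o_def])
       (use GAn in auto)
  have sphAn: "sphere 0 \<tau> \<subseteq> An" if "s' < \<tau>" "\<tau> < 1" for \<tau>
    using that by (auto simp: An_def)
  \<comment> \<open>The level curve on which \<open>u\<close> has modulus \<open>\<tau>\<close>,
    parametrised by \<open>G\<close> so that integrals over it become integrals over
    circles.\<close>
  define \<gamma> where "\<gamma> \<tau> = G \<circ> circlepath 0 \<tau>" for \<tau>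
  have \<gamma>_im: "path_image (\<gamma> \<tau>) = G ` sphere 0 \<tau>" if "\<tau> > 0" for \<tau>
    using that by (simp add: \<gamma>_def path_image_compose)
  have aj: "analytic_jordan_curve (\<gamma> \<tau>)" if \<tau>: "0 < \<tau>" "\<tau> < 1" for \<tau>
    unfolding analytic_jordan_curve_def
  proof (intro exI conjI)
    let ?A = "ball 0 (1 / \<tau>) - {0 :: complex}"
    have A: "of_real \<tau> * \<zeta> \<in> ball 0 1 - {0}" if "\<zeta> \<in> ?A" for \<zeta>
      using that \<tau> by (auto simp: norm_mult field_simps)
    show "open ?A" by (intro open_delete open_ball)
    show "sphere 0 1 \<subseteq> ?A" using \<tau> by (auto simp: field_simps)
    show "G \<circ> (\<lambda>\<zeta>. of_real \<tau> * \<zeta>) holomorphic_on ?A"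
    proof (rule holomorphic_on_compose_gen[OF _ G_hol])
      show "(\<lambda>\<zeta>. of_real \<tau> * \<zeta>) holomorphic_on ?A" by (intro holomorphic_intros)
    qed (use A in auto)
    show "inj_on (G \<circ> (\<lambda>\<zeta>. of_real \<tau> * \<zeta>)) ?A"
    proof (rule inj_onI)
      fix x y assume xy: "x \<in> ?A" "y \<in> ?A" "(G \<circ> (\<lambda>\<zeta>. of_real \<tau> * \<zeta>)) x = (G \<circ> (\<lambda>\<zeta>. of_real \<tau> * \<zeta>)) y"
      then have "of_real \<tau> * x = of_real \<tau> * y"
        using inj_onD[OF G_inj, of "of_real \<tau> * x" "of_real \<tau> * y"] A by simp
      then show "x = y" using \<tau>(1) by simp
    qed
    show "\<gamma> \<tau> = (G \<circ> (\<lambda>\<zeta>. of_real \<tau> * \<zeta>)) \<circ> circlepath 0 1"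
      by (auto simp: \<gamma>_def circlepath)
  qed
  define I where "I \<tau> z = contour_integral (\<gamma> \<tau>) (\<lambda>w. d w / (w - z))" for \<tau> z
  have anG: "G analytic_on ball 0 1 - {0}"
    using G_hol opP by (simp add: analytic_on_open)
  have comp: "contour_integral (\<gamma> \<tau>) h = contour_integral (circlepath 0 \<tau>) (\<lambda>\<zeta>. deriv G \<zeta> * h (G \<zeta>))"
    if "0 < \<tau>" "\<tau> < 1" for \<tau> h
    unfolding \<gamma>_def by (rule contour_integral_comp_analyticW[OF anG valid_path_circlepath]) (use that in auto)
  have dG'_hol: "deriv G holomorphic_on An"
    by (rule holomorphic_on_subset[OF holomorphic_deriv[OF G_hol opP] An_P])
  have I_hol: "I \<tau> holomorphic_on - G ` sphere 0 \<tau>" if \<tau>: "s' < \<tau>" "\<tau> < 1" for \<tau>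
  proof -
    have "\<tau> > 0" using \<tau> rad by simp
    note sm = analytic_jordan_curve_smooth[OF aj[OF \<open>\<tau> > 0\<close> \<tau>(2)]]
    have "continuous_on (path_image (\<gamma> \<tau>)) d"
      unfolding \<gamma>_im[OF \<open>\<tau> > 0\<close>]
      by (rule continuous_on_subset[OF holomorphic_on_imp_continuous_on[OF d_hol]])
         (use GAn sphAn[OF \<tau>] in auto)
    from Cauchy_type_integral_holomorphic[OF sm(1,3) this] show ?thesis
      unfolding I_def[abs_def] \<gamma>_im[OF \<open>\<tau> > 0\<close>] .
  qed
  have bound: "norm (contour_integral (\<gamma> \<tau>) (\<lambda>w. d w * h w)) \<le> k * \<epsilon> * C * (2 * pi)"
    if \<tau>: "\<tau> \<in> {s, t}" and h: "continuous_on (G ` sphere 0 \<tau>) h" "\<And>w. w \<in> G ` sphere 0 \<tau> \<Longrightarrow> norm (h w) \<le> C" "0 \<le> C" for \<tau> h C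
  proof -
    have r: "0 < \<tau>" "\<tau> < 1" "s' < \<tau>" using \<tau> rad by auto
    have dG_c: "continuous_on (sphere 0 \<tau>) (\<lambda>\<zeta>. d (G \<zeta>))"
      by (rule continuous_on_subset[OF holomorphic_on_imp_continuous_on[OF dG_hol] sphAn[OF r(3,2)]])
    have G_c: "continuous_on (sphere 0 \<tau>) G"
      by (rule continuous_on_subset[OF holomorphic_on_imp_continuous_on[OF G_hol]]) (use sphAn[OF r(3,2)] An_P in blast)
    have G'_c: "continuous_on (sphere 0 \<tau>) (deriv G)"
      by (rule continuous_on_subset[OF holomorphic_on_imp_continuous_on[OF dG'_hol] sphAn[OF r(3,2)]])
    have h_c: "continuous_on (sphere 0 \<tau>) (\<lambda>\<zeta>. h (G \<zeta>))"
      by (rule continuous_on_compose2[OF h(1) G_c]) auto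
    have "continuous_on (path_image (circlepath 0 \<tau>)) (\<lambda>\<zeta>. deriv G \<zeta> * (d (G \<zeta>) * h (G \<zeta>)))"
      using r(1) continuous_on_mult[OF G'_c continuous_on_mult[OF dG_c h_c]] by simp
    then have "(\<lambda>\<zeta>. deriv G \<zeta> * (d (G \<zeta>) * h (G \<zeta>))) contour_integrable_on circlepath 0 \<tau>"
      by (rule contour_integrable_continuous_circlepath)
    then have hc: "((\<lambda>\<zeta>. deriv G \<zeta> * (d (G \<zeta>) * h (G \<zeta>))) has_contour_integral contour_integral (\<gamma> \<tau>) (\<lambda>w. d w * h w)) (circlepath 0 \<tau>)"
      unfolding comp[OF r(1,2)] by (rule has_contour_integral_integral)
    have "norm (contour_integral (\<gamma> \<tau>) (\<lambda>w. d w * h w)) \<le> (k * (\<epsilon> * C)) * (2 * pi * \<tau>)"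
    proof (rule has_contour_integral_bound_circlepath[OF hc])
      fix \<zeta> :: complex assume \<zeta>: "norm (\<zeta> - 0) = \<tau>"
      have n: "norm \<zeta> < 1" "\<zeta> \<noteq> 0" using \<zeta> r by auto
      have "norm (d (G \<zeta>)) \<le> \<epsilon>"
        using close(1)[OF G_out[OF n]] uG[OF n] \<zeta> \<tau> by (simp add: d_def H_def G_def)
      moreover have "norm (deriv G \<zeta>) \<le> k" using K(1)[of \<zeta>] \<zeta> \<tau> by (auto simp: G_def[abs_def])
      moreover have "norm (h (G \<zeta>)) \<le> C" using h(2)[of "G \<zeta>"] \<zeta> by auto
      ultimately show "norm (deriv G \<zeta> * (d (G \<zeta>) * h (G \<zeta>))) \<le> k * (\<epsilon> * C)"
        unfolding norm_mult using K(2) close(2) h(3) by (intro mult_mono mult_nonneg_nonneg) auto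
    qed (use r K(2) close(2) h(3) in auto)
    also have "\<dots> = (k * (\<epsilon> * C) * (2 * pi)) * \<tau>" by simp
    also have "\<dots> \<le> (k * (\<epsilon> * C) * (2 * pi)) * 1"
      using r K(2) close(2) h(3) by (intro mult_left_mono) auto
    finally show ?thesis by (simp add: mult.assoc)
  qed
  have I_bound: "norm (I \<tau> z / (2 * of_real pi * \<i>)) \<le> k * \<epsilon> / \<delta>"
    if \<tau>: "\<tau> \<in> {s, t}" and far: "\<And>w. w \<in> G ` sphere 0 \<tau> \<Longrightarrow> \<delta> \<le> dist w z" for \<tau> z
  proof -
    have far': "\<delta> \<le> norm (w - z)" if "w \<in> G ` sphere 0 \<tau>" for w using far[OF that] by (simp add: dist_norm)
    have "norm (contour_integral (\<gamma> \<tau>) (\<lambda>w. d w * (1 / (w - z)))) \<le> k * \<epsilon> * (1 / \<delta>) * (2 * pi)"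
    proof (rule bound[OF \<tau>])
      show "continuous_on (G ` sphere 0 \<tau>) (\<lambda>w. 1 / (w - z))"
        using far' \<delta>(1) by (intro continuous_intros) force
      show "norm (1 / (w - z)) \<le> 1 / \<delta>" if "w \<in> G ` sphere 0 \<tau>" for w
        using far'[OF that] \<delta>(1) unfolding norm_divide by (intro frac_le) auto
    qed (use \<delta>(1) in auto)
    then have "norm (I \<tau> z) \<le> (k * \<epsilon> / \<delta>) * (2 * pi)" by (simp add: I_def)
    then show ?thesis by (simp add: norm_divide norm_mult pos_divide_le_eq)
  qed
  have G_sph: "w \<notin> L \<and> norm (u w) = \<tau>" if "w \<in> G ` sphere 0 \<tau>" "0 < \<tau>" "\<tau> < 1" for w \<tau>
  proof -
    from that(1) obtain \<zeta> where "w = G \<zeta>" "\<zeta> \<in> sphere 0 \<tau>" by (rule imageE)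
    then show ?thesis using G_out[of \<zeta>] uG[of \<zeta>] that by auto
  qed
  \<comment> \<open>Pulled back by \<open>G\<close>, the Cauchy kernel is
    \<open>1 / (\<xi> - \<zeta>0)\<close> times the factor \<open>deriv G \<xi> / q \<xi>\<close>,
    which is holomorphic because \<open>q\<close> has no zeros and equals 1 at
    \<open>\<zeta>0\<close>. The formula for the annulus therefore returns
    \<open>d z\<close>.\<close>
  have jump: "I t z - I s z = 2 * of_real pi * \<i> * d z" if z: "z \<notin> L" "s < norm (u z)" "norm (u z) < t" for z
  proof -
    define \<zeta>0 where "\<zeta>0 = u z"
    have \<zeta>0: "s < norm \<zeta>0" "norm \<zeta>0 < t" "G \<zeta>0 = z" using z Gu by (auto simp: \<zeta>0_def)
    have \<zeta>0P: "\<zeta>0 \<in> ball 0 1 - {0}" using \<zeta>0 rad by auto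
    define q where "q \<xi> = (if \<xi> = \<zeta>0 then deriv G \<zeta>0 else (G \<xi> - G \<zeta>0) / (\<xi> - \<zeta>0))" for \<xi>
    have q: "q holomorphic_on ball 0 1 - {0}" unfolding q_def by (rule pole_lemma_open[OF G_hol opP])
    have qnz: "q \<xi> \<noteq> 0" if "\<xi> \<in> ball 0 1 - {0}" for \<xi>
      using holomorphic_injective_imp_regular[OF G_hol opP G_inj \<zeta>0P] inj_onD[OF G_inj, of \<xi> \<zeta>0] \<zeta>0P that
      by (auto simp: q_def)
    define X where "X \<xi> = deriv G \<xi> * d (G \<xi>) / q \<xi>" for \<xi>
    have X: "X holomorphic_on An"
      unfolding X_def[abs_def]
      by (intro holomorphic_on_divide holomorphic_on_mult dG'_hol dG_hol holomorphic_on_subset[OF q An_P] qnz)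
         (use An_P in auto)
    have "deriv G \<zeta>0 \<noteq> 0" by (rule holomorphic_injective_imp_regular[OF G_hol opP G_inj \<zeta>0P])
    then have X0: "X \<zeta>0 = d z" by (simp add: X_def q_def \<zeta>0(3))
    have I_eq: "I \<tau> z = contour_integral (circlepath 0 \<tau>) (\<lambda>\<xi>. X \<xi> / (\<xi> - \<zeta>0))"
      if \<tau>: "\<tau> \<in> {s, t}" for \<tau>
    proof -
      have r: "0 < \<tau>" "\<tau> < 1" using \<tau> rad by auto
      show ?thesis
        unfolding I_def comp[OF r]
      proof (rule contour_integral_cong)
        fix \<xi> assume "\<xi> \<in> path_image (circlepath 0 \<tau>)"
        then have \<xi>: "norm \<xi> = \<tau>" using r by simp
        then have "\<xi> \<noteq> \<zeta>0" using \<tau> \<zeta>0 by auto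
        moreover have "\<xi> \<in> ball 0 1 - {0}" using \<xi> r by auto
        ultimately have "G \<xi> - z \<noteq> 0" using inj_onD[OF G_inj, of \<xi> \<zeta>0] \<zeta>0P \<zeta>0(3) by auto
        then show "deriv G \<xi> * (d (G \<xi>) / (G \<xi> - z)) = X \<xi> / (\<xi> - \<zeta>0)"
          using \<open>\<xi> \<noteq> \<zeta>0\<close> by (simp add: X_def q_def \<zeta>0(3))
      qed simp
    qed
    have "cball 0 t - ball 0 s \<subseteq> An" using rad by (auto simp: An_def)
    from annulus_Cauchy_formula[OF opAn X this _ \<zeta>0(1,2)] rad show ?thesis
      using I_eq[of s] I_eq[of t] X0 by simp
  qed
  define A where "A = {z. z \<notin> L \<and> norm (u z) < t} \<inter> - M"
  define B where "B = (- N \<inter> - {z. z \<notin> L \<and> norm (u z) \<le> s}) \<inter> - M"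
  \<comment> \<open>By the jump relation the two formulas agree on \<open>A \<inter> B\<close>,
    where the modulus of \<open>u\<close> lies strictly between \<open>s\<close> and
    \<open>t\<close>.\<close>
  define F where "F z = (if z \<in> A then f z + I t z / (2 * of_real pi * \<i>)
      else H z + I s z / (2 * of_real pi * \<i>))" for z
  have opA: "open A"
    unfolding A_def using exterior_map_open_sublevel[OF e clL] clM by (intro open_Int open_Compl) auto
  have opB: "open B"
    unfolding B_def using exterior_map_closed_sublevel[OF e, of s] clN clM rad by (intro open_Int open_Compl) auto
  have BB': "B \<subseteq> B'" using rad by (auto simp: B_def B'_def)
  have agree: "f z + I t z / (2 * of_real pi * \<i>) = H z + I s z / (2 * of_real pi * \<i>)" if "z \<in> A" "z \<in> B" for z
  proof -
    have "I t z = I s z + 2 * of_real pi * \<i> * (H z - f z)"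
      using jump[of z] that by (auto simp: A_def B_def d_def algebra_simps)
    then show ?thesis by (simp add: field_simps)
  qed
  have A_t: "A \<subseteq> - G ` sphere 0 t"
  proof (rule subsetI, rule ComplI)
    fix z assume "z \<in> A" "z \<in> G ` sphere 0 t"
    then show False using G_sph[of z t] rad by (simp add: A_def)
  qed
  have B_s: "B \<subseteq> - G ` sphere 0 s"
  proof (rule subsetI, rule ComplI)
    fix z assume "z \<in> B" "z \<in> G ` sphere 0 s"
    then show False using G_sph[of z s] rad by (simp add: B_def)
  qed
  have cover: "- (N \<union> M) \<subseteq> A \<union> B" using NL rad by (force simp: A_def B_def)
  have F_hol: "F holomorphic_on A \<union> B"
    unfolding F_def[abs_def]
  proof (rule holomorphic_on_If_Un[OF _ _ opA opB agree])
    show "(\<lambda>z. f z + I t z / (2 * of_real pi * \<i>)) holomorphic_on A"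
      by (intro holomorphic_on_add holomorphic_on_divide holomorphic_on_const
          holomorphic_on_subset[OF f(1)] holomorphic_on_subset[OF I_hol A_t]) (use rad in \<open>auto simp: A_def\<close>)
    show "(\<lambda>z. H z + I s z / (2 * of_real pi * \<i>)) holomorphic_on B"
      by (intro holomorphic_on_add holomorphic_on_divide holomorphic_on_const
          holomorphic_on_subset[OF H_hol BB'] holomorphic_on_subset[OF I_hol B_s]) (use rad in auto)
  qed auto
  have F_bound: "norm (F z) \<le> 1 + k * \<epsilon> / \<delta>" if z: "z \<in> - (N \<union> M)" for z
  \<comment> \<open>The level \<open>m\<close> separates the two curves; on either side of it the
    formula is used whose curve has distance at least \<open>\<delta>\<close> from
    \<open>z\<close>.\<close>
  proof (cases "z \<notin> L \<and> norm (u z) \<le> m")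
    case True
    then have zA: "z \<in> A" using rad z by (auto simp: A_def)
    have "norm (I t z / (2 * of_real pi * \<i>)) \<le> k * \<epsilon> / \<delta>"
      using \<delta>(2) G_sph[of _ t] True rad by (intro I_bound) auto
    moreover have "norm (f z) \<le> 1" using f(2)[of z] True z by auto
    ultimately show ?thesis
      using norm_triangle_ineq[of "f z" "I t z / (2 * of_real pi * \<i>)"] zA by (simp add: F_def)
  next
    case False
    then have zB: "z \<in> B" using z rad by (auto simp: B_def)
    have "norm (I s z / (2 * of_real pi * \<i>)) \<le> k * \<epsilon> / \<delta>"
      using \<delta>(3) G_sph[of _ s] False rad by (intro I_bound) auto
    moreover have "norm (H z) \<le> 1" unfolding H_def using f(2)[OF Gu'] zB BB' by blast
    moreover have "F z = H z + I s z / (2 * of_real pi * \<i>)"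
      using agree[OF _ zB] by (auto simp: F_def)
    ultimately show ?thesis
      using norm_triangle_ineq[of "H z" "I s z / (2 * of_real pi * \<i>)"] by simp
  qed
  \<comment> \<open>Up to sign, the coefficient of the Cauchy integral \<open>I t\<close> at
    infinity; it accounts for the passage from \<open>\<alpha>\<close> to
    \<open>\<alpha>'\<close>.\<close>
  define J where "J = contour_integral (\<gamma> t) (\<lambda>w. d w * 1)"
  have J: "norm J \<le> k * \<epsilon> * 1 * (2 * pi)"
    unfolding J_def by (rule bound) auto
  have rt: "0 < t" "t < 1" "s' < t" using rad by auto
  have cG: "compact (G ` sphere 0 t)"
    using rt sphAn[OF rt(3,2)] An_P
    by (intro compact_continuous_image compact_sphere continuous_on_subset[OF holomorphic_on_imp_continuous_on[OF G_hol]]) auto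
  obtain R where R: "R > 0" "\<And>w. w \<in> G ` sphere 0 t \<Longrightarrow> norm w \<le> R"
    using compact_imp_bounded[OF cG] bounded_pos by metis
  have I_inf: "((\<lambda>z. z * I t z) \<longlongrightarrow> - J) at_infinity"
  proof (rule LIM_zero_cancel, rule Lim_null_comparison)
    have "norm (z * I t z - - J) \<le> k * \<epsilon> * (R / (norm z - R)) * (2 * pi)" if z: "norm z > R" for z
    proof -
      have far: "norm z - R \<le> norm (w - z)" "w - z \<noteq> 0" if "w \<in> G ` sphere 0 t" for w
        using norm_triangle_ineq2[of z w] R(2)[OF that] z by (auto simp: norm_minus_commute)
      have cd: "continuous_on (G ` sphere 0 t) d"
        by (rule continuous_on_subset[OF holomorphic_on_imp_continuous_on[OF d_hol]])
           (use GAn sphAn[OF rt(3,2)] in auto)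
      have ci: "(\<lambda>w. d w * h w) contour_integrable_on \<gamma> t" if "continuous_on (G ` sphere 0 t) h" for h
      proof -
        note sm = analytic_jordan_curve_smooth[OF aj[OF rt(1,2)]]
        have "continuous_on {0..1} (\<gamma> t)" using valid_path_imp_path[OF sm(1)] by (simp add: path_def)
        moreover have "continuous_on (G ` sphere 0 t) (\<lambda>w. d w * h w)" by (rule continuous_on_mult[OF cd that])
        moreover have "\<gamma> t ` {0..1} \<subseteq> G ` sphere 0 t" using \<gamma>_im[OF rt(1)] by (simp add: path_image_def)
        ultimately have "continuous_on {0..1} (\<lambda>x. d (\<gamma> t x) * h (\<gamma> t x))"
          using continuous_on_compose2[of "G ` sphere 0 t" "\<lambda>w. d w * h w" "{0..1}" "\<gamma> t"] by blast
        then show ?thesis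
          unfolding contour_integrable_on by (intro integrable_continuous_real continuous_on_mult[OF _ sm(3)])
      qed
      have c1: "continuous_on (G ` sphere 0 t) (\<lambda>w. 1 / (w - z))"
        using far(2) by (intro continuous_intros) auto
      have "z * I t z - - J = z * contour_integral (\<gamma> t) (\<lambda>w. d w * (1 / (w - z))) + J"
        by (simp add: I_def)
      also have "z * contour_integral (\<gamma> t) (\<lambda>w. d w * (1 / (w - z))) = contour_integral (\<gamma> t) (\<lambda>w. z * (d w * (1 / (w - z))))"
        by (rule contour_integral_lmul[OF ci[OF c1], symmetric])
      also have "\<dots> + J = contour_integral (\<gamma> t) (\<lambda>w. z * (d w * (1 / (w - z))) + d w * 1)"
        unfolding J_def by (rule contour_integral_add[symmetric, OF contour_integrable_lmul[OF ci[OF c1]] ci]) simp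
      also have "\<dots> = contour_integral (\<gamma> t) (\<lambda>w. d w * (w / (w - z)))"
      proof (rule contour_integral_cong[OF refl])
        fix w assume "w \<in> path_image (\<gamma> t)"
        then have "w - z \<noteq> 0" using far(2) \<gamma>_im[OF rt(1)] by blast
        then show "z * (d w * (1 / (w - z))) + d w * 1 = d w * (w / (w - z))" by (simp add: field_simps)
      qed
      also have "norm \<dots> \<le> k * \<epsilon> * (R / (norm z - R)) * (2 * pi)"
      proof (rule bound)
        show "continuous_on (G ` sphere 0 t) (\<lambda>w. w / (w - z))"
          using far(2) by (intro continuous_intros) auto
        show "norm (w / (w - z)) \<le> R / (norm z - R)" if "w \<in> G ` sphere 0 t" for w
          using R(1) R(2)[OF that] far(1)[OF that] z unfolding norm_divide by (intro frac_le) auto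
      qed (use R(1) z in auto)
      finally show ?thesis .
    qed
    then show "\<forall>\<^sub>F z in at_infinity. norm (z * I t z - - J) \<le> k * \<epsilon> * (R / (norm z - R)) * (2 * pi)"
      unfolding eventually_at_infinity by (intro exI[of _ "R + 1"]) auto
    have "((\<lambda>x. k * \<epsilon> * (R / (x - R)) * (2 * pi)) \<longlongrightarrow> 0) at_top" by real_asymp
    then show "((\<lambda>z::complex. k * \<epsilon> * (R / (norm z - R)) * (2 * pi)) \<longlongrightarrow> 0) at_infinity"
      by (rule filterlim_compose) (rule filterlim_norm_at_top)
  qed
  have "bounded (- A)"
  proof (rule bounded_subset)
    show "bounded (- {z. z \<notin> L \<and> norm (u z) < t} \<union> M)"
      using exterior_map_bounded[OF e compact_imp_bounded[OF L] rt(1)] M(1) by (simp add: compact_imp_bounded)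
  qed (auto simp: A_def)
  then obtain R' where R': "\<And>z. z \<in> - A \<Longrightarrow> norm z \<le> R'" unfolding bounded_iff by blast
  have ev: "\<forall>\<^sub>F z in at_infinity. f z + I t z / (2 * of_real pi * \<i>) = F z"
    unfolding eventually_at_infinity
  proof (intro exI[of _ "R' + 1"] allI impI)
    fix z :: complex assume "R' + 1 \<le> norm z"
    then have "z \<in> A" using R'[of z] by force
    then show "f z + I t z / (2 * of_real pi * \<i>) = F z" by (simp add: F_def)
  qed
  have I0: "(I t \<longlongrightarrow> 0) at_infinity" by (rule tendsto_zero_of_times_ident[OF I_inf])
  show thesis
  proof (rule that[of F "\<alpha> + - J / (2 * of_real pi * \<i>)"])
    show "F holomorphic_on - (N \<union> M)" by (rule holomorphic_on_subset[OF F_hol cover])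
    show "norm (F z) \<le> 1 + k * \<epsilon> / \<delta>" if "z \<in> - (N \<union> M)" for z by (rule F_bound[OF that])
    have "((\<lambda>z. f z + I t z / (2 * of_real pi * \<i>)) \<longlongrightarrow> c + 0 / (2 * of_real pi * \<i>)) at_infinity"
      by (intro tendsto_add lim tendsto_divide I0 tendsto_const) simp
    then show "(F \<longlongrightarrow> c) at_infinity"
      by (intro Lim_transform_eventually[OF _ ev]) simp
    have "((\<lambda>z. z * (f z - c) + z * I t z / (2 * of_real pi * \<i>)) \<longlongrightarrow> \<alpha> + - J / (2 * of_real pi * \<i>)) at_infinity"
      by (intro tendsto_add lim tendsto_divide I_inf tendsto_const) simp
    then show "((\<lambda>z. z * (F z - c)) \<longlongrightarrow> \<alpha> + - J / (2 * of_real pi * \<i>)) at_infinity"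
    proof (rule Lim_transform_eventually)
      show "\<forall>\<^sub>F z in at_infinity. z * (f z - c) + z * I t z / (2 * of_real pi * \<i>) = z * (F z - c)"
        using ev
      proof eventually_elim
        case (elim z)
        show ?case unfolding elim[symmetric] by (simp add: algebra_simps)
      qed
    qed
    show "norm (\<alpha> + - J / (2 * of_real pi * \<i>) - \<alpha>) \<le> k * \<epsilon>"
      using J by (simp add: norm_divide norm_mult divide_simps)
  qed
qed

section \<open>Replacement of one continuum, uniformly in the function\<close>

lemma radii_exist:
  fixes \<rho> :: real
  assumes "0 < \<rho>" "\<rho> < 1"
  obtains s' s m t where "\<rho> < s'" "s' < s" "s < m" "m < t" "t < 1"
  using assms dense[of \<rho> 1] by (metis dense)

context shrinking_continua
begin

text \<open>The index \<open>n\<close> is chosen before \<open>M\<close>, \<open>f\<close>,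
  \<open>c\<close> and \<open>\<alpha>\<close>, because these change with \<open>n\<close> in the
  induction over the components. All radii, distances and moduli of continuity therefore depend only
  on \<open>L\<close>, its exterior map, \<open>M0\<close> and \<open>e\<close>.\<close>

lemma replace_continuum_ex:
  assumes M0: "compact M0" "M0 \<inter> L = {}" and "e > 0"
  shows "\<exists>n. \<forall>M f c \<alpha>. compact M \<and> M \<subseteq> M0 \<and> f holomorphic_on - (L \<union> M) \<and>
      (\<forall>z\<in>- (L \<union> M). norm (f z) \<le> 1) \<and> (f \<longlongrightarrow> c) at_infinity \<and>
      ((\<lambda>z. z * (f z - c)) \<longlongrightarrow> \<alpha>) at_infinity \<longrightarrow>
    (\<exists>F \<alpha>'. F holomorphic_on - (Ls n \<union> M) \<and> (\<forall>z\<in>- (Ls n \<union> M). norm (F z) \<le> 1 + e) \<and>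
      (F \<longlongrightarrow> c) at_infinity \<and> ((\<lambda>z. z * (F z - c)) \<longlongrightarrow> \<alpha>') at_infinity \<and> norm (\<alpha>' - \<alpha>) \<le> e)"
proof -
  obtain r a b g u gs us where r: "strict_mono (r :: nat \<Rightarrow> nat)" and ext: "exterior_map L b g u"
    and exts: "\<And>n. exterior_map (Ls (r n)) (a n) (gs n) (us n)"
    and unif: "\<And>K. compact K \<Longrightarrow> K \<subseteq> - L \<Longrightarrow> uniform_limit K us u sequentially"
    by (rule limit_exterior_map, rule that)
  note D = exterior_mapD[OF ext] and X = exterior_map_nonzero[OF ext]
  have clL: "closed L" using L(1) by (rule compact_imp_closed)
  define G where "G \<zeta> = b + inverse (g \<zeta>)" for \<zeta>
  have G_out: "G \<zeta> \<notin> L" and uG: "u (G \<zeta>) = \<zeta>" if "norm \<zeta> < 1" "\<zeta> \<noteq> 0" for \<zeta>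
    using D(8)[OF that] X(3)[OF that] by (simp_all add: G_def)
  have Gu: "G (u z) = z" if "z \<notin> L" for z using X(4)[OF that] by (simp add: G_def)
  have G_hol: "G holomorphic_on ball 0 1 - {0}"
    unfolding G_def[abs_def]
    by (intro holomorphic_on_add holomorphic_on_const holomorphic_on_inverse holomorphic_on_subset[OF D(2)])
       (use X(2) in auto)
  have opP: "open (ball (0::complex) 1 - {0})" by (intro open_delete open_ball)
  have "compact (u ` M0)"
    using M0 by (intro compact_continuous_image continuous_on_subset[OF holomorphic_on_imp_continuous_on[OF D(5)]]) auto
  obtain \<rho> where \<rho>: "0 < \<rho>" "\<rho> < 1" "\<And>z. z \<in> M0 \<Longrightarrow> norm (u z) \<le> \<rho>"
  proof (cases "M0 = {}")
    case True
    then show ?thesis using that[of "1 / 2"] by auto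
  next
    case False
    have "continuous_on M0 (\<lambda>z. norm (u z))"
      using M0(2) by (intro continuous_on_norm continuous_on_subset[OF holomorphic_on_imp_continuous_on[OF D(5)]]) auto
    then obtain z where z: "z \<in> M0" "\<And>w. w \<in> M0 \<Longrightarrow> norm (u w) \<le> norm (u z)"
      using continuous_attains_sup[OF M0(1) False] by blast
    have "z \<notin> L" using z(1) M0(2) by blast
    then show ?thesis using that[of "norm (u z)"] z(2) X(1)[of z] D(6)[of z] by auto
  qed
  obtain s' s m t where rad: "\<rho> < s'" "s' < s" "s < m" "m < t" "t < 1"
    using radii_exist[OF \<rho>(1,2)] by blast
  define curve where "curve \<tau> = {w. w \<notin> L \<and> norm (u w) = \<tau>}" for \<tau>
  have curve_compact: "compact (curve \<tau>)" if "0 < \<tau>" "\<tau> < 1" for \<tau>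
  proof -
    have "curve \<tau> = G ` sphere 0 \<tau>"
    proof (intro set_eqI iffI)
      fix w assume "w \<in> curve \<tau>"
      then show "w \<in> G ` sphere 0 \<tau>"
        using Gu[of w] imageI[of "u w" "sphere 0 \<tau>" G] by (simp add: curve_def)
    next
      fix w assume "w \<in> G ` sphere 0 \<tau>"
      then obtain \<zeta> where "w = G \<zeta>" "\<zeta> \<in> sphere 0 \<tau>" by (rule imageE)
      then show "w \<in> curve \<tau>" using G_out[of \<zeta>] uG[of \<zeta>] that by (auto simp: curve_def)
    qed
    moreover have "compact (G ` sphere 0 \<tau>)"
      using that by (intro compact_continuous_image compact_sphere
          continuous_on_subset[OF holomorphic_on_imp_continuous_on[OF G_hol]]) auto
    ultimately show ?thesis by simp
  qed
  have curve_L: "curve \<tau> \<subseteq> - L" for \<tau> by (auto simp: curve_def)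
  define C where "C = curve s \<union> curve t"
  have C: "compact C" "C \<subseteq> - L"
    unfolding C_def using curve_compact curve_L rad \<rho> by (auto intro!: compact_Un)
  obtain \<delta>1 where \<delta>1: "\<delta>1 > 0" "\<And>w z. w \<in> curve t \<Longrightarrow> z \<notin> L \<Longrightarrow> norm (u z) \<le> m \<Longrightarrow> \<delta>1 \<le> dist w z"
  proof -
    have "curve t \<inter> {z. z \<notin> L \<and> norm (u z) \<le> m} = {}" using rad by (auto simp: curve_def)
    then obtain d where "d > 0" "\<forall>w\<in>curve t. \<forall>z\<in>{z. z \<notin> L \<and> norm (u z) \<le> m}. d \<le> dist w z"
      using separate_compact_closed[OF curve_compact[of t] exterior_map_closed_sublevel[OF ext, of m]] rad \<rho> by auto
    then show ?thesis using that[of d] by blast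
  qed
  obtain \<delta>2 where \<delta>2: "\<delta>2 > 0" "\<And>w z. w \<in> curve s \<Longrightarrow> z \<in> L \<or> norm (u z) \<ge> m \<Longrightarrow> \<delta>2 \<le> dist w z"
  proof -
    have cl: "closed (- {z. z \<notin> L \<and> norm (u z) < m})"
      by (intro closed_Compl exterior_map_open_sublevel[OF ext clL])
    have "curve s \<inter> - {z. z \<notin> L \<and> norm (u z) < m} = {}" using rad by (auto simp: curve_def)
    then obtain d where d: "d > 0" "\<forall>w\<in>curve s. \<forall>z\<in>- {z. z \<notin> L \<and> norm (u z) < m}. d \<le> dist w z"
      using separate_compact_closed[OF curve_compact[of s] cl] rad \<rho> by auto
    show ?thesis
    proof (rule that[OF d(1)])
      fix w z assume "w \<in> curve s" "z \<in> L \<or> norm (u z) \<ge> m"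
      then show "d \<le> dist w z" using d(2) by (auto simp: not_less)
    qed
  qed
  define \<delta> where "\<delta> = min 1 (min \<delta>1 \<delta>2)"
  have \<delta>: "0 < \<delta>" "\<delta> \<le> 1" "\<delta> \<le> \<delta>1" "\<delta> \<le> \<delta>2" using \<delta>1(1) \<delta>2(1) by (auto simp: \<delta>_def)
  \<comment> \<open>The factor 2 leaves a ball of radius \<open>2 * \<eta>\<close> on which
    \<open>f\<close> is bounded by 1, as the Lipschitz estimate demands.\<close>
  obtain \<eta> where \<eta>: "\<eta> > 0" "\<And>w z. w \<in> C \<Longrightarrow> z \<in> L \<union> M0 \<Longrightarrow> 2 * \<eta> \<le> dist w z"
  proof -
    have "C \<inter> (L \<union> M0) = {}"
      using C(2) \<rho>(3) rad unfolding C_def curve_def by fastforce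
    then obtain d where d: "d > 0" "\<forall>w\<in>C. \<forall>z\<in>L \<union> M0. d \<le> dist w z"
      using separate_compact_closed[OF C(1) closed_Un[OF clL compact_imp_closed[OF M0(1)]]] by auto
    then show ?thesis by (intro that[of "d / 2"]) auto
  qed
  have "continuous_on (sphere 0 s \<union> sphere 0 t) (deriv G)"
    using rad \<rho> by (intro continuous_on_subset[OF holomorphic_on_imp_continuous_on[OF holomorphic_deriv[OF G_hol opP]]]) auto
  then have "compact (deriv G ` (sphere 0 s \<union> sphere 0 t))"
    by (intro compact_continuous_image compact_Un compact_sphere)
  then obtain k where k: "k > 0" "\<And>x. x \<in> deriv G ` (sphere 0 s \<union> sphere 0 t) \<Longrightarrow> norm x \<le> k"
    using compact_imp_bounded bounded_pos by metis
  \<comment> \<open>Chosen so that the loss \<open>k * \<epsilon> / \<delta>\<close> of the gluing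
    step is exactly \<open>e\<close>; as \<open>\<delta> \<le> 1\<close>, the change of the
    coefficient is at most \<open>e\<close> too.\<close>
  define \<epsilon> where "\<epsilon> = e * \<delta> / k"
  have \<epsilon>: "\<epsilon> > 0" "k * \<epsilon> / \<delta> = e" "k * \<epsilon> \<le> e"
    using \<open>e > 0\<close> \<delta>(1,2) k(1) by (auto simp: \<epsilon>_def mult_left_le)
  define t'' where "t'' = (1 + t) / 2"
  have t'': "t < t''" "t'' < 1" using rad by (auto simp: t''_def)
  define An where "An = cball (0::complex) t'' - ball 0 s'"
  have An: "compact An" "An \<subseteq> ball 0 1 - {0}"
    using t'' rad \<rho> by (auto simp: An_def compact_diff)
  have "uniformly_continuous_on An G"
    by (rule compact_uniformly_continuous[OF continuous_on_subset[OF holomorphic_on_imp_continuous_on[OF G_hol] An(2)] An(1)])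
  moreover have "min \<eta> (\<epsilon> * \<eta>) > 0" using \<eta> \<epsilon> by simp
  ultimately obtain d where d: "d > 0" "\<And>x y. x \<in> An \<Longrightarrow> y \<in> An \<Longrightarrow> dist y x < d \<Longrightarrow> dist (G y) (G x) < min \<eta> (\<epsilon> * \<eta>)"
    unfolding uniformly_continuous_on_def by metis
  \<comment> \<open>Beyond the uniform continuity of \<open>G\<close>, this keeps the perturbed
    values \<open>us n w\<close> between the radii \<open>s'\<close> and \<open>t''\<close>, that
    is, in \<open>An\<close>.\<close>
  define d' where "d' = min d (min (s - s') (t'' - t))"
  have d': "d' > 0" "d' \<le> d" "d' \<le> s - s'" "d' \<le> t'' - t" using d(1) rad t'' by (auto simp: d'_def)
  have "\<forall>\<^sub>F n in sequentially. \<forall>z\<in>C. dist (us n z) (u z) < d'"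
    using uniform_limitD[OF unif[OF C] d'(1)] .
  moreover have "\<forall>\<^sub>F n in sequentially. \<forall>z\<in>curve s'. dist (us n z) (u z) < s' - \<rho>"
    by (rule uniform_limitD[OF unif[OF curve_compact curve_L]]) (use rad \<rho> in auto)
  ultimately have "\<forall>\<^sub>F n in sequentially. (\<forall>z\<in>C. dist (us n z) (u z) < d') \<and> (\<forall>z\<in>curve s'. dist (us n z) (u z) < s' - \<rho>)"
    by (rule eventually_conj)
  then obtain n where n1: "\<And>z. z \<in> C \<Longrightarrow> dist (us n z) (u z) < d'"
      and n2: "\<And>z. z \<in> curve s' \<Longrightarrow> dist (us n z) (u z) < s' - \<rho>"
    unfolding eventually_sequentially by blast
  have move: "dist (G (us n w)) w < min \<eta> (\<epsilon> * \<eta>)" if w: "w \<in> C" for w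
  proof -
    have uw: "w \<notin> L" "s \<le> norm (u w)" "norm (u w) \<le> t" using w rad by (auto simp: C_def curve_def)
    have "\<bar>norm (us n w) - norm (u w)\<bar> < d'"
      using n1[OF w] norm_triangle_ineq3[of "us n w" "u w"] by (simp add: dist_norm)
    then have "us n w \<in> An" "u w \<in> An" using uw d' t'' rad by (auto simp: An_def)
    then have "dist (G (us n w)) (G (u w)) < min \<eta> (\<epsilon> * \<eta>)"
      using n1[OF w] d'(2) by (intro d(2)) auto
    then show ?thesis using Gu[OF uw(1)] by simp
  qed
  show ?thesis
  proof (rule exI[of _ "r n"], intro allI impI, elim conjE)
    fix M f c \<alpha>
    assume M: "compact M" "M \<subseteq> M0" and f: "f holomorphic_on - (L \<union> M)" "\<forall>z\<in>- (L \<union> M). norm (f z) \<le> 1"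
      and lim: "(f \<longlongrightarrow> c) at_infinity" "((\<lambda>z. z * (f z - c)) \<longlongrightarrow> \<alpha>) at_infinity"
    have close: "norm (f (b + inverse (g (us n w))) - f w) \<le> \<epsilon>" if w: "w \<notin> L" "norm (u w) \<in> {s, t}" for w
    proof -
      have wC: "w \<in> C" using w by (auto simp: C_def curve_def)
      have sub: "ball w (2 * \<eta>) \<subseteq> - (L \<union> M)"
      proof
        fix y assume "y \<in> ball w (2 * \<eta>)"
        then show "y \<in> - (L \<union> M)" using \<eta>(2)[OF wC, of y] M(2) by auto
      qed
      have "norm (f (G (us n w)) - f w) \<le> norm (G (us n w) - w) / \<eta>"
        by (rule bounded_holomorphic_Lipschitz[OF holomorphic_on_subset[OF f(1) sub]
              f(2)[rule_format, OF subsetD[OF sub]] \<eta>(1)])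
           (use move[OF wC] in \<open>auto simp: dist_commute\<close>)
      also have "\<dots> \<le> \<epsilon>"
        using move[OF wC] \<eta>(1) by (simp add: dist_norm pos_divide_le_eq)
      finally show ?thesis by (simp add: G_def)
    qed
    have lower: "norm (us n z) > \<rho>" if z: "z \<notin> L" "norm (u z) = s'" for z
    proof -
      have "norm (us n z - u z) < s' - \<rho>" using n2[of z] z by (simp add: curve_def dist_norm)
      then show ?thesis using norm_triangle_ineq2[of "u z" "us n z"] z(2) by (simp add: norm_minus_commute)
    qed
    have kb: "norm (deriv (\<lambda>\<zeta>. b + inverse (g \<zeta>)) \<zeta>) \<le> k" if "\<zeta> \<in> sphere 0 s \<union> sphere 0 t" for \<zeta>
      using k(2)[OF imageI[OF that]] by (simp add: G_def[abs_def])
    show "\<exists>F \<alpha>'. F holomorphic_on - (Ls (r n) \<union> M) \<and> (\<forall>z\<in>- (Ls (r n) \<union> M). norm (F z) \<le> 1 + e) \<and>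
      (F \<longlongrightarrow> c) at_infinity \<and> ((\<lambda>z. z * (F z - c)) \<longlongrightarrow> \<alpha>') at_infinity \<and> norm (\<alpha>' - \<alpha>) \<le> e"
    proof (rule glue_step[OF ext exts Ls(4) L(1) Ls(1) M(1) _ \<rho>(1) rad _ lower kb k(1) \<delta>(1) _ _ f(1) _ close \<epsilon>(1) lim])
      show "M \<inter> L = {}" using M(2) M0(2) by blast
      show "norm (u z) \<le> \<rho>" if "z \<in> M" for z using \<rho>(3) that M(2) by blast
      show "\<delta> \<le> dist w z" if "w \<notin> L" "norm (u w) = t" "z \<notin> L" "norm (u z) \<le> m" for w z
        using \<delta>1(2)[of w z] \<delta>(3) that by (auto simp: curve_def)
      show "\<delta> \<le> dist w z" if "w \<notin> L" "norm (u w) = s" "z \<in> L \<or> norm (u z) \<ge> m" for w z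
        using \<delta>2(2)[of w z] \<delta>(4) that by (auto simp: curve_def)
      show "norm (f z) \<le> 1" if "z \<in> - (L \<union> M)" for z using f(2) that by blast
      fix F \<alpha>' assume F: "F holomorphic_on - (Ls (r n) \<union> M)" "\<And>z. z \<in> - (Ls (r n) \<union> M) \<Longrightarrow> norm (F z) \<le> 1 + k * \<epsilon> / \<delta>"
        "(F \<longlongrightarrow> c) at_infinity" "((\<lambda>z. z * (F z - c)) \<longlongrightarrow> \<alpha>') at_infinity" "norm (\<alpha>' - \<alpha>) \<le> k * \<epsilon>"
      show ?thesis
        by (rule exI[of _ F], rule exI[of _ \<alpha>'], intro conjI ballI)
           (use F \<epsilon>(2,3) in \<open>auto intro: order_trans\<close>)
    qed
  qed
qed

end

definition replaceable :: "complex set \<Rightarrow> complex set \<Rightarrow> complex set \<Rightarrow> real \<Rightarrow> bool" where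
  "replaceable L N M0 e \<longleftrightarrow> (\<forall>M f c \<alpha>. compact M \<and> M \<subseteq> M0 \<and> f holomorphic_on - (L \<union> M) \<and>
      (\<forall>z\<in>- (L \<union> M). norm (f z) \<le> 1) \<and> (f \<longlongrightarrow> c) at_infinity \<and>
      ((\<lambda>z. z * (f z - c)) \<longlongrightarrow> \<alpha>) at_infinity \<longrightarrow>
    (\<exists>F \<alpha>'. F holomorphic_on - (N \<union> M) \<and> (\<forall>z\<in>- (N \<union> M). norm (F z) \<le> 1 + e) \<and>
      (F \<longlongrightarrow> c) at_infinity \<and> ((\<lambda>z. z * (F z - c)) \<longlongrightarrow> \<alpha>') at_infinity \<and> norm (\<alpha>' - \<alpha>) \<le> e))"

text \<open>The assumptions pass to subsequences, so every subsequence contains a good index.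
  Applied to the indices of failure, this shows that they are finite in number.\<close>

lemma (in shrinking_continua) eventually_replaceable:
  assumes M0: "compact M0" "M0 \<inter> L = {}" and "e > 0"
  shows "\<forall>\<^sub>F n in sequentially. replaceable L (Ls n) M0 e"
proof (rule ccontr)
  assume "\<not> ?thesis"
  then have "\<exists>\<^sub>F n in sequentially. \<not> replaceable L (Ls n) M0 e" by (simp add: not_eventually)
  then have inf: "infinite {n. \<not> replaceable L (Ls n) M0 e}"
    by (simp add: frequently_cofinite flip: cofinite_eq_sequentially)
  define r where "r = enumerate {n. \<not> replaceable L (Ls n) M0 e}"
  have r: "strict_mono r" "\<And>n. \<not> replaceable L (Ls (r n)) M0 e"
    using inf enumerate_in_set[OF inf] by (auto simp: r_def strict_mono_enumerate)
  interpret sub: shrinking_continua L "\<lambda>n. Ls (r n)" p q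
  proof
    show "\<forall>\<^sub>F n in sequentially. ball z e \<inter> Ls (r n) \<noteq> {}" if "z \<in> frontier L" "e > 0" for z e
      using eventually_compose_filterlim[OF approach[OF that] filterlim_subseq[OF r(1)]] .
  qed (use L Ls pq in auto)
  show False
    using sub.replace_continuum_ex[OF M0 \<open>e > 0\<close>] r(2) unfolding replaceable_def by blast
qed

section \<open>Components of the filled sets\<close>

lemma connected_components_of_top_of_set: "connected_components_of (top_of_set S) = components S"
proof -
  have "connected_component_of (top_of_set S) = connected_component S"
    by (intro ext) (auto simp: connected_component_of_def connected_component_def connectedin_subtopology)
  then show ?thesis by (simp add: connected_components_of_def components_def)
qed

text \<open>\<open>Some\<close> embeds the plane in the sphere, so the components counted on the
  sphere are images of planar ones.\<close>

lemma connected_components_of_Some_image: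
  "connected_components_of (subtopology riemann_sphere (Some ` S)) = image Some ` components S"
proof -
  have "homeomorphic_map euclidean (subtopology riemann_sphere (range Some)) (Some :: complex \<Rightarrow> _)"
    using embedding_map_Some[of "euclidean :: complex topology"]
    by (simp add: embedding_map_def riemann_sphere_def)
  then have "homeomorphic_map (top_of_set S) (subtopology (subtopology riemann_sphere (range Some)) (Some ` S)) Some"
    by (rule homeomorphic_map_subtopologies) auto
  moreover have "range Some \<inter> Some ` S = Some ` S" by auto
  ultimately have "homeomorphic_map (top_of_set S) (subtopology riemann_sphere (Some ` S)) Some"
    by (simp add: subtopology_subtopology)
  then show ?thesis
    using homeomorphic_map_connected_components_of connected_components_of_top_of_set by metis
qed

lemma Compl_outer_domain: "compact E \<Longrightarrow> - outer_domain E = Some ` (- outside E)"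
  unfolding outer_domain_eq
proof (intro set_eqI)
  fix x show "x \<in> - insert None (Some ` outside E) \<longleftrightarrow> x \<in> Some ` (- outside E)"
    by (cases x) auto
qed

lemma nondegenerate_connected_domain_components:
  assumes "compact E" "nondegenerate_connected_domain m (outer_domain E)"
  shows "finite (components (- outside E))" "card (components (- outside E)) = m"
    and "\<And>L. L \<in> components (- outside E) \<Longrightarrow> \<exists>x\<in>L. \<exists>y\<in>L. x \<noteq> y"
proof -
  have inj: "inj_on (image (Some :: complex \<Rightarrow> _)) A" for A
    by (rule inj_on_subset[of _ UNIV]) (auto simp: inj_image_eq_iff intro!: injI)
  have "finite (image Some ` components (- outside E)) \<and> card (image Some ` components (- outside E)) = m \<and>
      (\<forall>C\<in>image Some ` components (- outside E). \<exists>x\<in>C. \<exists>y\<in>C. x \<noteq> y)"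
    using assms unfolding nondegenerate_connected_domain_def Let_def
    by (simp add: Compl_outer_domain connected_components_of_Some_image del: image_iff bex_simps ball_simps)
  then have *: "finite (image Some ` components (- outside E))"
      "card (image Some ` components (- outside E)) = m"
      "\<forall>C\<in>image Some ` components (- outside E). \<exists>x\<in>C. \<exists>y\<in>C. x \<noteq> y"
    by simp_all
  show "finite (components (- outside E))" using *(1) finite_imageD[OF _ inj] by blast
  show "card (components (- outside E)) = m" using *(2) card_image[OF inj] by metis
  fix L assume "L \<in> components (- outside E)"
  then have "\<exists>x\<in>Some ` L. \<exists>y\<in>Some ` L. x \<noteq> y" using *(3) by (metis imageI)
  then show "\<exists>x\<in>L. \<exists>y\<in>L. x \<noteq> y" by auto
qed

text \<open>If \<open>p\<close> is one frontier point, the punctured plane is still connected and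
  meets both \<open>L\<close> and its complement, so it contains another.\<close>

lemma two_frontier_points:
  fixes L :: "complex set"
  assumes "compact L" "x \<in> L" "y \<in> L" "x \<noteq> y"
  obtains p q where "p \<in> frontier L" "q \<in> frontier L" "p \<noteq> q"
proof -
  obtain w where w: "w \<notin> L" using assms(1) compact_imp_bounded not_bounded_UNIV by (metis UNIV_eq_I)
  then have "frontier L \<noteq> {}" using assms(2) frontier_not_empty by blast
  then obtain p where p: "p \<in> frontier L" by blast
  have pL: "p \<in> L" using p frontier_subset_closed[OF compact_imp_closed[OF assms(1)]] by blast
  have "connected (- {p})" by (rule connected_punctured_universe) simp
  moreover have "- {p} \<inter> L \<noteq> {}" using assms by (metis ComplI IntI emptyE singletonD)
  moreover have "- {p} - L \<noteq> {}" using w pL by auto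
  ultimately have "- {p} \<inter> frontier L \<noteq> {}" by (rule connected_Int_frontier)
  then show ?thesis using p that by auto
qed

text \<open>The other components are finitely many compact sets, so their union is compact and keeps
  a positive distance from each point of \<open>L\<close>.\<close>

lemma component_isolated:
  fixes H :: "complex set"
  assumes "compact H" "finite (components H)" "L \<in> components H"
  shows "compact L" "compact (H - L)" "p \<in> L \<Longrightarrow> \<exists>d>0. ball p d \<inter> H \<subseteq> L"
proof -
  show "compact L" using assms compact_components by blast
  have "H - L = \<Union>(components H - {L})"
  proof (intro equalityI subsetI)
    fix x assume "x \<in> H - L"
    then show "x \<in> \<Union>(components H - {L})" using Union_components[of H] by (metis DiffD1 DiffD2 DiffI UnionE UnionI singletonD)
  next
    fix x assume "x \<in> \<Union>(components H - {L})"
    then obtain C where C: "C \<in> components H" "C \<noteq> L" "x \<in> C" by blast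
    then show "x \<in> H - L"
      using components_nonoverlap[OF C(1) assms(3)] in_components_subset[OF C(1)] by blast
  qed
  moreover have "compact (\<Union>(components H - {L}))"
    using assms compact_components by (intro compact_Union) auto
  ultimately show cpt: "compact (H - L)" by simp
  show "\<exists>d>0. ball p d \<inter> H \<subseteq> L" if p: "p \<in> L"
  proof -
    have "open (- (H - L))" using cpt compact_imp_closed open_Compl by blast
    moreover have "p \<in> - (H - L)" using p by simp
    ultimately obtain d where "d > 0" "ball p d \<subseteq> - (H - L)" by (rule openE)
    then show ?thesis by blast
  qed
qed

text \<open>Every component of \<open>Hs k\<close> lies in a component of \<open>H\<close>, and
  eventually every component of \<open>H\<close> is met. The resulting map between finite sets of
  equal size is onto, hence one-to-one, so no component of \<open>H\<close> contains two.\<close>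

lemma eventually_components_correspond:
  fixes H :: "complex set" and Hs :: "nat \<Rightarrow> complex set"
  assumes H: "compact H" "finite (components H)"
    and Hs: "\<And>k. Hs k \<subseteq> H" "\<And>k. finite (components (Hs k))"
      "\<And>k. card (components (Hs k)) = card (components H)"
    and approach: "\<And>p e. p \<in> frontier H \<Longrightarrow> e > 0 \<Longrightarrow> \<forall>\<^sub>F k in sequentially. ball p e \<inter> Hs k \<noteq> {}"
  shows "\<forall>\<^sub>F k in sequentially. \<forall>L\<in>components H. L \<inter> Hs k \<in> components (Hs k)"
proof -
  have "\<forall>\<^sub>F k in sequentially. L \<inter> Hs k \<noteq> {}" if L: "L \<in> components H" for L
  proof -
    have "L \<noteq> {}" "L \<noteq> UNIV"
      using L in_components_nonempty component_isolated(1)[OF H L] not_compact_UNIV by auto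
    then obtain p where p: "p \<in> frontier L" using frontier_not_empty by blast
    then have "p \<in> L" using component_isolated(1)[OF H L] compact_imp_closed frontier_subset_closed by blast
    then obtain d where d: "d > 0" "ball p d \<inter> H \<subseteq> L" using component_isolated(3)[OF H L] by blast
    have "p \<in> frontier H" using p frontier_of_components_subset[OF L] by blast
    then have "\<forall>\<^sub>F k in sequentially. ball p d \<inter> Hs k \<noteq> {}" using d(1) approach by blast
    then show ?thesis by (rule eventually_mono) (use d(2) Hs(1) in blast)
  qed
  then have "\<forall>\<^sub>F k in sequentially. \<forall>L\<in>components H. L \<inter> Hs k \<noteq> {}"
    by (intro eventually_ball_finite H(2)) blast
  then show ?thesis
  proof (rule eventually_mono)
    fix k assume meets: "\<forall>L\<in>components H. L \<inter> Hs k \<noteq> {}"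
    have "\<exists>L. L \<in> components H \<and> C \<subseteq> L" if C: "C \<in> components (Hs k)" for C
    proof -
      have "C \<subseteq> H" "connected C" "C \<noteq> {}"
        using C in_components_subset Hs(1) in_components_connected in_components_nonempty by blast+
      then show ?thesis using exists_component_superset[of C H] by auto
    qed
    then obtain g where g: "\<And>C. C \<in> components (Hs k) \<Longrightarrow> g C \<in> components H \<and> C \<subseteq> g C" by metis
    have cover: "\<exists>C\<in>components (Hs k). x \<in> C \<and> g C = L" if x: "L \<in> components H" "x \<in> L" "x \<in> Hs k" for L x
    proof -
      obtain C where C: "C \<in> components (Hs k)" "x \<in> C" using x(3) Union_components[of "Hs k"] by blast
      then have "x \<in> g C \<inter> L" using g x(2) by blast
      then have "g C = L" using components_nonoverlap[of "g C" H L] g[OF C(1)] x(1) by blast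
      then show ?thesis using C by blast
    qed
    have "g ` components (Hs k) = components H"
    proof (intro equalityI subsetI)
      fix L assume L: "L \<in> components H"
      then obtain x where "x \<in> L" "x \<in> Hs k" using meets by blast
      then show "L \<in> g ` components (Hs k)" using cover[OF L] by blast
    qed (use g in blast)
    then have inj: "inj_on g (components (Hs k))" using Hs(2,3) by (intro eq_card_imp_inj_on) auto
    show "\<forall>L\<in>components H. L \<inter> Hs k \<in> components (Hs k)"
    proof
      fix L assume L: "L \<in> components H"
      then obtain x where "x \<in> L" "x \<in> Hs k" using meets by blast
      then obtain C where C: "C \<in> components (Hs k)" "g C = L" using cover[OF L] by blast
      have "L \<inter> Hs k = C"
      proof (intro equalityI subsetI)
        fix y assume "y \<in> L \<inter> Hs k"
        then obtain C' where "C' \<in> components (Hs k)" "y \<in> C'" "g C' = L" using cover[OF L] by blast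
        then show "y \<in> C" using inj C by (metis inj_onD)
      next
        fix y assume "y \<in> C"
        then show "y \<in> L \<inter> Hs k" using C g[OF C(1)] in_components_subset[OF C(1)] by auto
      qed
      then show "L \<inter> Hs k \<in> components (Hs k)" using C(1) by simp
    qed
  qed
qed

text \<open>If a disc around a boundary point of the limit domain lay in infinitely many of the
  domains, it could be added to the kernel of the corresponding subsequence.\<close>

lemma caratheodory_converges_approach:
  assumes E: "compact E" and Es: "\<And>k. compact (Es k)" "\<And>k. Es k \<subseteq> E"
    and conv: "caratheodory_converges (\<lambda>k. outer_domain (Es k)) (outer_domain E)"
    and p: "p \<in> frontier (outside E)" and e: "e > 0"
  shows "\<forall>\<^sub>F k in sequentially. ball p e \<inter> - outside (Es k) \<noteq> {}"
proof (rule ccontr)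
  define S where "S = {k. ball p e \<subseteq> outside (Es k)}"
  assume "\<not> ?thesis"
  then have "\<exists>\<^sub>F k in sequentially. ball p e \<subseteq> outside (Es k)"
    unfolding not_eventually by (rule frequently_elim1) blast
  then have inf: "infinite S"
    unfolding S_def cofinite_eq_sequentially[symmetric] by (simp add: frequently_cofinite)
  define \<Omega> where "\<Omega> = outer_domain E \<union> Some ` ball p e"
  have "is_kernel ((\<lambda>k. outer_domain (Es k)) \<circ> enumerate S) (outer_domain E)"
    using conv strict_mono_enumerate[OF inf] unfolding caratheodory_converges_def by blast
  then have dom: "sphere_domain (outer_domain E)" "None \<in> outer_domain E"
    and max: "\<And>\<Omega>'. sphere_domain \<Omega>' \<Longrightarrow> None \<in> \<Omega>' \<Longrightarrow>
      eventually_absorbed ((\<lambda>k. outer_domain (Es k)) \<circ> enumerate S) \<Omega>' \<Longrightarrow> \<Omega>' \<subseteq> outer_domain E"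
    unfolding is_kernel_def by simp_all
  have "p \<in> closure (outside E)" using p frontier_def by (metis DiffD1)
  \<comment> \<open>The disc meets the outer domain, so their union is connected.\<close>
  then obtain y where y: "y \<in> outside E" "y \<in> ball p e"
    using e unfolding closure_approachable by (auto simp: dist_commute)
  have "outer_domain E \<inter> Some ` ball p e \<noteq> {}" using y unfolding outer_domain_eq[OF E] by blast
  then have "sphere_domain \<Omega>"
    using dom(1) unfolding sphere_domain_def \<Omega>_def
    by (intro conjI connectedin_Un connectedin_riemann_sphere_Some connected_ball openin_Un openin_riemann_sphere_Some open_ball) auto
  moreover have "None \<in> \<Omega>" using dom(2) by (simp add: \<Omega>_def)
  moreover have "\<Omega> \<subseteq> outer_domain (Es (enumerate S k))" for k
  proof -
    have "ball p e \<subseteq> outside (Es (enumerate S k))" using enumerate_in_set[OF inf, of k] by (simp add: S_def)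
    moreover have "outside E \<subseteq> outside (Es (enumerate S k))" by (rule outside_mono[OF Es(2)])
    ultimately show ?thesis unfolding \<Omega>_def outer_domain_eq[OF E] outer_domain_eq[OF Es(1)] by blast
  qed
  then have "eventually_absorbed ((\<lambda>k. outer_domain (Es k)) \<circ> enumerate S) \<Omega>"
    unfolding eventually_absorbed_def by (metis comp_apply order_trans)
  ultimately have "\<Omega> \<subseteq> outer_domain E" by (rule max)
  moreover have "Some p \<in> \<Omega>" using e by (simp add: \<Omega>_def)
  ultimately have "p \<in> outside E" by (auto simp: outer_domain_eq[OF E])
  moreover have "p \<notin> outside E"
    using p open_outside[OF compact_imp_closed[OF E]] by (simp add: frontier_def interior_open)
  ultimately show False by blast
qed

section \<open>Replacing all components\<close>

text \<open>\<open>H\<close> and \<open>Hs\<close> stand for the complements of the unbounded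
  domains, with so many initial terms dropped that the correspondence of components holds for every
  index.\<close>

locale component_approximation =
  fixes H :: "complex set" and Hs :: "nat \<Rightarrow> complex set"
  assumes H: "compact H" "connected (- H)" "finite (components H)"
    and nondegenerate: "\<And>L. L \<in> components H \<Longrightarrow> \<exists>x\<in>L. \<exists>y\<in>L. x \<noteq> y"
    and Hs: "\<And>n. compact (Hs n)" "\<And>n. connected (- Hs n)" "\<And>n. Hs n \<subseteq> H"
    and correspond: "\<And>n L. L \<in> components H \<Longrightarrow> L \<inter> Hs n \<in> components (Hs n)"
    and approach: "\<And>p e. p \<in> frontier H \<Longrightarrow> e > 0 \<Longrightarrow> \<forall>\<^sub>F n in sequentially. ball p e \<inter> Hs n \<noteq> {}"
begin

lemma eventually_replaceable_component:
  assumes L: "L \<in> components H" and e: "e > 0"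
  shows "\<forall>\<^sub>F n in sequentially. replaceable L (L \<inter> Hs n) (H - L) e"
proof -
  note iso = component_isolated[OF H(1,3) L]
  obtain x y where "x \<in> L" "y \<in> L" "x \<noteq> y" using nondegenerate[OF L] by blast
  then obtain p q where pq: "p \<in> frontier L" "q \<in> frontier L" "p \<noteq> q"
    using two_frontier_points[OF iso(1)] by blast
  interpret shrinking_continua L "\<lambda>n. L \<inter> Hs n" p q
  proof
    show "compact L" by (rule iso)
    show "connected L" using L by (rule in_components_connected)
    show "connected (- L)" using component_complement_connected[OF H(2)] L by simp
    fix n
    show "compact (L \<inter> Hs n)" using iso(1) Hs(1) by (rule compact_Int)
    show "connected (L \<inter> Hs n)" using correspond[OF L] by (rule in_components_connected)
    show "connected (- (L \<inter> Hs n))" 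
      by (rule component_complement_connected[OF Hs(2)[of n]]) (use correspond[OF L, of n] in simp)
    show "L \<inter> Hs n \<noteq> {}" using correspond[OF L] by (rule in_components_nonempty)
  next
    fix z e assume z: "z \<in> frontier L" and e: "(e::real) > 0"
    then have "z \<in> L" using iso(1) compact_imp_closed frontier_subset_closed by blast
    then obtain d where d: "d > 0" "ball z d \<inter> H \<subseteq> L" using iso(3) by blast
    have "z \<in> frontier H" using z frontier_of_components_subset[OF L] by blast
    \<comment> \<open>The radius \<open>d\<close> isolates \<open>L\<close> in \<open>H\<close>, so
      points of \<open>Hs n\<close> found in the smaller ball belong to \<open>L\<close>.\<close>
    then have "\<forall>\<^sub>F n in sequentially. ball z (min d e) \<inter> Hs n \<noteq> {}" using d(1) e by (intro approach) auto
    then show "\<forall>\<^sub>F n in sequentially. ball z e \<inter> (L \<inter> Hs n) \<noteq> {}"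
    proof (rule eventually_mono)
      fix n assume "ball z (min d e) \<inter> Hs n \<noteq> {}"
      then obtain w where "w \<in> ball z d" "w \<in> ball z e" "w \<in> Hs n" by auto
      then show "ball z e \<inter> (L \<inter> Hs n) \<noteq> {}" using d(2) Hs(3)[of n] by blast
    qed
  qed (use pq in auto)
  show ?thesis by (rule eventually_replaceable[OF iso(2) _ e]) blast
qed

text \<open>\<open>X \<D> n\<close> is the intermediate singular set in which exactly the components
  in \<open>\<D>\<close> have been replaced. The loss \<open>\<eta>\<close> is arbitrary in the
  induction, so half of it can be spent on the earlier components.\<close>

lemma eventually_approximate:
  assumes f: "f holomorphic_on - H" "\<And>z. z \<in> - H \<Longrightarrow> norm (f z) \<le> 1"
    and lim: "(f \<longlongrightarrow> c) at_infinity" "((\<lambda>z. z * (f z - c)) \<longlongrightarrow> a) at_infinity"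
    and "\<D> \<subseteq> components H" "\<eta> > 0"
  defines "X \<equiv> \<lambda>\<D> n. \<Union>(components H - \<D>) \<union> (\<Union>D\<in>\<D>. D \<inter> Hs n)"
  shows "\<forall>\<^sub>F n in sequentially. \<exists>F c' a'. F holomorphic_on - X \<D> n \<and> (\<forall>z\<in>- X \<D> n. norm (F z) \<le> 1) \<and>
      (F \<longlongrightarrow> c') at_infinity \<and> ((\<lambda>z. z * (F z - c')) \<longlongrightarrow> a') at_infinity \<and> norm a - \<eta> \<le> norm a'"
proof -
  have "finite \<D>" using H(3) assms(5) finite_subset by blast
  then show ?thesis using assms(5,6)
  proof (induction \<D> arbitrary: \<eta> rule: finite_induct)
    case empty
    have "X {} n = H" for n unfolding X_def using Union_components[of H] by simp
    then show ?case using f lim empty by (intro always_eventually allI exI[of _ f] exI[of _ c] exI[of _ a]) auto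
  next
    case (insert L \<D>)
    \<comment> \<open>The second half of the loss: \<open>e * (norm a + 1) = \<eta> / 2\<close>
      covers both the change of the coefficient and the division by \<open>1 + e\<close> that
      restores the bound 1.\<close>
    define e where "e = \<eta> / (2 * (norm a + 1))"
    have "e > 0" using insert.prems(2) by (simp add: e_def add_nonneg_pos)
    have e_eq: "e * (norm a + 1) = \<eta> / 2"
      using add_nonneg_pos[OF norm_ge_zero[of a] zero_less_one] by (simp add: e_def field_simps)
    have L: "L \<in> components H" and D: "\<D> \<subseteq> components H" using insert.prems(1) by auto
    define M where "M n = \<Union>(components H - insert L \<D>) \<union> (\<Union>D\<in>\<D>. D \<inter> Hs n)" for n
    have "compact (M n)" for n
      unfolding M_def using H(1,3) D Hs(1) compact_components insert.hyps(1)
      by (intro compact_Un compact_Union compact_UN compact_Int) auto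
    have "M n \<subseteq> H - L" for n
    proof
      fix x assume "x \<in> M n"
      then obtain C where C: "C \<in> components H" "C \<noteq> L" "x \<in> C"
        unfolding M_def using D insert.hyps(2) by blast
      then show "x \<in> H - L"
        using components_nonoverlap[OF C(1) L] in_components_subset[OF C(1)] by blast
    qed
    have X1: "X \<D> n = L \<union> M n" for n
      unfolding X_def M_def using L insert.hyps(2) by blast
    have X2: "X (insert L \<D>) n = (L \<inter> Hs n) \<union> M n" for n
      unfolding X_def M_def by blast
    have "\<eta> / 2 > 0" using insert.prems(2) by simp
    note IH = insert.IH[OF D this]
    show ?case
      using IH eventually_replaceable_component[OF L \<open>e > 0\<close>]
    proof eventually_elim
      case (elim n)
      then obtain F c' a' where F: "F holomorphic_on - X \<D> n" "\<forall>z\<in>- X \<D> n. norm (F z) \<le> 1"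
        "(F \<longlongrightarrow> c') at_infinity" "((\<lambda>z. z * (F z - c')) \<longlongrightarrow> a') at_infinity" "norm a - \<eta> / 2 \<le> norm a'"
        by blast
      obtain G a'' where G: "G holomorphic_on - (L \<inter> Hs n \<union> M n)"
        "\<forall>z\<in>- (L \<inter> Hs n \<union> M n). norm (G z) \<le> 1 + e" "(G \<longlongrightarrow> c') at_infinity"
        "((\<lambda>z. z * (G z - c')) \<longlongrightarrow> a'') at_infinity" "norm (a'' - a') \<le> e"
        using elim(2)[unfolded replaceable_def, rule_format, of "M n" F c' a'] F \<open>compact (M n)\<close> \<open>M n \<subseteq> H - L\<close>
        unfolding X1 by blast
      let ?k = "complex_of_real (1 + e)"
      have k: "?k \<noteq> 0" "norm ?k = 1 + e" using \<open>e > 0\<close> by (auto simp del: of_real_add)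
      have "(\<lambda>z. G z / ?k) holomorphic_on - X (insert L \<D>) n"
        unfolding X2 by (intro holomorphic_on_divide G holomorphic_on_const) (use k in auto)
      moreover have "\<forall>z\<in>- X (insert L \<D>) n. norm (G z / ?k) \<le> 1"
        unfolding X2 norm_divide k(2) using G(2) \<open>e > 0\<close> by (auto simp: divide_le_eq)
      moreover have "((\<lambda>z. G z / ?k) \<longlongrightarrow> c' / ?k) at_infinity"
        by (intro tendsto_divide G tendsto_const k)
      moreover have "((\<lambda>z. z * (G z / ?k - c' / ?k)) \<longlongrightarrow> a'' / ?k) at_infinity"
        using tendsto_divide[OF G(4) tendsto_const k(1)] by (simp add: diff_divide_distrib right_diff_distrib)
      moreover have "norm a - \<eta> \<le> norm (a'' / ?k)"
      proof -
        have "norm a' \<le> norm a'' + e" using G(5) norm_triangle_ineq2[of a' a''] norm_minus_commute[of a' a''] by linarith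
        then have "norm a - \<eta> / 2 - e \<le> norm a''" using F(5) by linarith
        moreover have "(norm a - \<eta>) * (1 + e) \<le> norm a - \<eta> / 2 - e"
        proof -
          have "e * \<eta> \<ge> 0" using \<open>e > 0\<close> insert.prems(2) by simp
          moreover have "(norm a - \<eta>) * (1 + e) = norm a - \<eta> + (e * (norm a + 1) - e) - e * \<eta>" by (simp add: algebra_simps)
          ultimately show ?thesis unfolding e_eq by (simp add: field_simps)
        qed
        ultimately show ?thesis using \<open>e > 0\<close> unfolding norm_divide k(2) by (simp add: le_divide_eq)
      qed
      ultimately show ?case by blast
    qed
  qed
qed

lemma eventually_approximate_all:
  assumes f: "f holomorphic_on - H" "\<And>z. z \<in> - H \<Longrightarrow> norm (f z) \<le> 1"
    and lim: "(f \<longlongrightarrow> c) at_infinity" "((\<lambda>z. z * (f z - c)) \<longlongrightarrow> a) at_infinity"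
    and "\<eta> > 0"
  shows "\<forall>\<^sub>F n in sequentially. \<exists>F c' a'. F holomorphic_on - Hs n \<and> (\<forall>z\<in>- Hs n. norm (F z) \<le> 1) \<and>
      (F \<longlongrightarrow> c') at_infinity \<and> ((\<lambda>z. z * (F z - c')) \<longlongrightarrow> a') at_infinity \<and> norm a - \<eta> \<le> norm a'"
proof -
  have "\<Union>(components H - components H) \<union> (\<Union>D\<in>components H. D \<inter> Hs n) = Hs n" for n
    using Union_components[of H] Hs(3)[of n] by blast
  then show ?thesis using eventually_approximate[OF f lim subset_refl \<open>\<eta> > 0\<close>] by simp
qed

end

section \<open>Lower bounds for the Cauchy capacity\<close>

lemma cauchy_capacity_ge_0: "0 \<le> cauchy_capacity E"
proof -
  have "complex_borel_measure (\<lambda>_. 0)" "supported_on (\<lambda>_. 0) E"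
    by (simp_all add: complex_borel_measure_def supported_on_def)
  moreover have "cauchy_transform (\<lambda>_. 0) p = 0" for p
    by (cases p) (simp_all add: cauchy_transform_def complex_measure_integral_def signed_integral_def)
  ultimately show ?thesis unfolding cauchy_capacity_def by (intro SUP_upper2[of "\<lambda>_. 0"]) simp_all
qed

text \<open>A measure supported on \<open>F\<close> is also supported on \<open>E\<close>, and there
  its transform has to be bounded on a smaller set only.\<close>

lemma cauchy_capacity_mono:
  assumes "compact F" "compact E" "F \<subseteq> E"
  shows "cauchy_capacity F \<le> cauchy_capacity E"
  unfolding cauchy_capacity_def
proof (rule SUP_mono)
  fix \<nu> assume "\<nu> \<in> {\<nu>. complex_borel_measure \<nu> \<and> supported_on \<nu> F \<and>
                  (\<forall>z\<in>- Some ` F. cmod (cauchy_transform \<nu> z) \<le> 1)}"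
  then have \<nu>: "complex_borel_measure \<nu>" "supported_on \<nu> F"
    and bd: "\<And>z. z \<in> - Some ` F \<Longrightarrow> cmod (cauchy_transform \<nu> z) \<le> 1" by auto
  have sets: "F \<in> sets borel" "E - F \<in> sets borel" "F \<inter> (E - F) = {}"
    using borel_compact[OF assms(1)] borel_compact[OF assms(2)] by (auto intro: sets.Diff)
  note sgn = complex_borel_measure_Re_Im[OF \<nu>(1)]
  have "\<nu> (F \<union> (E - F)) = \<nu> F + \<nu> (E - F)"
    by (rule complex_eqI; unfold plus_complex.sel)
       (rule signed_borel_measure_Un[OF sgn(1) sets] signed_borel_measure_Un[OF sgn(2) sets])+
  moreover have "\<nu> (E - F) = 0" using \<nu>(2) sets unfolding supported_on_def by auto
  moreover have "F \<union> (E - F) = E" using assms(3) by blast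
  ultimately have "\<nu> E = \<nu> F" by simp
  moreover have "supported_on \<nu> E" using \<nu>(2) assms(3) unfolding supported_on_def by blast
  moreover have "\<forall>z\<in>- Some ` E. cmod (cauchy_transform \<nu> z) \<le> 1" using bd assms(3) by blast
  ultimately show "\<exists>\<nu>'\<in>{\<nu>. complex_borel_measure \<nu> \<and> supported_on \<nu> E \<and>
                  (\<forall>z\<in>- Some ` E. cmod (cauchy_transform \<nu> z) \<le> 1)}. ereal (cmod (\<nu> F)) \<le> ereal (cmod (\<nu>' E))"
    using \<nu>(1) by (intro bexI[of _ \<nu>]) auto
qed

lemma eventually_at_infinity_outside:
  assumes "bounded F" shows "\<forall>\<^sub>F z :: complex in at_infinity. z \<in> outside F"
proof -
  have "bounded (- outside F)" using assms by (rule cobounded_outside)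
  then obtain B where "\<And>z. z \<in> - outside F \<Longrightarrow> norm z \<le> B" unfolding bounded_iff by blast
  then show ?thesis unfolding eventually_at_infinity by (intro exI[of _ "B + 1"]) force
qed

text \<open>The Moebius transformation moving the value at infinity to the origin only increases
  the derivative there; it needs a value strictly inside the disc, whence the factor \<open>1 + e\<close>.\<close>

lemma cauchy_capacity_ge_of_bounded_function:
  assumes F: "finite_painleve_length F"
    and f: "f holomorphic_on outside F" "\<And>z. z \<in> outside F \<Longrightarrow> norm (f z) \<le> 1"
    and lim: "(f \<longlongrightarrow> c) at_infinity" "((\<lambda>z. z * (f z - c)) \<longlongrightarrow> a) at_infinity"
    and e: "e > 0"
  shows "ereal (norm a / (1 + e)) \<le> cauchy_capacity F"
proof (cases "F = {}")
  case True
  \<comment> \<open>With \<open>F\<close> empty, Liouville's theorem leaves only constants, whose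
    coefficient at infinity is 0.\<close>
  have "outside F = UNIV" using True by (simp add: outside_empty)
  then have "bounded (range f)" "f holomorphic_on UNIV" using f by (auto simp: bounded_iff)
  then have "f constant_on UNIV" using Liouville_theorem by blast
  then obtain d where d: "f = (\<lambda>_. d)" unfolding constant_on_def by auto
  have "((\<lambda>z::complex. d) \<longlongrightarrow> c) at_infinity" using lim(1) unfolding d .
  then have "d = c" by (metis tendsto_const tendsto_unique trivial_limit_at_infinity)
  then have "((\<lambda>z::complex. 0) \<longlongrightarrow> a) at_infinity" using lim(2) by (simp add: d)
  then have "a = 0" by (metis tendsto_const tendsto_unique trivial_limit_at_infinity)
  then show ?thesis using cauchy_capacity_ge_0 by (simp add: zero_ereal_def)
next
  case False
  have cF: "compact F" using F by (simp add: finite_painleve_length_def)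
  let ?k = "complex_of_real (1 + e)"
  have k: "?k \<noteq> 0" "norm ?k = 1 + e" using e by (auto simp del: of_real_add)
  define C where "C = c / ?k"
  define h where "h z = f z / ?k" for z
  \<comment> \<open>The disc automorphism taking \<open>C\<close> to 0, applied to \<open>h\<close>;
    its derivative at \<open>C\<close> is \<open>1 / (1 - (norm C)\<^sup>2)\<close>, which is at
    least 1.\<close>
  define \<phi> where "\<phi> z = (h z - C) / (1 - cnj C * h z)" for z
  have "norm c \<le> 1"
    using eventually_mono[OF eventually_at_infinity_outside[OF compact_imp_bounded[OF cF]] f(2)]
    by (intro Lim_norm_ubound[OF trivial_limit_at_infinity lim(1)])
  then have C: "norm C < 1" unfolding C_def norm_divide k(2) using e by (simp add: divide_less_eq)
  have h: "norm (h z) < 1" if "z \<in> outside F" for z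
    unfolding h_def norm_divide k(2) using f(2)[OF that] e by (simp add: divide_less_eq)
  have den: "1 - cnj C * w \<noteq> 0" if "norm w < 1" for w
  proof
    assume "1 - cnj C * w = 0"
    then have "norm (cnj C * w) = 1" by simp
    moreover have "norm (cnj C * w) < 1 * 1" unfolding norm_mult complex_mod_cnj
      using C that by (intro mult_strict_mono) auto
    ultimately show False by simp
  qed
  have "h holomorphic_on outside F"
    unfolding h_def[abs_def] by (intro holomorphic_on_divide holomorphic_on_const f k)
  then have "\<phi> holomorphic_on outside F"
    unfolding \<phi>_def[abs_def]
    by (intro holomorphic_on_divide holomorphic_on_diff holomorphic_on_mult holomorphic_on_const den h)
  have "norm (\<phi> z) \<le> 1" if "z \<in> outside F" for z
    using Moebius_function_norm_lt_1[OF C h[OF that], of 0] by (simp add: \<phi>_def Moebius_function_simple)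
  have hlim: "(h \<longlongrightarrow> C) at_infinity" unfolding h_def[abs_def] C_def by (intro tendsto_divide lim tendsto_const k)
  have "((\<lambda>z. z * (h z - C)) \<longlongrightarrow> a / ?k) at_infinity"
    using tendsto_divide[OF lim(2) tendsto_const k(1)] unfolding h_def C_def by (simp add: diff_divide_distrib right_diff_distrib)
  then have "((\<lambda>z. z * (h z - C) / (1 - cnj C * h z)) \<longlongrightarrow> a / ?k / (1 - cnj C * C)) at_infinity"
    using den[OF C] by (intro tendsto_divide tendsto_diff tendsto_mult tendsto_const hlim)
  then have "((\<lambda>z. z * \<phi> z) \<longlongrightarrow> a / ?k / (1 - cnj C * C)) at_infinity" by (simp add: \<phi>_def)
  then obtain \<nu> where \<nu>: "complex_borel_measure \<nu>" "supported_on \<nu> F" "\<nu> F = - (a / ?k / (1 - cnj C * C))"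
    "\<And>z. z \<in> outside F \<Longrightarrow> cauchy_transform \<nu> (Some z) = \<phi> z"
    "\<And>z. z \<in> inside F \<Longrightarrow> cauchy_transform \<nu> (Some z) = 0"
    using Cauchy_measure_of_bounded_function[OF F False \<open>\<phi> holomorphic_on outside F\<close>]
      \<open>\<And>z. z \<in> outside F \<Longrightarrow> norm (\<phi> z) \<le> 1\<close> by blast
  have "cmod (cauchy_transform \<nu> p) \<le> 1" if p: "p \<in> - Some ` F" for p
  proof (cases p)
    case None
    then show ?thesis by (simp add: cauchy_transform_def)
  next
    case (Some z)
    \<comment> \<open>The transform vanishes on the bounded components, so the bound 1 holds on the
      entire complement of \<open>F\<close>.\<close>
    then consider "z \<in> inside F" | "z \<in> outside F" using p inside_Un_outside[of F] by blast
    then show ?thesis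
      by cases (simp_all add: Some \<nu>(4,5) \<open>\<And>z. z \<in> outside F \<Longrightarrow> norm (\<phi> z) \<le> 1\<close>)
  qed
  moreover have "norm a / (1 + e) \<le> cmod (\<nu> F)"
  proof -
    have "1 - cnj C * C = of_real (1 - (norm C)\<^sup>2)"
      by (simp only: of_real_diff of_real_1 complex_norm_square mult.commute[of "cnj C"])
    moreover have n: "0 < 1 - (norm C)\<^sup>2" "1 - (norm C)\<^sup>2 \<le> 1" using C by (simp_all add: abs_square_less_1)
    ultimately have "norm (1 - cnj C * C) = 1 - (norm C)\<^sup>2" by (metis abs_of_pos norm_of_real)
    then have "cmod (\<nu> F) = norm a / (1 + e) / (1 - (norm C)\<^sup>2)" 
      unfolding \<nu>(3) norm_minus_cancel norm_divide k(2) by simp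
    moreover have "norm a / (1 + e) / 1 \<le> norm a / (1 + e) / (1 - (norm C)\<^sup>2)"
      using n e by (intro divide_left_mono) auto
    ultimately show ?thesis by simp
  qed
  ultimately show ?thesis unfolding cauchy_capacity_def using \<nu>(1,2) by (intro SUP_upper2[of \<nu>]) auto
qed

text \<open>\<open>deriv_at_infinity\<close> is defined by \<open>Lim\<close>, which carries
  information only if the limit exists; existence follows from differentiability at 0 in the chart
  at infinity.\<close>

lemma sphere_holomorphic_on_at_infinity:
  assumes E: "compact E" and f: "sphere_holomorphic_on f (outer_domain E)"
  shows "(\<lambda>z. f (Some z)) holomorphic_on outside E"
    and "((\<lambda>z. f (Some z)) \<longlongrightarrow> f None) at_infinity"
    and "((\<lambda>z. z * (f (Some z) - f None)) \<longlongrightarrow> deriv_at_infinity f) at_infinity"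
proof -
  define V where "V = chart_at_infinity -` outer_domain E"
  define g where "g = f \<circ> chart_at_infinity"
  show "(\<lambda>z. f (Some z)) holomorphic_on outside E"
    using f unfolding sphere_holomorphic_on_def vimage_Some_outer_domain[OF E] by (simp add: o_def)
  have "open V" "0 \<in> V" unfolding V_def using open_vimage_chart_outer_domain[OF E] vimage_chart_outer_domain[OF E] by auto
  moreover have "g holomorphic_on V" using f by (simp add: sphere_holomorphic_on_def V_def g_def)
  ultimately have "(g has_field_derivative deriv g 0) (at 0)" by (rule holomorphic_derivI[rotated 1])
  then have "((\<lambda>w. (g w - g 0) / w) \<longlongrightarrow> deriv g 0) (at 0)" by (simp add: has_field_derivative_iff)
  moreover have "filterlim (inverse :: complex \<Rightarrow> complex) (at 0) at_infinity"
    using filterlim_inverse_at_iff[of "\<lambda>x. x" at_infinity] by (simp add: filterlim_ident)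
  ultimately have *: "((\<lambda>z. (g (inverse z) - g 0) / inverse z) \<longlongrightarrow> deriv g 0) at_infinity"
    by (rule filterlim_compose)
  have "\<forall>\<^sub>F z :: complex in at_infinity. (g (inverse z) - g 0) / inverse z = z * (f (Some z) - f None)"
    unfolding eventually_at_infinity g_def chart_at_infinity_def
    by (intro exI[of _ 1]) (auto simp: divide_inverse mult.commute)
  then have lim: "((\<lambda>z. z * (f (Some z) - f None)) \<longlongrightarrow> deriv g 0) at_infinity"
    using * by (rule Lim_transform_eventually[rotated])
  then show "((\<lambda>z. z * (f (Some z) - f None)) \<longlongrightarrow> deriv_at_infinity f) at_infinity"
    unfolding deriv_at_infinity_def using tendsto_Lim[OF trivial_limit_at_infinity lim] by simp
  show "((\<lambda>z. f (Some z)) \<longlongrightarrow> f None) at_infinity"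
    by (rule LIM_zero_cancel[OF tendsto_zero_of_times_ident[OF lim]])
qed

section \<open>Equality of the two capacities\<close>

theorem theorem1p4:
  fixes E :: "complex set" and Es :: "nat \<Rightarrow> complex set"
  assumes "compact E"
    and "\<And>k. compact (Es k)" and "\<And>k. Es k \<subseteq> E"
    and "\<And>k. finite_painleve_length (Es k)"
    and "\<exists>m. nondegenerate_connected_domain m (outer_domain E) \<and>
             (\<forall>k. nondegenerate_connected_domain m (outer_domain (Es k)))"
    and "caratheodory_converges (\<lambda>k. outer_domain (Es k)) (outer_domain E)"
  shows "analytic_capacity E = cauchy_capacity E"
proof (rule antisym)
  note E = assms(1) and Es = assms(2,3)
  obtain m where m: "nondegenerate_connected_domain m (outer_domain E)"
    "\<And>k. nondegenerate_connected_domain m (outer_domain (Es k))" using assms(5) by blast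
  note comps = nondegenerate_connected_domain_components[OF E m(1)]
  note comps_k = nondegenerate_connected_domain_components[OF Es(1) m(2)]
  have conn: "connected (outside X)" if "compact X" for X :: "complex set"
    using that compact_imp_bounded by (intro connected_outside) auto
  \<comment> \<open>The sets compared are the complements of the unbounded domains; their components
    are those counted in the definition of connectivity.\<close>
  have sub: "- outside (Es k) \<subseteq> - outside E" for k using outside_mono[OF Es(2)] by blast
  have meets: "\<forall>\<^sub>F k in sequentially. ball p e \<inter> - outside (Es k) \<noteq> {}"
    if "p \<in> frontier (- outside E)" "e > 0" for p e
    using caratheodory_converges_approach[OF E Es assms(6)] that by (simp add: frontier_complement)
  have "\<forall>\<^sub>F k in sequentially. \<forall>L\<in>components (- outside E).
      L \<inter> - outside (Es k) \<in> components (- outside (Es k))"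
    using comps comps_k by (intro eventually_components_correspond compact_Compl_outside E sub meets) auto
  then obtain N where N: "\<And>k L. k \<ge> N \<Longrightarrow> L \<in> components (- outside E) \<Longrightarrow>
      L \<inter> - outside (Es k) \<in> components (- outside (Es k))"
    unfolding eventually_sequentially by blast
  interpret component_approximation "- outside E" "\<lambda>n. - outside (Es (n + N))"
  proof
    show "\<forall>\<^sub>F n in sequentially. ball p e \<inter> - outside (Es (n + N)) \<noteq> {}"
      if "p \<in> frontier (- outside E)" "e > 0" for p e
      using sequentially_offset[OF meets[OF that]] .
    show "connected (- (- outside E))" using conn[OF E] by simp
    show "connected (- (- outside (Es (n + N))))" for n using conn[OF Es(1)] by simp
    show "L \<inter> - outside (Es (n + N)) \<in> components (- outside (Es (n + N)))"
      if "L \<in> components (- outside E)" for n L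
      by (rule N[OF _ that]) simp
  qed (fact compact_Compl_outside[OF E] compact_Compl_outside[OF Es(1)] comps sub)+
  show "analytic_capacity E \<le> cauchy_capacity E"
    unfolding analytic_capacity_def
  proof (rule SUP_least)
    fix f assume "f \<in> {f \<in> H_infinity (outer_domain E). \<forall>z\<in>outer_domain E. cmod (f z) \<le> 1}"
    then have f: "sphere_holomorphic_on f (outer_domain E)" and "\<And>z. z \<in> outer_domain E \<Longrightarrow> cmod (f z) \<le> 1"
      by (auto simp: H_infinity_def)
    then have bd: "cmod (f (Some z)) \<le> 1" if "z \<in> outside E" for z
      using that by (simp add: outer_domain_eq[OF E])
    note S = sphere_holomorphic_on_at_infinity[OF E f]
    \<comment> \<open>For fixed \<open>\<eta>\<close> a single index \<open>n + N\<close> is used: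
      monotonicity of the Cauchy capacity moves the bound from \<open>Es (n + N)\<close> to
      \<open>E\<close>, and only then does \<open>\<eta>\<close> tend to 0.\<close>
    have bound: "ereal ((cmod (deriv_at_infinity f) - \<eta>) / (1 + \<eta>)) \<le> cauchy_capacity E" if \<eta>: "\<eta> > 0" for \<eta>
    proof -
      have "(\<lambda>z. f (Some z)) holomorphic_on - (- outside E)" "\<And>z. z \<in> - (- outside E) \<Longrightarrow> cmod (f (Some z)) \<le> 1"
        using S(1) bd by simp_all
      from eventually_happens'[OF sequentially_bot eventually_approximate_all[OF this S(2,3) \<eta>]]
      obtain n F c a where F: "F holomorphic_on outside (Es (n + N))"
        "\<And>z. z \<in> outside (Es (n + N)) \<Longrightarrow> norm (F z) \<le> 1" "(F \<longlongrightarrow> c) at_infinity"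
        "((\<lambda>z. z * (F z - c)) \<longlongrightarrow> a) at_infinity" "cmod (deriv_at_infinity f) - \<eta> \<le> norm a"
        unfolding double_complement by blast
      have "(cmod (deriv_at_infinity f) - \<eta>) / (1 + \<eta>) \<le> norm a / (1 + \<eta>)"
        using F(5) \<eta> by (intro divide_right_mono) auto
      also have "ereal (norm a / (1 + \<eta>)) \<le> cauchy_capacity (Es (n + N))"
        by (rule cauchy_capacity_ge_of_bounded_function[OF assms(4) F(1-4) \<eta>])
      also have "\<dots> \<le> cauchy_capacity E" by (rule cauchy_capacity_mono[OF Es(1) E Es(2)])
      finally show ?thesis by simp
    qed
    have "((\<lambda>\<eta>. (cmod (deriv_at_infinity f) - \<eta>) / (1 + \<eta>)) \<longlongrightarrow> (cmod (deriv_at_infinity f) - 0) / (1 + 0)) (at_right 0)"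
      by (intro tendsto_intros) auto
    then have "((\<lambda>\<eta>. ereal ((cmod (deriv_at_infinity f) - \<eta>) / (1 + \<eta>))) \<longlongrightarrow> ereal (cmod (deriv_at_infinity f))) (at_right 0)"
      by simp
    then show "ereal (cmod (deriv_at_infinity f)) \<le> cauchy_capacity E"
      by (rule tendsto_upperbound) (auto intro: eventually_mono[OF eventually_at_right_less] bound)
  qed
  show "cauchy_capacity E \<le> analytic_capacity E" by (rule cauchy_capacity_le_analytic_capacity[OF E])
qed

end
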